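(* Let $B(t)$, $t\ge 0$, be a standard Brownian motion, let $W_0(t)=B(t)$ and $W_n(t)=\int_0^t W_{n-1}(s)\,ds$ for $n\ge 1$, and for each integer $n\ge 0$ define $$X_n(t)=e^{-(n+\frac12)t}\,W_n(e^t),\qquad t\in\mathbb{R}.$$ Then the processes $X_n(t)$, $n\ge 0$, are jointly Gaussian and jointly stationary. Furthermore, there is a Gaussian random spectral measure $\zeta$ on $\mathbb{R}$ (the same for all $n$), with $E\,\zeta(dv)\overline{\zeta(dv')}=2\pi\,\delta_{vv'}\,dv$, such that for every $n\ge 0$ the process $X_n$ has the spectral representation $$X_n(t)=\frac{1}{2\pi}\int_{-\infty}^{\infty}H_n(v)\,e^{ivt}\,\zeta(dv),\qquad t\in\mathbb{R},$$ where $$H_n(v)=\prod_{k=0}^{n}\frac{1}{k+\frac12+iv}.$$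
   Context: The process $W_n$ is called $n$-fold integrated Brownian motion. The notation $E\,\zeta(dv)\overline{\zeta(dv')}=2\pi\,\delta_{vv'}\,dv$ means that $\zeta$ is a mean-zero complex Gaussian random measure with orthogonal increments and control measure $2\pi\,dv$, i.e. $E\big[\int f\,d\zeta\;\overline{\int g\,d\zeta}\big]=2\pi\int_{-\infty}^\infty f(v)\overline{g(v)}\,dv$ for $f,g\in L^2(\mathbb{R})$; it is the (Fourier) spectral measure of a real Gaussian white noise $Z(ds)$ on $\mathbb{R}$ (independent Gaussian increments with $E[Z(t)-Z(s)]^2=|t-s|$). Jointly stationary means that the finite-dimensional distributions of the vector process $(X_0(t),\dots,X_n(t))_{t\in\mathbb{R}}$ are invariant under time shifts, for every $n$. *)

theory Defs
  imports "HOL-Probability.Probability"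
begin

(* Point masses count as Gaussian (variance 0), as needed for linear combinations. *)
definition gaussian_rv :: "'a measure \<Rightarrow> ('a \<Rightarrow> real) \<Rightarrow> bool" where
  "gaussian_rv M X \<longleftrightarrow> X \<in> borel_measurable M \<and>
     (\<exists>\<mu>. (AE \<omega> in M. X \<omega> = \<mu>) \<or>
          (\<exists>\<sigma>>0. distributed M lborel X (normal_density \<mu> \<sigma>)))"

definition jointly_gaussian :: "'a measure \<Rightarrow> 'i set \<Rightarrow> ('i \<Rightarrow> 'a \<Rightarrow> real) \<Rightarrow> bool" where
  "jointly_gaussian M I X \<longleftrightarrow>
     (\<forall>F c. finite F \<and> F \<subseteq> I \<longrightarrow> gaussian_rv M (\<lambda>\<omega>. \<Sum>i\<in>F. c i * X i \<omega>))"

definition jointly_stationary :: "'a measure \<Rightarrow> (nat \<Rightarrow> real \<Rightarrow> 'a \<Rightarrow> real) \<Rightarrow> bool" where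
  "jointly_stationary M X \<longleftrightarrow>
     (\<forall>n t. X n t \<in> borel_measurable M) \<and>
     (\<forall>(N::nat) (T::real set) (h::real). finite T \<longrightarrow>
        distr M (PiM ({..N} \<times> T) (\<lambda>_. borel))
          (\<lambda>\<omega>. \<lambda>(n, t) \<in> {..N} \<times> T. X n (t + h) \<omega>) =
        distr M (PiM ({..N} \<times> T) (\<lambda>_. borel))
          (\<lambda>\<omega>. \<lambda>(n, t) \<in> {..N} \<times> T. X n t \<omega>))"

(* Only the values Z t with t in the time set T matter. *)
definition independent_gaussian_increments ::
    "'a measure \<Rightarrow> real set \<Rightarrow> (real \<Rightarrow> 'a \<Rightarrow> real) \<Rightarrow> bool" where
  "independent_gaussian_increments M T Z \<longleftrightarrow>
     (\<forall>t\<in>T. Z t \<in> borel_measurable M) \<and>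
     (\<forall>s\<in>T. \<forall>t\<in>T. s < t \<longrightarrow>
        distributed M lborel (\<lambda>\<omega>. Z t \<omega> - Z s \<omega>) (normal_density 0 (sqrt (t - s)))) \<and>
     (\<forall>(m::nat) \<tau>. (\<forall>i\<le>m. \<tau> i \<in> T) \<and> (\<forall>i<m. \<tau> i < \<tau> (Suc i)) \<longrightarrow>
        prob_space.indep_vars M (\<lambda>_. borel)
          (\<lambda>i \<omega>. Z (\<tau> (Suc i)) \<omega> - Z (\<tau> i) \<omega>) {..<m})"

definition standard_brownian_motion :: "'a measure \<Rightarrow> (real \<Rightarrow> 'a \<Rightarrow> real) \<Rightarrow> bool" where
  "standard_brownian_motion M B \<longleftrightarrow>
     (AE \<omega> in M. B 0 \<omega> = 0) \<and>
     independent_gaussian_increments M {0..} B \<and>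
     (\<forall>\<omega>\<in>space M. continuous_on {0..} (\<lambda>t. B t \<omega>))"

primrec integrated_bm :: "(real \<Rightarrow> 'a \<Rightarrow> real) \<Rightarrow> nat \<Rightarrow> real \<Rightarrow> 'a \<Rightarrow> real" where
  "integrated_bm B 0 t \<omega> = B t \<omega>"
| "integrated_bm B (Suc n) t \<omega> = integral {0..t} (\<lambda>s. integrated_bm B n s \<omega>)"

definition rescaled_integrated_bm ::
    "(real \<Rightarrow> 'a \<Rightarrow> real) \<Rightarrow> nat \<Rightarrow> real \<Rightarrow> 'a \<Rightarrow> real" where
  "rescaled_integrated_bm B n t \<omega> =
     exp (- (real n + 1/2) * t) * integrated_bm B n (exp t) \<omega>"

definition spectral_kernel :: "nat \<Rightarrow> real \<Rightarrow> complex" where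
  "spectral_kernel n v = (\<Prod>k=0..n. 1 / (of_nat k + 1/2 + \<i> * of_real v))"

definition finite_sets :: "real measure \<Rightarrow> real set set" where
  "finite_sets \<nu> = {A \<in> sets \<nu>. emeasure \<nu> A < \<infinity>}"

(* Y is a version of the stochastic integral of f against the random set function \<zeta> with
   control measure \<nu>: the L2-limit of the elementary integrals of simple functions that
   converge to f in L2(\<nu>). Errors are nn_integrals, so that convergence to 0 entails
   square-integrability of f and Y. *)
definition has_random_integral ::
    "'a measure \<Rightarrow> real measure \<Rightarrow> (real set \<Rightarrow> 'a \<Rightarrow> complex) \<Rightarrow> (real \<Rightarrow> complex)
      \<Rightarrow> ('a \<Rightarrow> complex) \<Rightarrow> bool" where
  "has_random_integral M \<nu> \<zeta> f Y \<longleftrightarrow>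
     f \<in> borel_measurable \<nu> \<and> Y \<in> borel_measurable M \<and>
     (\<exists>(m :: nat \<Rightarrow> nat) (c :: nat \<Rightarrow> nat \<Rightarrow> complex) (A :: nat \<Rightarrow> nat \<Rightarrow> real set).
        (\<forall>k. \<forall>i<m k. A k i \<in> finite_sets \<nu>) \<and>
        (\<lambda>k. \<integral>\<^sup>+ v. ennreal ((norm (f v - (\<Sum>i<m k. c k i * indicator (A k i) v)))\<^sup>2) \<partial>\<nu>)
          \<longlonglongrightarrow> 0 \<and>
        (\<lambda>k. \<integral>\<^sup>+ \<omega>. ennreal ((norm (Y \<omega> - (\<Sum>i<m k. c k i * \<zeta> (A k i) \<omega>)))\<^sup>2) \<partial>M)
          \<longlonglongrightarrow> 0)"

(* Mean-zero complex Gaussian random measure with orthogonal increments and control measure \<nu>.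
   Gaussian means that the real and imaginary parts are jointly Gaussian (no circular symmetry
   is asked for: the spectral measure of a real process satisfies \<zeta>(-A) = cnj (\<zeta> A)).
   For indicators f and g the isometry reads E[\<zeta>(A) cnj (\<zeta>(B))] = \<nu>(A \<inter> B). *)
definition gaussian_random_measure ::
    "'a measure \<Rightarrow> real measure \<Rightarrow> (real set \<Rightarrow> 'a \<Rightarrow> complex) \<Rightarrow> bool" where
  "gaussian_random_measure M \<nu> \<zeta> \<longleftrightarrow>
     (\<forall>A\<in>finite_sets \<nu>. \<zeta> A \<in> borel_measurable M \<and>
        integrable M (\<lambda>\<omega>. (norm (\<zeta> A \<omega>))\<^sup>2) \<and> (LINT \<omega>|M. \<zeta> A \<omega>) = 0) \<and>
     jointly_gaussian M (finite_sets \<nu> \<times> (UNIV :: bool set))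
       (\<lambda>(A, b) \<omega>. if b then Re (\<zeta> A \<omega>) else Im (\<zeta> A \<omega>)) \<and>
     (\<forall>A :: nat \<Rightarrow> real set.
        range A \<subseteq> finite_sets \<nu> \<and> disjoint_family A \<and> (\<Union>i. A i) \<in> finite_sets \<nu> \<longrightarrow>
        (\<lambda>k. \<integral>\<^sup>+ \<omega>. ennreal ((norm (\<zeta> (\<Union>i. A i) \<omega> - (\<Sum>i<k. \<zeta> (A i) \<omega>)))\<^sup>2) \<partial>M)
          \<longlonglongrightarrow> 0) \<and>
     (\<forall>f g Y Y'. has_random_integral M \<nu> \<zeta> f Y \<and> has_random_integral M \<nu> \<zeta> g Y' \<longrightarrow>
        (LINT \<omega>|M. Y \<omega> * cnj (Y' \<omega>)) = (LINT v|\<nu>. f v * cnj (g v)))"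

definition spectral_control :: "real measure" where
  "spectral_control = scale_measure (ennreal (2 * pi)) lborel"

(* Z is the distribution function of the white noise Z(ds), and \<zeta> its Fourier spectral measure:
   Z(ds) = 1/(2 pi) (\<integral> e^(ivs) \<zeta>(dv)) ds, integrated over s \<le> u \<le> t. *)
definition white_noise_spectral_measure ::
    "'a measure \<Rightarrow> (real \<Rightarrow> 'a \<Rightarrow> real) \<Rightarrow> (real set \<Rightarrow> 'a \<Rightarrow> complex) \<Rightarrow> bool" where
  "white_noise_spectral_measure M Z \<zeta> \<longleftrightarrow>
     independent_gaussian_increments M UNIV Z \<and>
     (\<forall>s t. s < t \<longrightarrow>
        (\<exists>Y. has_random_integral M spectral_control \<zeta>
               (\<lambda>v. integral {s..t} (\<lambda>u. exp (\<i> * of_real (v * u)))) Y \<and>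
             (AE \<omega> in M. of_real (Z t \<omega> - Z s \<omega>) = 1 / (2 * of_real pi) * Y \<omega>)))"

definition gaussian_spectral_measure ::
    "'a measure \<Rightarrow> (real set \<Rightarrow> 'a \<Rightarrow> complex) \<Rightarrow> bool" where
  "gaussian_spectral_measure M \<zeta> \<longleftrightarrow>
     gaussian_random_measure M spectral_control \<zeta> \<and>
     (\<exists>Z. white_noise_spectral_measure M Z \<zeta>)"

end

theory Submission
  imports Defs
begin

text \<open>\<open>X\<^sub>0(t) = e^(-t/2) B(e^t)\<close> is the Ornstein-Uhlenbeck process: a centered Gaussian process with
covariance \<open>e^(-\<bar>s - t\<bar>/2)\<close>. On the spectral side, the functions \<open>h\<^sub>t(v) = H\<^sub>0(v) e^(ivt)\<close> in
\<open>L\<^sup>2(2\<pi> dv)\<close> have, up to the factor \<open>4\<pi>\<^sup>2\<close>, the same Gram matrix, because \<open>\<bar>H\<^sub>0(v)\<bar>\<^sup>2 = 1/(1/4 + v\<^sup>2)\<close>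
is the Fourier transform of \<open>e^(-\<bar>x\<bar>/2)\<close> (\<open>Cauchy_density_transform\<close>). Hence \<open>h\<^sub>t \<mapsto> 2\<pi> X\<^sub>0(t)\<close> extends
to a linear isometry from the closed span of the \<open>h\<^sub>t\<close> into \<open>L\<^sup>2(M)\<close>. That span is everything: a function
orthogonal to all \<open>h\<^sub>t\<close> has, after multiplication by \<open>cnj H\<^sub>0\<close>, a vanishing Fourier transform
(\<open>spectral_waves_total\<close>). The random measure is the image of the indicators, and the stochastic integral
against it is the isometry itself.

The isometry is kept as a relation \<open>paired f Y\<close>, the closure of the pairs of corresponding finite combinations
of generators. This relation is linear, isometric and closed under mean-square limits, hence under integration in a
parameter (\<open>paired_integral\<close>). Everything else follows from these properties:

\<^item> \<open>X\<^sub>n\<close> arises from \<open>X\<^sub>n\<^sub>-\<^sub>1\<close> by integrating over a time parameter, and the same operation on the spectral side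
multiplies the kernel by \<open>1/(n + 1/2 + iv)\<close>. So \<open>H\<^sub>n(v) e^(ivt)\<close> is paired with \<open>2\<pi> X\<^sub>n(t)\<close>, by induction on \<open>n\<close>
(\<open>paired_X\<close>).

\<^item> The white noise needs no stochastic integral: as \<open>1/H\<^sub>0(v) = 1/2 + iv\<close>, the function \<open>\<integral>\<^sub>s\<^sup>t e^(ivu) du\<close> is paired with
\<open>2\<pi>\<close> times \<open>X\<^sub>0(t) - X\<^sub>0(s) + 1/2 \<integral>\<^sub>s\<^sup>t X\<^sub>0(u) du\<close>, which is defined pathwise.

\<^item> Real parts of paired variables are \<open>L\<^sup>2\<close>-limits of Gaussian variables, hence Gaussian, so all laws are determined
by second moments, which the isometry computes. A time shift multiplies the spectral functions by the unimodular
\<open>e^(ivh)\<close> and changes no second moment, which gives stationarity; orthogonality gives independence. Both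
conclusions rest on the Cramer-Wold theorem, proved below from the uniqueness theorem for characteristic functions
on the line.\<close>

section \<open>Square-integrable complex functions\<close>

definition L2 :: "'a measure \<Rightarrow> ('a \<Rightarrow> complex) set" where
  "L2 M = {f \<in> borel_measurable M. integrable M (\<lambda>x. (cmod (f x))\<^sup>2)}"

definition norm2 :: "'a measure \<Rightarrow> ('a \<Rightarrow> complex) \<Rightarrow> real" where
  "norm2 M f = sqrt (LINT x|M. (cmod (f x))\<^sup>2)"

definition inner2 :: "'a measure \<Rightarrow> ('a \<Rightarrow> complex) \<Rightarrow> ('a \<Rightarrow> complex) \<Rightarrow> complex" where
  "inner2 M f g = (LINT x|M. f x * cnj (g x))"

abbreviation L2_lim :: "'a measure \<Rightarrow> (nat \<Rightarrow> 'a \<Rightarrow> complex) \<Rightarrow> ('a \<Rightarrow> complex) \<Rightarrow> bool" where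
  "L2_lim M f g \<equiv> (\<lambda>k. norm2 M (\<lambda>x. f k x - g x)) \<longlonglongrightarrow> 0"

lemma borel_measurable_cnj [measurable]: "cnj \<in> borel_measurable borel"
  by (intro borel_measurable_continuous_onI continuous_intros)

lemma L2_measurable [measurable_dest]: "f \<in> L2 M \<Longrightarrow> f \<in> borel_measurable M"
  by (simp add: L2_def)

lemma L2_integrable: "f \<in> L2 M \<Longrightarrow> integrable M (\<lambda>x. (cmod (f x))\<^sup>2)"
  by (simp add: L2_def)

lemma L2_bound:
  assumes "f \<in> borel_measurable M" "integrable M D" "AE x in M. (cmod (f x))\<^sup>2 \<le> D x"
  shows "f \<in> L2 M"
proof -
  have "integrable M (\<lambda>x. (cmod (f x))\<^sup>2)"
    by (rule Bochner_Integration.integrable_bound[OF assms(2)]) (use assms in auto)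
  then show ?thesis using assms by (simp add: L2_def)
qed

lemma cmod_add_sq_le: "(cmod (a + b))\<^sup>2 \<le> 2 * (cmod a)\<^sup>2 + 2 * (cmod b)\<^sup>2"
proof -
  have "(cmod (a + b))\<^sup>2 \<le> (cmod a + cmod b)\<^sup>2"
    by (intro power_mono norm_triangle_ineq) auto
  also have "\<dots> \<le> 2 * (cmod a)\<^sup>2 + 2 * (cmod b)\<^sup>2"
    using sum_squares_bound[of "cmod a" "cmod b"] by (simp add: power2_sum)
  finally show ?thesis .
qed

lemma L2_cmult [intro]: "f \<in> L2 M \<Longrightarrow> (\<lambda>x. c * f x) \<in> L2 M"
  by (auto simp: L2_def norm_mult power_mult_distrib)

lemma L2_add [intro]:
  assumes "f \<in> L2 M" "g \<in> L2 M" shows "(\<lambda>x. f x + g x) \<in> L2 M"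
proof (rule L2_bound)
  show "integrable M (\<lambda>x. 2 * (cmod (f x))\<^sup>2 + 2 * (cmod (g x))\<^sup>2)"
    using assms by (auto simp: L2_def)
qed (use assms in \<open>auto simp: L2_def cmod_add_sq_le\<close>)

lemma L2_diff [intro]: "f \<in> L2 M \<Longrightarrow> g \<in> L2 M \<Longrightarrow> (\<lambda>x. f x - g x) \<in> L2 M"
  using L2_add[OF _ L2_cmult[of g M "-1"]] by simp

lemma L2_zero [simp]: "(\<lambda>x. 0) \<in> L2 M"
  by (simp add: L2_def)

lemma L2_mult_integrable:
  assumes "f \<in> L2 M" "g \<in> L2 M"
  shows "integrable M (\<lambda>x. f x * cnj (g x))"
proof (rule Bochner_Integration.integrable_bound)
  show "integrable M (\<lambda>x. (cmod (f x))\<^sup>2 + (cmod (g x))\<^sup>2)"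
    using assms by (auto simp: L2_def)
  have "a * b \<le> a\<^sup>2 + b\<^sup>2" if "a \<ge> 0" "b \<ge> 0" for a b :: real
    using sum_squares_bound[of a b] mult_nonneg_nonneg[OF that] by linarith
  then show "AE x in M. cmod (f x * cnj (g x)) \<le> norm ((cmod (f x))\<^sup>2 + (cmod (g x))\<^sup>2)"
    by (auto simp: norm_mult)
qed (use assms in \<open>auto simp: L2_def\<close>)

lemma norm2_nonneg [simp]: "0 \<le> norm2 M f"
  by (simp add: norm2_def)

lemma norm2_sq: "(norm2 M f)\<^sup>2 = (LINT x|M. (cmod (f x))\<^sup>2)"
  by (simp add: norm2_def)

lemma inner2_self: "inner2 M f f = complex_of_real ((norm2 M f)\<^sup>2)"
  unfolding inner2_def norm2_sq integral_complex_of_real[symmetric] complex_norm_square ..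

lemma nn_integral_norm2:
  "f \<in> L2 M \<Longrightarrow> (\<integral>\<^sup>+x. ennreal ((cmod (f x))\<^sup>2) \<partial>M) = ennreal ((norm2 M f)\<^sup>2)"
  by (subst nn_integral_eq_integral) (auto simp: L2_def norm2_sq)

lemma L2I_nn_integral:
  assumes "f \<in> borel_measurable M" "(\<integral>\<^sup>+x. ennreal ((cmod (f x))\<^sup>2) \<partial>M) < \<infinity>"
  shows "f \<in> L2 M"
  using assms by (auto simp: L2_def intro!: integrableI_bounded)

lemma inner2_add_left:
  "f \<in> L2 M \<Longrightarrow> g \<in> L2 M \<Longrightarrow> h \<in> L2 M \<Longrightarrow>
    inner2 M (\<lambda>x. f x + g x) h = inner2 M f h + inner2 M g h"
  by (simp add: inner2_def distrib_right L2_mult_integrable)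

lemma inner2_cmult_left: "inner2 M (\<lambda>x. c * f x) h = c * inner2 M f h"
  by (simp add: inner2_def mult.assoc)

lemma inner2_commute: "inner2 M f g = cnj (inner2 M g f)"
proof -
  have "cnj (inner2 M g f) = (LINT x|M. cnj (g x * cnj (f x)))"
    unfolding inner2_def by (rule Bochner_Integration.integral_cnj[symmetric])
  also have "\<dots> = inner2 M f g" unfolding inner2_def by (simp only: complex_cnj_mult complex_cnj_cnj mult.commute)
  finally show ?thesis ..
qed

lemma inner2_add_right:
  assumes "f \<in> L2 M" "g \<in> L2 M" "h \<in> L2 M"
  shows "inner2 M h (\<lambda>x. f x + g x) = inner2 M h f + inner2 M h g"
  using assms by (simp add: inner2_commute[of M h] inner2_add_left)

lemma inner2_cmult_right: "inner2 M h (\<lambda>x. c * f x) = cnj c * inner2 M h f"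
  by (simp add: inner2_commute[of M h] inner2_cmult_left)

lemma norm2_add_sq:
  assumes "f \<in> L2 M" "g \<in> L2 M"
  shows "(norm2 M (\<lambda>x. f x + g x))\<^sup>2 = (norm2 M f)\<^sup>2 + (norm2 M g)\<^sup>2 + 2 * Re (inner2 M f g)"
proof -
  have "complex_of_real ((norm2 M (\<lambda>x. f x + g x))\<^sup>2) =
    inner2 M f f + inner2 M g g + (inner2 M f g + cnj (inner2 M f g))"
    unfolding inner2_self[symmetric] inner2_commute[of M f g, THEN arg_cong[of _ _ cnj]]
    using assms by (simp add: inner2_add_left inner2_add_right L2_add)
  then have "Re (complex_of_real ((norm2 M (\<lambda>x. f x + g x))\<^sup>2)) =
    Re (inner2 M f f + inner2 M g g + (inner2 M f g + cnj (inner2 M f g)))" by (rule arg_cong)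
  then show ?thesis by (simp add: inner2_self del: of_real_power)
qed

lemma norm2_cmult: "norm2 M (\<lambda>x. c * f x) = cmod c * norm2 M f"
  by (simp add: norm2_def norm_mult power_mult_distrib real_sqrt_mult)

lemma norm2_minus_commute: "norm2 M (\<lambda>x. f x - g x) = norm2 M (\<lambda>x. g x - f x)"
  by (simp add: norm2_def norm_minus_commute)

lemma integral_cmod_mult_le:
  assumes "f \<in> L2 M" "g \<in> L2 M"
  shows "(LINT x|M. cmod (f x) * cmod (g x)) \<le> norm2 M f * norm2 M g"
proof -
  have int: "integrable M (\<lambda>x. cmod (f x) * cmod (g x))"
    using integrable_norm[OF L2_mult_integrable[OF assms]] by (simp add: norm_mult)
  have "ennreal ((LINT x|M. cmod (f x) * cmod (g x))\<^sup>2) = (\<integral>\<^sup>+x. ennreal (cmod (f x)) * ennreal (cmod (g x)) \<partial>M)\<^sup>2"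
    using nn_integral_eq_integral[OF int] by (simp add: ennreal_mult ennreal_power)
  also have "\<dots> \<le> (\<integral>\<^sup>+x. (ennreal (cmod (f x)))\<^sup>2 \<partial>M) * (\<integral>\<^sup>+x. (ennreal (cmod (g x)))\<^sup>2 \<partial>M)"
    using assms by (intro Cauchy_Schwarz_nn_integral) (auto simp: L2_def)
  also have "\<dots> = ennreal ((norm2 M f)\<^sup>2 * (norm2 M g)\<^sup>2)"
    using assms by (simp add: ennreal_power nn_integral_norm2 ennreal_mult del: ennreal_power[symmetric])
  finally have "(LINT x|M. cmod (f x) * cmod (g x))\<^sup>2 \<le> (norm2 M f * norm2 M g)\<^sup>2"
    by (simp add: power_mult_distrib)
  then show ?thesis by (rule power2_le_imp_le) simp
qed

lemma norm2_Cauchy_Schwarz: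
  assumes "f \<in> L2 M" "g \<in> L2 M"
  shows "cmod (inner2 M f g) \<le> norm2 M f * norm2 M g"
proof -
  have "cmod (inner2 M f g) \<le> (LINT x|M. cmod (f x * cnj (g x)))"
    unfolding inner2_def by (rule integral_norm_bound)
  also have "\<dots> = (LINT x|M. cmod (f x) * cmod (g x))" by (simp add: norm_mult)
  finally show ?thesis using integral_cmod_mult_le[OF assms] by simp
qed

lemma norm2_triangle:
  assumes "f \<in> L2 M" "g \<in> L2 M"
  shows "norm2 M (\<lambda>x. f x + g x) \<le> norm2 M f + norm2 M g"
proof (rule power2_le_imp_le)
  have "Re (inner2 M f g) \<le> norm2 M f * norm2 M g"
    using complex_Re_le_cmod[of "inner2 M f g"] norm2_Cauchy_Schwarz[OF assms] by linarith
  then show "(norm2 M (\<lambda>x. f x + g x))\<^sup>2 \<le> (norm2 M f + norm2 M g)\<^sup>2"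
    by (simp add: norm2_add_sq[OF assms] power2_sum)
qed simp

lemma norm2_triangle_via:
  assumes "f \<in> L2 M" "g \<in> L2 M" "h \<in> L2 M"
  shows "norm2 M (\<lambda>x. f x - h x) \<le> norm2 M (\<lambda>x. f x - g x) + norm2 M (\<lambda>x. g x - h x)"
  using norm2_triangle[OF L2_diff[OF assms(1,2)] L2_diff[OF assms(2,3)]] by simp

lemma norm2_diff_abs:
  assumes "f \<in> L2 M" "g \<in> L2 M"
  shows "\<bar>norm2 M f - norm2 M g\<bar> \<le> norm2 M (\<lambda>x. f x - g x)"
  using norm2_triangle_via[OF assms L2_zero] norm2_triangle_via[OF assms(2,1) L2_zero]
  by (simp add: norm2_minus_commute[of M f g])

lemma norm2_tendsto:
  assumes "\<And>k. f k \<in> L2 M" "g \<in> L2 M" "L2_lim M f g"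
  shows "(\<lambda>k. norm2 M (f k)) \<longlonglongrightarrow> norm2 M g"
proof -
  have "(\<lambda>k. norm2 M (f k) - norm2 M g) \<longlonglongrightarrow> 0"
    by (rule Lim_null_comparison[OF _ assms(3)]) (simp add: norm2_diff_abs assms(1,2))
  then show ?thesis by (simp add: LIM_zero_iff)
qed

lemma inner2_diff_left:
  assumes "f \<in> L2 M" "g \<in> L2 M" "h \<in> L2 M"
  shows "inner2 M (\<lambda>x. f x - g x) h = inner2 M f h - inner2 M g h"
  using assms by (simp add: inner2_def left_diff_distrib L2_mult_integrable)

lemma inner2_tendsto_left:
  assumes "\<And>k. f k \<in> L2 M" "g \<in> L2 M" "h \<in> L2 M" "L2_lim M f g"
  shows "(\<lambda>k. inner2 M (f k) h) \<longlonglongrightarrow> inner2 M g h"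
proof -
  have lim: "(\<lambda>k. norm2 M (\<lambda>x. f k x - g x) * norm2 M h) \<longlonglongrightarrow> 0"
    using tendsto_mult_right[OF assms(4), of "norm2 M h"] by simp
  have "(\<lambda>k. inner2 M (f k) h - inner2 M g h) \<longlonglongrightarrow> 0"
  proof (rule Lim_null_comparison[OF _ lim])
    show "\<forall>\<^sub>F k in sequentially. cmod (inner2 M (f k) h - inner2 M g h) \<le> norm2 M (\<lambda>x. f k x - g x) * norm2 M h"
      using assms(1-3) by (simp add: inner2_diff_left[symmetric] norm2_Cauchy_Schwarz L2_diff)
  qed
  then show ?thesis by (simp add: LIM_zero_iff)
qed

lemma norm2_dominated_convergence:
  assumes "\<And>k. f k \<in> borel_measurable M" "g \<in> borel_measurable M" "integrable M (\<lambda>x. (D x)\<^sup>2)"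
    and lim: "AE x in M. (\<lambda>k. f k x) \<longlonglongrightarrow> g x"
    and bound: "\<And>k. AE x in M. cmod (f k x) \<le> D x"
  shows "L2_lim M f g" and "g \<in> L2 M"
proof -
  have *: "AE x in M. (\<forall>k. cmod (f k x) \<le> D x) \<and> cmod (g x) \<le> D x"
  proof -
    have "AE x in M. \<forall>k. cmod (f k x) \<le> D x" using bound by (simp add: AE_all_countable)
    then show ?thesis using lim
    proof eventually_elim
      case (elim x)
      then show ?case by (auto intro: tendsto_upperbound[OF tendsto_norm[of _ "g x" sequentially]])
    qed
  qed
  have sq: "(a::real)\<^sup>2 \<le> b\<^sup>2" if "0 \<le> a" "a \<le> b" for a b using that by (rule power_mono[rotated])
  show "g \<in> L2 M"
    by (rule L2_bound[OF assms(2,3)]) (use * in eventually_elim, auto intro: sq)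
  have "(\<lambda>k. \<integral>x. (cmod (f k x - g x))\<^sup>2 \<partial>M) \<longlonglongrightarrow> (LINT x|M. 0)"
  proof (rule integral_dominated_convergence)
    show "integrable M (\<lambda>x. 4 * (D x)\<^sup>2)" using assms(3) by simp
    show "AE x in M. (\<lambda>k. (cmod (f k x - g x))\<^sup>2) \<longlonglongrightarrow> 0"
      using lim
    proof eventually_elim
      case (elim x)
      then have "(\<lambda>k. (cmod (f k x - g x))\<^sup>2) \<longlonglongrightarrow> (cmod (g x - g x))\<^sup>2"
        by (intro tendsto_intros)
      then show ?case by simp
    qed
    show "AE x in M. norm ((cmod (f k x - g x))\<^sup>2) \<le> 4 * (D x)\<^sup>2" for k
      using *
    proof eventually_elim
      case (elim x)
      have "(cmod (f k x - g x))\<^sup>2 \<le> (2 * D x)\<^sup>2"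
        using elim norm_triangle_ineq4[of "f k x" "g x"] by (intro sq) (auto intro: order_trans[where y="cmod (f k x) + cmod (g x)"] simp: add_mono elim!: allE[of _ k])
      then show ?case by (simp add: power_mult_distrib)
    qed
  qed (use assms in auto)
  then have "(\<lambda>k. sqrt (LINT x|M. (cmod (f k x - g x))\<^sup>2)) \<longlonglongrightarrow> sqrt 0"
    by (intro tendsto_real_sqrt) simp
  then show "L2_lim M f g" by (simp add: norm2_def)
qed

lemma norm2_zero_AE:
  assumes "f \<in> L2 M" "norm2 M f = 0" shows "AE x in M. f x = 0"
  using assms integral_nonneg_eq_0_iff_AE[of M "\<lambda>x. (cmod (f x))\<^sup>2"]
  by (auto simp: L2_def norm2_def)

lemma norm2_cong_AE:
  assumes "AE x in M. f x = g x" "f \<in> borel_measurable M" "g \<in> borel_measurable M"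
  shows "norm2 M f = norm2 M g"
  unfolding norm2_def using assms by (intro arg_cong[of _ _ sqrt] integral_cong_AE) auto

text \<open>The Riesz-Fischer theorem. A subsequence with geometrically small steps converges almost everywhere; its limit
is the limit in mean square of the whole sequence by Fatou's lemma. The subsequence is part of the conclusion
because it is what identifies mean-square limits with pointwise ones.\<close>

lemma L2_complete:
  assumes f: "\<And>k. f k \<in> L2 M"
    and Cauchy: "\<And>e. e > 0 \<Longrightarrow> \<exists>K. \<forall>m\<ge>K. \<forall>n\<ge>K. norm2 M (\<lambda>x. f m x - f n x) < e"
  obtains g r where "g \<in> L2 M" "L2_lim M f g"
    "strict_mono (r :: nat \<Rightarrow> nat)" "AE x in M. (\<lambda>k. f (r k) x) \<longlonglongrightarrow> g x"
proof -
  have meas [measurable]: "f k \<in> borel_measurable M" for k using f by measurable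
  have "\<forall>j. \<exists>K. \<forall>m\<ge>K. \<forall>n\<ge>K. norm2 M (\<lambda>x. f m x - f n x) < (1/2)^j"
    using Cauchy by simp
  then obtain K where K: "\<And>j m n. m \<ge> K j \<Longrightarrow> n \<ge> K j \<Longrightarrow> norm2 M (\<lambda>x. f m x - f n x) < (1/2)^j"
    by metis
  define r where "r = rec_nat (K 0) (\<lambda>j R. Suc (R + K (Suc j)))"
  have r_Suc: "r (Suc j) = Suc (r j + K (Suc j))" for j by (simp add: r_def)
  have r_mono: "strict_mono r" unfolding strict_mono_Suc_iff by (simp add: r_Suc)
  have r_ge: "r j \<ge> K j" for j by (cases j) (simp_all add: r_Suc, simp add: r_def)
  have step: "norm2 M (\<lambda>x. f (r (Suc j)) x - f (r j) x) \<le> (1/2)^j" for j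
    using K[of j "r (Suc j)" "r j"] r_ge[of j] strict_monoD[OF r_mono, of j "Suc j"] by simp
  define G where "G j x = (2::real)^j * (cmod (f (r (Suc j)) x - f (r j) x))\<^sup>2" for j x
  have G_nonneg: "0 \<le> G j x" for j x by (simp add: G_def)
  have "AE x in M. summable (\<lambda>j. f (r (Suc j)) x - f (r j) x)"
  proof -
    have "(\<integral>\<^sup>+x. (\<Sum>j. ennreal (G j x)) \<partial>M) = (\<Sum>j. \<integral>\<^sup>+x. ennreal (G j x) \<partial>M)"
      by (intro nn_integral_suminf) (simp add: G_def)
    also have "\<dots> \<le> (\<Sum>j. ennreal ((1/2)^j))"
    proof (intro suminf_le summableI)
      fix j
      have "(\<integral>\<^sup>+x. ennreal (G j x) \<partial>M) = ennreal (2^j) * (\<integral>\<^sup>+x. ennreal ((cmod (f (r (Suc j)) x - f (r j) x))\<^sup>2) \<partial>M)"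
        unfolding G_def by (subst nn_integral_cmult[symmetric]) (auto simp: ennreal_mult)
      also have "\<dots> = ennreal (2^j * (norm2 M (\<lambda>x. f (r (Suc j)) x - f (r j) x))\<^sup>2)"
        by (subst nn_integral_norm2) (auto simp: ennreal_mult f)
      also have "\<dots> \<le> ennreal (2^j * ((1/2)^j)\<^sup>2)"
        by (intro ennreal_leI mult_left_mono power_mono step) auto
      also have "2^j * ((1/2)^j)\<^sup>2 = ((1/2)^j :: real)"
        by (simp add: power2_eq_square field_simps)
      finally show "(\<integral>\<^sup>+x. ennreal (G j x) \<partial>M) \<le> ennreal ((1/2)^j)" .
    qed
    also have "\<dots> < \<infinity>"
      by (subst suminf_ennreal2) (auto intro!: summable_geometric)
    finally have "AE x in M. (\<Sum>j. ennreal (G j x)) \<noteq> \<infinity>"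
      by (intro nn_integral_noteq_infinite) (auto simp: G_def)
    then show ?thesis
    proof eventually_elim
      case (elim x)
      have sum_G: "summable (\<lambda>j. G j x)"
        by (rule summable_suminf_not_top) (use elim in \<open>auto simp: G_nonneg\<close>)
      show ?case
      proof (rule summable_comparison_test')
        show "summable (\<lambda>j. G j x + (1/2)^j)"
          by (intro summable_add sum_G summable_geometric) simp
        fix j :: nat assume "j \<ge> 0"
        \<comment> \<open>With \<open>p\<^sup>2 = 2^j\<close>, the bound \<open>2 d \<le> (p d)\<^sup>2 + (1/p)\<^sup>2\<close> reduces summability of the steps \<open>d\<close>
          to that of the weighted squares \<open>2^j d\<^sup>2\<close>, whose integrals are controlled.\<close>
        define d p :: real where "d = cmod (f (r (Suc j)) x - f (r j) x)" and "p = sqrt (2^j)"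
        have p: "p > 0" "p\<^sup>2 = 2^j" by (simp_all add: p_def)
        have "2 * ((p * d) * (1/p)) \<le> (p * d)\<^sup>2 + (1/p)\<^sup>2"
          using sum_squares_bound[of "p * d" "1/p"] by (simp only: mult.assoc)
        moreover have "(p * d) * (1/p) = d" using p by simp
        moreover have "(p * d)\<^sup>2 = G j x" by (simp add: power_mult_distrib p G_def d_def)
        moreover have "(1/p)\<^sup>2 = (1/2)^j" by (simp add: p power_divide)
        moreover have "d \<ge> 0" by (simp add: d_def)
        ultimately show "norm (f (r (Suc j)) x - f (r j) x) \<le> G j x + (1/2)^j"
          by (simp flip: d_def)
      qed
    qed
  qed
  then have conv: "AE x in M. convergent (\<lambda>k. f (r k) x)"
  proof eventually_elim
    case (elim x)
    then have "convergent (\<lambda>n. \<Sum>j<n. f (r (Suc j)) x - f (r j) x)"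
      by (simp add: summable_iff_convergent)
    then have "convergent (\<lambda>n. (f (r n) x - f (r 0) x) + f (r 0) x)"
      by (subst (asm) sum_lessThan_telescope, intro convergent_add convergent_const)
    then show ?case by simp
  qed
  define g where "g x = lim (\<lambda>k. f (r k) x)" for x
  have g_meas [measurable]: "g \<in> borel_measurable M" unfolding g_def by measurable
  have g_lim: "AE x in M. (\<lambda>k. f (r k) x) \<longlonglongrightarrow> g x"
    using conv by eventually_elim (simp add: g_def convergent_LIMSEQ_iff)
  \<comment> \<open>Fatou's lemma transfers the Cauchy estimates to the limit.\<close>
  have Fatou: "(\<integral>\<^sup>+x. ennreal ((cmod (f m x - g x))\<^sup>2) \<partial>M) \<le> ennreal (((1/2)^j)\<^sup>2)" if m: "m \<ge> K j" for m j
  proof -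
    have "(\<integral>\<^sup>+x. ennreal ((cmod (f m x - g x))\<^sup>2) \<partial>M) =
      (\<integral>\<^sup>+x. liminf (\<lambda>k. ennreal ((cmod (f m x - f (r k) x))\<^sup>2)) \<partial>M)"
      using g_lim
    proof (intro nn_integral_cong_AE, eventually_elim)
      case (elim x)
      have "(\<lambda>k. ennreal ((cmod (f m x - f (r k) x))\<^sup>2)) \<longlonglongrightarrow> ennreal ((cmod (f m x - g x))\<^sup>2)"
        by (intro tendsto_ennrealI tendsto_intros elim)
      then show ?case by (intro lim_imp_Liminf[symmetric]) simp_all
    qed
    also have "\<dots> \<le> liminf (\<lambda>k. \<integral>\<^sup>+x. ennreal ((cmod (f m x - f (r k) x))\<^sup>2) \<partial>M)"
      by (intro nn_integral_liminf) auto
    also have "\<dots> \<le> ennreal (((1/2)^j)\<^sup>2)"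
    proof (rule Liminf_le)
      show "\<forall>\<^sub>F k in sequentially. (\<integral>\<^sup>+x. ennreal ((cmod (f m x - f (r k) x))\<^sup>2) \<partial>M) \<le> ennreal (((1/2)^j)\<^sup>2)"
        using eventually_ge_at_top[of j]
      proof eventually_elim
        case (elim k)
        have "r k \<ge> K j" using r_ge[of j] strict_mono_leD[OF r_mono elim] by simp
        then have "norm2 M (\<lambda>x. f m x - f (r k) x) \<le> (1/2)^j" using K[OF m] by (simp add: less_imp_le)
        then show ?case by (subst nn_integral_norm2) (auto intro!: ennreal_leI power_mono simp: f)
      qed
    qed simp
    finally show ?thesis .
  qed
  have diff: "(\<lambda>x. f m x - g x) \<in> L2 M" if "m \<ge> K 0" for m
    by (rule L2I_nn_integral) (use Fatou[OF that] in \<open>auto intro: le_less_trans\<close>)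
  have g: "g \<in> L2 M"
    using L2_diff[OF f[of "K 0"] diff[of "K 0"]] by simp
  have le: "norm2 M (\<lambda>x. f m x - g x) \<le> (1/2)^j" if "m \<ge> K j" for m j
  proof (rule power2_le_imp_le)
    have "(\<lambda>x. f m x - g x) \<in> L2 M" using f g by auto
    then show "(norm2 M (\<lambda>x. f m x - g x))\<^sup>2 \<le> ((1/2)^j)\<^sup>2"
      using Fatou[OF that] by (simp add: nn_integral_norm2 del: ennreal_power)
  qed simp
  have "L2_lim M f g"
  proof (rule LIMSEQ_I)
    fix e :: real assume "e > 0"
    then obtain j where "(1/2)^j < e" using real_arch_pow_inv[of e "1/2"] by auto
    then show "\<exists>K. \<forall>m\<ge>K. norm (norm2 M (\<lambda>x. f m x - g x) - 0) < e"
      using le[of j] by (intro exI[of _ "K j"]) (auto intro: le_less_trans)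
  qed
  from that[OF g this r_mono g_lim] show ?thesis .
qed

lemma norm2_tendsto_Cauchy:
  assumes "\<And>k. f k \<in> L2 M" "g \<in> L2 M" "L2_lim M f g" "e > 0"
  shows "\<exists>K. \<forall>m\<ge>K. \<forall>n\<ge>K. norm2 M (\<lambda>x. f m x - f n x) < e"
proof -
  obtain K where K: "\<And>m. m \<ge> K \<Longrightarrow> norm2 M (\<lambda>x. f m x - g x) < e / 2"
    using LIMSEQ_D[OF assms(3), of "e/2"] \<open>e > 0\<close> by auto
  have "norm2 M (\<lambda>x. f m x - f n x) < e" if "m \<ge> K" "n \<ge> K" for m n
    using norm2_triangle_via[OF assms(1)[of m] assms(2) assms(1)[of n]] K[OF that(1)] K[OF that(2)]
    by (simp add: norm2_minus_commute[of M g])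
  then show ?thesis by blast
qed

lemma AE_eq_of_L2_limit:
  assumes "\<And>k. f k \<in> L2 M" "g \<in> L2 M" "L2_lim M f g"
    and lim: "AE x in M. (\<lambda>k. f k x) \<longlonglongrightarrow> h x"
  shows "AE x in M. h x = g x"
proof -
  obtain g' r where g': "g' \<in> L2 M" "L2_lim M f g'"
    and r: "strict_mono (r :: nat \<Rightarrow> nat)" "AE x in M. (\<lambda>k. f (r k) x) \<longlonglongrightarrow> g' x"
    by (rule L2_complete[OF assms(1) norm2_tendsto_Cauchy[OF assms(1-3)]])
  have "(\<lambda>k. norm2 M (\<lambda>x. f k x - g x) + norm2 M (\<lambda>x. f k x - g' x)) \<longlonglongrightarrow> 0 + 0"
    by (intro tendsto_add g' assms)
  then have "(\<lambda>k. norm2 M (\<lambda>x. f k x - g x) + norm2 M (\<lambda>x. f k x - g' x)) \<longlonglongrightarrow> 0" by simp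
  then have "norm2 M (\<lambda>x. g x - g' x) \<le> 0"
  proof (rule tendsto_lowerbound)
    show "\<forall>\<^sub>F k in sequentially. norm2 M (\<lambda>x. g x - g' x) \<le> norm2 M (\<lambda>x. f k x - g x) + norm2 M (\<lambda>x. f k x - g' x)"
      using norm2_triangle_via[OF assms(2) assms(1) g'(1)] by (simp add: norm2_minus_commute[of M g])
  qed simp
  then have "norm2 M (\<lambda>x. g x - g' x) = 0" using norm2_nonneg[of M "\<lambda>x. g x - g' x"] by linarith
  then have "AE x in M. g x - g' x = 0" using assms(2) g'(1) by (intro norm2_zero_AE) auto
  then show ?thesis using r(2) lim
  proof eventually_elim
    case (elim x)
    have "(\<lambda>k. f (r k) x) \<longlonglongrightarrow> h x"
      using LIMSEQ_subseq_LIMSEQ[OF elim(3) r(1)] by (simp add: o_def)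
    with elim(2) have "g' x = h x" by (rule LIMSEQ_unique)
    then show ?case using elim(1) by simp
  qed
qed

text \<open>The projection theorem in the form of a density criterion: a best approximation of \<open>f\<close> in the closure of \<open>S\<close>
exists by completeness, its error is orthogonal to \<open>S\<close>, and totality makes the error vanish.\<close>

lemma L2_dense_subspace:
  assumes S: "S \<subseteq> L2 M" "S \<noteq> {}"
    and S_comb: "\<And>p q a b. p \<in> S \<Longrightarrow> q \<in> S \<Longrightarrow> (\<lambda>x. a * p x + b * q x) \<in> S"
    and total: "\<And>g. g \<in> L2 M \<Longrightarrow> (\<And>p. p \<in> S \<Longrightarrow> inner2 M g p = 0) \<Longrightarrow> norm2 M g = 0"
    and f: "f \<in> L2 M" and e: "e > 0"
  shows "\<exists>p\<in>S. norm2 M (\<lambda>x. f x - p x) < e"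
proof -
  define d where "d = (INF p\<in>S. norm2 M (\<lambda>x. f x - p x))"
  have bdd: "bdd_below ((\<lambda>p. norm2 M (\<lambda>x. f x - p x)) ` S)" by (intro bdd_belowI[of _ 0]) auto
  have d_le: "d \<le> norm2 M (\<lambda>x. f x - p x)" if "p \<in> S" for p
    unfolding d_def by (rule cINF_lower[OF bdd that])
  have d_nonneg: "d \<ge> 0" unfolding d_def using S by (intro cINF_greatest) auto
  have "\<exists>p\<in>S. norm2 M (\<lambda>x. f x - p x) < d + 1 / real (Suc k)" for k
  proof -
    have "d < d + 1 / real (Suc k)" by simp
    then show ?thesis unfolding d_def cINF_less_iff[OF S(2) bdd] .
  qed
  then obtain p where p: "\<And>k. p k \<in> S" and p_lt: "\<And>k. norm2 M (\<lambda>x. f x - p k x) < d + 1 / real (Suc k)"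
    by metis
  have p_L2: "p k \<in> L2 M" for k using p S by auto
  have lim_d: "(\<lambda>k. norm2 M (\<lambda>x. f x - p k x)) \<longlonglongrightarrow> d"
  proof (rule tendsto_sandwich[OF always_eventually always_eventually tendsto_const])
    show "(\<lambda>k. d + 1 / real (Suc k)) \<longlonglongrightarrow> d"
      using tendsto_add[OF tendsto_const LIMSEQ_inverse_real_of_nat, of d] by (simp add: inverse_eq_divide)
  qed (use d_le p p_lt in \<open>auto intro: less_imp_le\<close>)
  \<comment> \<open>The parallelogram identity makes a minimizing sequence Cauchy.\<close>
  have par: "(norm2 M (\<lambda>x. p m x - p n x))\<^sup>2 \<le>
      2 * (norm2 M (\<lambda>x. f x - p m x))\<^sup>2 + 2 * (norm2 M (\<lambda>x. f x - p n x))\<^sup>2 - 4 * d\<^sup>2" for m n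
  proof -
    let ?a = "\<lambda>x. f x - p m x" and ?b = "\<lambda>x. f x - p n x"
    have ab: "?a \<in> L2 M" "?b \<in> L2 M" "(\<lambda>x. - 1 * ?b x) \<in> L2 M"
      using L2_diff[OF f p_L2[of m]] L2_diff[OF f p_L2[of n]] L2_cmult[OF L2_diff[OF f p_L2[of n]], of "- 1"] by simp_all
    have "(norm2 M (\<lambda>x. ?a x + - 1 * ?b x))\<^sup>2 + (norm2 M (\<lambda>x. ?a x + ?b x))\<^sup>2 =
      2 * (norm2 M ?a)\<^sup>2 + 2 * (norm2 M ?b)\<^sup>2"
      unfolding norm2_add_sq[OF ab(1,2)] norm2_add_sq[OF ab(1,3)] inner2_cmult_right norm2_cmult by simp
    moreover have "norm2 M (\<lambda>x. ?a x + - 1 * ?b x) = norm2 M (\<lambda>x. p m x - p n x)"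
      unfolding norm2_minus_commute[of M "p m"] by simp
    moreover have "4 * d\<^sup>2 \<le> (norm2 M (\<lambda>x. ?a x + ?b x))\<^sup>2"
    proof -
      have "(\<lambda>x. ?a x + ?b x) = (\<lambda>x. 2 * (f x - (1/2 * p m x + 1/2 * p n x)))" by (simp add: fun_eq_iff algebra_simps)
      then have "norm2 M (\<lambda>x. ?a x + ?b x) = 2 * norm2 M (\<lambda>x. f x - (1/2 * p m x + 1/2 * p n x))"
        by (simp only: norm2_cmult) simp
      moreover have "d \<le> norm2 M (\<lambda>x. f x - (1/2 * p m x + 1/2 * p n x))" by (intro d_le S_comb p)
      ultimately have "(2 * d)\<^sup>2 \<le> (norm2 M (\<lambda>x. ?a x + ?b x))\<^sup>2" using d_nonneg by (intro power_mono) auto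
      then show ?thesis by (simp add: power_mult_distrib)
    qed
    ultimately show ?thesis by simp
  qed
  have "\<exists>K. \<forall>m\<ge>K. \<forall>n\<ge>K. norm2 M (\<lambda>x. p m x - p n x) < e" if "e > 0" for e
  proof -
    have "(\<lambda>k. (norm2 M (\<lambda>x. f x - p k x))\<^sup>2) \<longlonglongrightarrow> d\<^sup>2" by (intro tendsto_intros lim_d)
    from LIMSEQ_D[OF this, of "e\<^sup>2/4"] that
    obtain K where K: "\<And>k. k \<ge> K \<Longrightarrow> \<bar>(norm2 M (\<lambda>x. f x - p k x))\<^sup>2 - d\<^sup>2\<bar> < e\<^sup>2 / 4"
      by auto
    have "norm2 M (\<lambda>x. p m x - p n x) < e" if "m \<ge> K" "n \<ge> K" for m n
    proof (rule power2_less_imp_less)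
      show "(norm2 M (\<lambda>x. p m x - p n x))\<^sup>2 < e\<^sup>2"
        using par[of m n] K[OF that(1)] K[OF that(2)] by linarith
    qed (use \<open>e > 0\<close> in simp)
    then show ?thesis by blast
  qed
  then obtain q where q: "q \<in> L2 M" and
    q_lim: "L2_lim M p q" by (rule L2_complete[OF p_L2])
  define g where "g x = f x - q x" for x
  have g: "g \<in> L2 M" unfolding g_def using f q by auto
  have shift: "norm2 M (\<lambda>x. g x + c * s x) \<ge> d" and norm_g: "norm2 M g = d" if "s \<in> S" for s c
  proof -
    have cs: "(\<lambda>x. c * s x) \<in> L2 M" for c using that S by auto
    have "(\<lambda>k. norm2 M (\<lambda>x. f x - p k x + c * s x)) \<longlonglongrightarrow> norm2 M (\<lambda>x. g x + c * s x)" for c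
    proof (rule norm2_tendsto)
      show "(\<lambda>x. f x - p k x + c * s x) \<in> L2 M" "(\<lambda>x. g x + c * s x) \<in> L2 M" for k
        by (rule L2_add[OF L2_diff[OF f p_L2] cs], rule L2_add[OF g cs])
      show "(\<lambda>k. norm2 M (\<lambda>x. f x - p k x + c * s x - (g x + c * s x))) \<longlonglongrightarrow> 0"
        using q_lim by (simp add: g_def norm2_minus_commute[of M q])
    qed
    note lim = this
    show "norm2 M (\<lambda>x. g x + c * s x) \<ge> d"
    proof (rule tendsto_lowerbound[OF lim always_eventually]; (intro allI)?)
      fix k
      have "d \<le> norm2 M (\<lambda>x. f x - (1 * p k x + (-c) * s x))" by (intro d_le S_comb p that)
      then show "d \<le> norm2 M (\<lambda>x. f x - p k x + c * s x)" by (simp add: algebra_simps)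
    qed simp
    show "norm2 M g = d" using LIMSEQ_unique[OF lim_d] lim[of 0] by simp
  qed
  have "norm2 M g = 0"
  proof (rule total[OF g])
    fix s assume s: "s \<in> S"
    define z where "z = inner2 M g s"
    define n where "n = (norm2 M s)\<^sup>2 + 1"
    have n: "n > 0" "(norm2 M s)\<^sup>2 \<le> n" by (auto simp: n_def add_nonneg_pos)
    \<comment> \<open>A small step from \<open>g\<close> along \<open>s\<close>, opposite to the inner product, would bring \<open>g\<close> closer to 0; the
      denominator \<open>n\<close> exceeds \<open>(norm2 M s)\<^sup>2\<close> by 1 so that it cannot vanish.\<close>
    define c where "c = - (z / of_real n)"
    have sL: "s \<in> L2 M" using s S by auto
    have "d\<^sup>2 \<le> (norm2 M (\<lambda>x. g x + c * s x))\<^sup>2" using shift[OF s] d_nonneg by (intro power_mono) auto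
    also have "\<dots> = d\<^sup>2 + (cmod c)\<^sup>2 * (norm2 M s)\<^sup>2 + 2 * Re (cnj c * z)"
      using sL by (simp add: norm2_add_sq g L2_cmult norm2_cmult inner2_cmult_right norm_g[OF s] power_mult_distrib z_def)
    also have "cnj c * z = of_real (- (cmod z)\<^sup>2 / n)"
      using complex_norm_square[of z] by (simp add: c_def mult.commute)
    also have "(cmod c)\<^sup>2 * (norm2 M s)\<^sup>2 \<le> (cmod c)\<^sup>2 * n" using n by (intro mult_left_mono) auto
    also have "(cmod c)\<^sup>2 * n = (cmod z)\<^sup>2 / n" using n by (simp add: c_def norm_divide power_divide power2_eq_square)
    finally have "(cmod z)\<^sup>2 / n \<le> 0" by (simp add: field_simps)
    then have "z = 0" using n by (simp add: divide_le_0_iff)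
    then show "inner2 M g s = 0" by (simp add: z_def)
  qed
  moreover obtain s where "s \<in> S" using S by auto
  ultimately have "d = 0" using norm_g by auto
  with lim_d have "(\<lambda>k. norm2 M (\<lambda>x. f x - p k x)) \<longlonglongrightarrow> 0" by simp
  then obtain k where "norm2 M (\<lambda>x. f x - p k x) < e"
    using LIMSEQ_D[OF _ e] by force
  then show ?thesis using p by blast
qed



section \<open>Uniqueness of Fourier transforms\<close>

lemma integrable_real_times_bounded:
  fixes w :: "'a \<Rightarrow> real" and f :: "'a \<Rightarrow> 'b::{banach, second_countable_topology}"
  assumes "integrable M w" "f \<in> borel_measurable M" "\<And>x. norm (f x) \<le> 1"
  shows "integrable M (\<lambda>x. w x *\<^sub>R f x)"
  by (rule Bochner_Integration.integrable_bound[OF assms(1)])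
     (use assms in \<open>auto intro!: mult_left_le\<close>)

text \<open>Two weighted variables with equal weighted Fourier transforms have equal weighted laws: after normalization
the weights are probability densities, and the uniqueness theorem for characteristic functions applies.
Two unrelated spaces and weights are allowed, since both the injectivity of the Fourier transform on \<open>L\<^sup>1\<close>
(the two weights being the positive and negative part of one function) and the induction for the
Cramer-Wold theorem are instances.\<close>

lemma weighted_char_unique:
  fixes w1 :: "'a \<Rightarrow> real" and w2 :: "'b \<Rightarrow> real"
  assumes w: "integrable M1 w1" "integrable M2 w2" "\<And>x. 0 \<le> w1 x" "\<And>x. 0 \<le> w2 x"
    and X [measurable]: "X1 \<in> borel_measurable M1" "X2 \<in> borel_measurable M2"
    and eq: "\<And>t. (LINT x|M1. w1 x *\<^sub>R iexp (t * X1 x)) = (LINT x|M2. w2 x *\<^sub>R iexp (t * X2 x))"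
    and A [measurable]: "A \<in> sets borel"
  shows "(LINT x|M1. w1 x * indicator A (X1 x)) = (LINT x|M2. w2 x * indicator A (X2 x))"
proof -
  define m where "m = (LINT x|M1. w1 x)"
  have [measurable]: "w1 \<in> borel_measurable M1" "w2 \<in> borel_measurable M2" using w by auto
  have m2: "m = (LINT x|M2. w2 x)"
    using eq[of 0] by (simp add: m_def scaleR_conv_of_real)
  show ?thesis
  proof (cases "m = 0")
    case True
    then have "AE x in M1. w1 x = 0" "AE x in M2. w2 x = 0"
      using w m2 integral_nonneg_eq_0_iff_AE[of M1 w1] integral_nonneg_eq_0_iff_AE[of M2 w2]
      by (auto simp: m_def)
    then have "(LINT x|M1. w1 x * indicator A (X1 x)) = 0" "(LINT x|M2. w2 x * indicator A (X2 x)) = 0"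
      by (auto intro!: integral_eq_zero_AE elim!: eventually_mono)
    then show ?thesis by simp
  next
    case False
    moreover have "0 \<le> m" unfolding m_def by (rule Bochner_Integration.integral_nonneg) (rule w(3))
    ultimately have m: "m > 0" by simp
    have key: "real_distribution P \<and> char P = (\<lambda>t. (LINT x|M. u x *\<^sub>R iexp (t * X x)) / m) \<and>
        m * measure P A = (LINT x|M. u x * indicator A (X x))"
      if P: "P = distr (density M (\<lambda>x. ennreal (u x / m))) borel X"
        and u: "integrable M u" "\<And>x. 0 \<le> u x" "(LINT x|M. u x) = m"
        and [measurable]: "X \<in> borel_measurable M"
      for P and M :: "'c measure" and u X
    proof -
      have [measurable]: "u \<in> borel_measurable M" using u by auto
      have tot: "(\<integral>\<^sup>+x. ennreal (u x / m) \<partial>M) = 1"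
        using u m by (subst nn_integral_eq_integral) auto
      interpret D: prob_space "density M (\<lambda>x. ennreal (u x / m))"
        by (rule prob_spaceI) (use tot in \<open>simp add: emeasure_density cong: nn_integral_cong\<close>)
      have "prob_space P" unfolding P by (rule D.prob_space_distr) simp
      then have R: "real_distribution P"
        by (simp add: real_distribution_def real_distribution_axioms_def P)
      interpret R: real_distribution P by (rule R)
      have "char P t = (LINT x|M. u x *\<^sub>R iexp (t * X x)) / m" for t
      proof -
        have "char P t = (LINT x|M. (u x / m) *\<^sub>R iexp (t * X x))"
          using u m unfolding char_def P
          by (subst integral_distr, simp, simp) (subst integral_density, auto)
        also have "\<dots> = (LINT x|M. u x *\<^sub>R iexp (t * X x) / of_real m)"
          by (intro Bochner_Integration.integral_cong) (auto simp: scaleR_conv_of_real)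
        finally show ?thesis by simp
      qed
      moreover have "m * measure P A = (LINT x|M. u x * indicator A (X x))"
      proof -
        have "measure P A = (LINT x|P. indicator A x)"
          by (simp add: P)
        also have "\<dots> = (LINT x|M. (u x / m) *\<^sub>R indicator A (X x))"
          using u m unfolding P
          by (subst integral_distr, simp, simp) (subst integral_density, auto)
        also have "\<dots> = (LINT x|M. u x * indicator A (X x) / m)" by simp
        finally show ?thesis using m by simp
      qed
      ultimately show ?thesis using R by auto
    qed
    note k1 = key[OF refl w(1,3) m_def[symmetric] X(1)] and k2 = key[OF refl w(2,4) m2[symmetric] X(2)]
    have "distr (density M1 (\<lambda>x. ennreal (w1 x / m))) borel X1 = distr (density M2 (\<lambda>x. ennreal (w2 x / m))) borel X2"
      by (rule Levy_uniqueness) (use k1 k2 eq in auto)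
    then show ?thesis using k1 k2 by metis
  qed
qed

lemma Fourier_unique_real:
  fixes w :: "'a \<Rightarrow> real"
  assumes w: "integrable M w" and X: "X \<in> borel_measurable M"
    and zero: "\<And>t. (LINT x|M. w x *\<^sub>R iexp (t * X x)) = 0"
    and A: "A \<in> sets borel"
  shows "(LINT x|M. w x * indicator A (X x)) = 0"
proof -
  let ?p = "\<lambda>x. max (w x) 0" and ?n = "\<lambda>x. max (- w x) 0"
  have split: "w x = ?p x - ?n x" for x by auto
  have int: "integrable M ?p" "integrable M ?n" using w by (auto intro!: integrable_max)
  have ie: "(\<lambda>x. iexp (t * X x)) \<in> borel_measurable M" for t using X by measurable
  have "(LINT x|M. ?p x * indicator A (X x)) = (LINT x|M. ?n x * indicator A (X x))"
  proof (rule weighted_char_unique[OF int _ _ X X _ A])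
    fix t
    have "(LINT x|M. ?p x *\<^sub>R iexp (t * X x)) - (LINT x|M. ?n x *\<^sub>R iexp (t * X x)) =
      (LINT x|M. w x *\<^sub>R iexp (t * X x))"
      by (subst Bochner_Integration.integral_diff[symmetric, OF
            integrable_real_times_bounded[OF int(1) ie] integrable_real_times_bounded[OF int(2) ie]])
         (auto intro!: Bochner_Integration.integral_cong simp flip: scaleR_diff_left)
    then show "(LINT x|M. ?p x *\<^sub>R iexp (t * X x)) = (LINT x|M. ?n x *\<^sub>R iexp (t * X x))"
      using zero[of t] by simp
  qed auto
  moreover have "(LINT x|M. w x * indicator A (X x)) =
     (LINT x|M. ?p x * indicator A (X x)) - (LINT x|M. ?n x * indicator A (X x))"
  proof -
    have ind: "(\<lambda>x. indicator A (X x) :: real) \<in> borel_measurable M" using X A by measurable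
    have "integrable M (\<lambda>x. ?p x * indicator A (X x))" "integrable M (\<lambda>x. ?n x * indicator A (X x))"
      using integrable_real_times_bounded[OF int(1) ind] integrable_real_times_bounded[OF int(2) ind] by simp_all
    from Bochner_Integration.integral_diff[OF this]
    show ?thesis by (simp flip: split left_diff_distrib)
  qed
  ultimately show ?thesis by simp
qed

text \<open>Conjugating \<open>w\<close> reflects its transform, so real and imaginary part have vanishing transforms, too.\<close>

lemma Fourier_injective_L1:
  fixes w :: "real \<Rightarrow> complex"
  assumes w: "integrable lborel w"
    and zero: "\<And>t. (LINT x|lborel. w x * iexp (t * x)) = 0"
  shows "AE x in lborel. w x = 0"
proof -
  have [measurable]: "w \<in> borel_measurable borel" using w by auto
  have int: "integrable lborel (\<lambda>x. w x * iexp (t * x))" for t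
    by (rule Bochner_Integration.integrable_bound[OF w]) (auto simp: norm_mult)
  have zero': "(LINT x|lborel. cnj (w x) * iexp (t * x)) = 0" for t
  proof -
    have "(LINT x|lborel. cnj (w x) * iexp (t * x)) = (LINT x|lborel. cnj (w x * iexp ((-t) * x)))"
      by (simp add: exp_cnj)
    also have "\<dots> = 0" unfolding Bochner_Integration.integral_cnj zero by simp
    finally show ?thesis .
  qed
  have int': "integrable lborel (\<lambda>x. cnj (w x) * iexp (t * x))" for t
    by (rule Bochner_Integration.integrable_bound[OF w]) (auto simp: norm_mult)
  have Re: "(LINT x|lborel. Re (w x) *\<^sub>R iexp (t * x)) = 0" for t
  proof -
    have "(LINT x|lborel. Re (w x) *\<^sub>R iexp (t * x)) = (LINT x|lborel. (w x * iexp (t * x) + cnj (w x) * iexp (t * x)) / 2)"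
      by (intro Bochner_Integration.integral_cong) (auto simp: scaleR_conv_of_real complex_add_cnj simp flip: distrib_right)
    also have "\<dots> = ((LINT x|lborel. w x * iexp (t * x)) + (LINT x|lborel. cnj (w x) * iexp (t * x))) / 2"
      by (subst Bochner_Integration.integral_add[symmetric, OF int int']) (rule integral_divide_zero)
    finally show ?thesis unfolding zero zero' by simp
  qed
  have Im: "(LINT x|lborel. Im (w x) *\<^sub>R iexp (t * x)) = 0" for t
  proof -
    have "(LINT x|lborel. Im (w x) *\<^sub>R iexp (t * x)) = (LINT x|lborel. (w x * iexp (t * x) - cnj (w x) * iexp (t * x)) / (2 * \<i>))"
      by (intro Bochner_Integration.integral_cong) (auto simp: scaleR_conv_of_real complex_diff_cnj field_simps simp flip: left_diff_distrib)
    also have "\<dots> = ((LINT x|lborel. w x * iexp (t * x)) - (LINT x|lborel. cnj (w x) * iexp (t * x))) / (2 * \<i>)"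
      by (subst Bochner_Integration.integral_diff[symmetric, OF int int']) (rule integral_divide_zero)
    finally show ?thesis unfolding zero zero' by simp
  qed
  have real_zero: "AE x in lborel. u x = 0"
    if u: "integrable lborel u" and uz: "\<And>t. (LINT x|lborel. u x *\<^sub>R iexp (t * x)) = 0" for u :: "real \<Rightarrow> real"
  proof -
    have um [measurable]: "u \<in> borel_measurable borel" using u by auto
    have idm: "(\<lambda>x::real. x) \<in> borel_measurable lborel" by simp
    have half: "AE x in lborel. s * u x \<le> 0" if s: "s \<in> {1, -1}" for s
    proof -
      define A where "A = {x. 0 < s * u x}"
      have A: "A \<in> sets borel" unfolding A_def by measurable
      have int: "integrable lborel (\<lambda>x. s * (u x * indicator A x))"
        using integrable_real_times_bounded[OF u, of "indicator A :: real \<Rightarrow> real"] A by auto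
      have "(LINT x|lborel. s * (u x * indicator A x)) = 0"
        using Fourier_unique_real[OF u idm uz A] by simp
      moreover have "AE x in lborel. 0 \<le> s * (u x * indicator A x)"
        by (auto simp: A_def indicator_def mult.assoc[symmetric])
      ultimately have "AE x in lborel. s * (u x * indicator A x) = 0"
        using integral_nonneg_eq_0_iff_AE[OF int] by simp
      then show ?thesis by eventually_elim (auto simp: A_def indicator_def split: if_splits)
    qed
    from half[of 1] half[of "-1"] show ?thesis by (auto elim!: AE_mp)
  qed
  have "AE x in lborel. Re (w x) = 0" "AE x in lborel. Im (w x) = 0"
    using w by (auto intro!: real_zero Re Im)
  then show ?thesis by eventually_elim (simp add: complex_eq_iff)
qed

lemma iexp_add: "iexp (a + b) = iexp a * iexp b"
  by (simp add: distrib_left exp_add)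

lemma cos_iexp: "complex_of_real (cos a) = (iexp a + iexp (- a)) / 2"
  by (simp add: cos_of_real[symmetric] cos_exp_eq)

lemma sin_iexp: "complex_of_real (sin a) = (iexp a - iexp (- a)) / (2 * \<i>)"
  by (simp add: sin_of_real[symmetric] sin_exp_eq)

lemma integral_add3:
  fixes f g h :: "'a \<Rightarrow> complex"
  assumes "integrable M f" "integrable M g" "integrable M h"
  shows "(LINT x|M. f x + p * g x + q * h x) = (LINT x|M. f x) + p * (LINT x|M. g x) + q * (LINT x|M. h x)"
  using assms by simp

text \<open>Induction on the number of variables. The weights make the induction work: once the variables other than \<open>j\<close>
are absorbed into a weight, uniqueness on the line treats the variable \<open>j\<close>; then the event \<open>X j \<in> A j\<close> is
absorbed into the weight instead, and the induction hypothesis treats the other variables.\<close>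

lemma weighted_Cramer_Wold:
  fixes w1 :: "'a \<Rightarrow> real" and w2 :: "'b \<Rightarrow> real"
  assumes "finite I"
    and "\<And>i. i \<in> I \<Longrightarrow> X i \<in> borel_measurable M1" "\<And>i. i \<in> I \<Longrightarrow> Y i \<in> borel_measurable M2"
    and "integrable M1 w1" "integrable M2 w2" "\<And>x. 0 \<le> w1 x" "\<And>x. 0 \<le> w2 x"
    and "\<And>c. (LINT x|M1. w1 x *\<^sub>R iexp (\<Sum>i\<in>I. c i * X i x)) = (LINT x|M2. w2 x *\<^sub>R iexp (\<Sum>i\<in>I. c i * Y i x))"
    and "\<And>i. i \<in> I \<Longrightarrow> A i \<in> sets borel"
  shows "(LINT x|M1. w1 x * (\<Prod>i\<in>I. indicator (A i) (X i x))) = (LINT x|M2. w2 x * (\<Prod>i\<in>I. indicator (A i) (Y i x)))"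
  using assms
proof (induction I arbitrary: w1 w2 rule: finite_induct)
  case empty
  from empty.prems(7)[of "\<lambda>_. 0"] show ?case by (simp add: scaleR_conv_of_real)
next
  case (insert j J)
  let ?X = "\<lambda>c x. \<Sum>i\<in>J. c i * X i x" and ?Y = "\<lambda>c x. \<Sum>i\<in>J. c i * Y i x"
  have [measurable]: "X j \<in> borel_measurable M1" "Y j \<in> borel_measurable M2" "A j \<in> sets borel"
    using insert.prems by auto
  have XJ [measurable]: "X i \<in> borel_measurable M1" "Y i \<in> borel_measurable M2" if "i \<in> J" for i
    using insert.prems that by auto
  have [measurable]: "?X c \<in> borel_measurable M1"
    "?Y c \<in> borel_measurable M2" for c
    by (auto intro!: borel_measurable_sum borel_measurable_times)
  note w = \<open>integrable M1 w1\<close> \<open>integrable M2 w2\<close>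
  have [measurable]: "w1 \<in> borel_measurable M1" "w2 \<in> borel_measurable M2" using w by auto
  have eq: "(LINT x|M1. w1 x *\<^sub>R iexp (t * X j x + ?X c x)) =
      (LINT x|M2. w2 x *\<^sub>R iexp (t * Y j x + ?Y c x))" for t c
  proof -
    have "(\<Sum>i\<in>J. (if i = j then t else c i) * Z i) = (\<Sum>i\<in>J. c i * Z i)" for Z :: "_ \<Rightarrow> real"
      using insert.hyps by (intro sum.cong) auto
    with insert.prems(7)[of "\<lambda>i. if i = j then t else c i"] insert.hyps show ?thesis by simp
  qed
  have bnd: "integrable M1 (\<lambda>x. w1 x *\<^sub>R f x)" if "f \<in> borel_measurable M1" "\<And>x. norm (f x) \<le> 1"
    for f :: "_ \<Rightarrow> complex" using w that by (intro integrable_real_times_bounded) auto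
  have bnd2: "integrable M2 (\<lambda>x. w2 x *\<^sub>R f x)" if "f \<in> borel_measurable M2" "\<And>x. norm (f x) \<le> 1"
    for f :: "_ \<Rightarrow> complex" using w that by (intro integrable_real_times_bounded) auto
  have rbnd: "integrable M1 (\<lambda>x. w1 x * f x)" if "f \<in> borel_measurable M1" "\<And>x. \<bar>f x\<bar> \<le> 1"
    for f :: "_ \<Rightarrow> real" using integrable_real_times_bounded[OF w(1) that(1)] that by auto
  have rbnd2: "integrable M2 (\<lambda>x. w2 x * f x)" if "f \<in> borel_measurable M2" "\<And>x. \<bar>f x\<bar> \<le> 1"
    for f :: "_ \<Rightarrow> real" using integrable_real_times_bounded[OF w(2) that(1)] that by auto
  define v1 where "v1 x = w1 x * indicator (A j) (X j x)" for x
  define v2 where "v2 x = w2 x * indicator (A j) (Y j x)" for x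
  have v: "integrable M1 v1" "integrable M2 v2"
    unfolding v1_def v2_def by (auto intro!: rbnd rbnd2 simp: indicator_def)
  have v_nonneg: "0 \<le> v1 x" "0 \<le> v2 y" for x y
    using insert.prems(5,6) by (auto simp: v1_def v2_def)
  have tot: "(LINT x|M1. v1 x) = (LINT x|M2. v2 x)"
    unfolding v1_def v2_def
    by (rule weighted_char_unique) (use w insert.prems eq[of _ "\<lambda>_. 0"] in auto)
  \<comment> \<open>A complex exponential of the remaining variables is not a weight, but \<open>1 + cos\<close> and \<open>1 + sin\<close> are
    nonnegative, and their transforms combine those of the exponentials.\<close>
  have trig: "(LINT x|M1. v1 x * g (?X c x)) = (LINT x|M2. v2 x * g (?Y c x))"
    if g: "\<And>a. \<bar>g a\<bar> \<le> 1" "\<And>a. complex_of_real (g a) = p * iexp a + q * iexp (- a)"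
      and gm [measurable]: "g \<in> borel_measurable borel" for g :: "real \<Rightarrow> real" and p q :: complex and c
  proof -
    have g1: "0 \<le> 1 + g a" "\<bar>(1 + g a) / 2\<bar> \<le> 1" for a using g(1)[of a] by auto
    have expand: "(w * (1 + g a)) *\<^sub>R iexp b = w *\<^sub>R iexp b + p * (w *\<^sub>R iexp (b + a)) + q * (w *\<^sub>R iexp (b - a))" for w a b :: real
      using g(2)[of a] iexp_add[of b a] iexp_add[of b "-a"]
      by (simp add: scaleR_conv_of_real ring_distribs)
    have "(LINT x|M1. w1 x * (1 + g (?X c x)) * indicator (A j) (X j x)) =
        (LINT x|M2. w2 x * (1 + g (?Y c x)) * indicator (A j) (Y j x))"
    proof (rule weighted_char_unique)
      show "integrable M1 (\<lambda>x. w1 x * (1 + g (?X c x)))"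
        using integrable_mult_right[OF rbnd[of "\<lambda>x. (1 + g (?X c x)) / 2"], of 2] g1(2) by simp
      show "integrable M2 (\<lambda>x. w2 x * (1 + g (?Y c x)))"
        using integrable_mult_right[OF rbnd2[of "\<lambda>x. (1 + g (?Y c x)) / 2"], of 2] g1(2) by simp
      fix t
      have "(LINT x|M1. (w1 x * (1 + g (?X c x))) *\<^sub>R iexp (t * X j x)) =
        (LINT x|M1. w1 x *\<^sub>R iexp (t * X j x)) + p * (LINT x|M1. w1 x *\<^sub>R iexp (t * X j x + ?X c x))
         + q * (LINT x|M1. w1 x *\<^sub>R iexp (t * X j x - ?X c x))"
        unfolding expand by (intro integral_add3 bnd) simp_all
      moreover have "(LINT x|M2. (w2 x * (1 + g (?Y c x))) *\<^sub>R iexp (t * Y j x)) =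
        (LINT x|M2. w2 x *\<^sub>R iexp (t * Y j x)) + p * (LINT x|M2. w2 x *\<^sub>R iexp (t * Y j x + ?Y c x))
         + q * (LINT x|M2. w2 x *\<^sub>R iexp (t * Y j x - ?Y c x))"
        unfolding expand by (intro integral_add3 bnd2) simp_all
      ultimately show "(LINT x|M1. (w1 x * (1 + g (?X c x))) *\<^sub>R iexp (t * X j x)) =
        (LINT x|M2. (w2 x * (1 + g (?Y c x))) *\<^sub>R iexp (t * Y j x))"
        using eq[of t "\<lambda>_. 0"] eq[of t c] eq[of t "\<lambda>i. - c i"] by (simp add: sum_negf)
    qed (use insert.prems g1 in auto)
    moreover have "(LINT x|M1. w1 x * (1 + g (?X c x)) * indicator (A j) (X j x)) =
      (LINT x|M1. v1 x) + (LINT x|M1. v1 x * g (?X c x))"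
    proof -
      have "integrable M1 (\<lambda>x. v1 x * g (?X c x))"
        using integrable_real_times_bounded[OF v(1), of "\<lambda>x. g (?X c x)"] g(1) by simp
      then show ?thesis
        by (subst Bochner_Integration.integral_add[symmetric]) (auto simp: v v1_def algebra_simps intro!: Bochner_Integration.integral_cong)
    qed
    moreover have "(LINT x|M2. w2 x * (1 + g (?Y c x)) * indicator (A j) (Y j x)) =
      (LINT x|M2. v2 x) + (LINT x|M2. v2 x * g (?Y c x))"
    proof -
      have "integrable M2 (\<lambda>x. v2 x * g (?Y c x))"
        using integrable_real_times_bounded[OF v(2), of "\<lambda>x. g (?Y c x)"] g(1) by simp
      then show ?thesis
        by (subst Bochner_Integration.integral_add[symmetric]) (auto simp: v v2_def algebra_simps intro!: Bochner_Integration.integral_cong)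
    qed
    ultimately show ?thesis using tot by simp
  qed
  have IH: "(LINT x|M1. v1 x * (\<Prod>i\<in>J. indicator (A i) (X i x))) = (LINT x|M2. v2 x * (\<Prod>i\<in>J. indicator (A i) (Y i x)))"
  proof (rule insert.IH)
    fix c
    have cos: "(LINT x|M1. v1 x * cos (?X c x)) = (LINT x|M2. v2 x * cos (?Y c x))"
      by (rule trig[of cos "1/2" "1/2"]) (auto simp: cos_iexp add_divide_distrib)
    have sin: "(LINT x|M1. v1 x * sin (?X c x)) = (LINT x|M2. v2 x * sin (?Y c x))"
      by (rule trig[of sin "1/(2*\<i>)" "-1/(2*\<i>)"]) (auto simp: sin_iexp field_simps)
    have euler: "v *\<^sub>R iexp a = of_real (v * cos a) + \<i> * of_real (v * sin a)" for v a :: real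
      by (simp add: cis_conv_exp[symmetric] complex_eq_iff)
    have i1: "integrable M1 (\<lambda>x. v1 x * h (?X c x))" if "\<And>a. \<bar>h a\<bar> \<le> 1" "h \<in> borel_measurable borel" for h :: "real \<Rightarrow> real"
      using integrable_real_times_bounded[OF v(1), of "\<lambda>x. h (?X c x)"] that by simp
    have i2: "integrable M2 (\<lambda>x. v2 x * h (?Y c x))" if "\<And>a. \<bar>h a\<bar> \<le> 1" "h \<in> borel_measurable borel" for h :: "real \<Rightarrow> real"
      using integrable_real_times_bounded[OF v(2), of "\<lambda>x. h (?Y c x)"] that by simp
    show "(LINT x|M1. v1 x *\<^sub>R iexp (?X c x)) = (LINT x|M2. v2 x *\<^sub>R iexp (?Y c x))"
      unfolding euler using i1[of cos] i1[of sin] i2[of cos] i2[of sin]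
      by (simp add: Bochner_Integration.integral_add integrable_of_real integral_complex_of_real cos sin
          del: of_real_mult)
  qed (use insert.prems(8) XJ v v_nonneg in auto)
  then show ?case
    using insert.hyps by (simp add: v1_def v2_def mult.assoc)
qed

lemma Cramer_Wold:
  fixes X :: "'i \<Rightarrow> 'a \<Rightarrow> real" and Y :: "'i \<Rightarrow> 'b \<Rightarrow> real"
  assumes "prob_space M1" "prob_space M2" and I: "finite I"
    and X: "\<And>i. i \<in> I \<Longrightarrow> X i \<in> borel_measurable M1" and Y: "\<And>i. i \<in> I \<Longrightarrow> Y i \<in> borel_measurable M2"
    and eq: "\<And>c. (LINT x|M1. iexp (\<Sum>i\<in>I. c i * X i x)) = (LINT x|M2. iexp (\<Sum>i\<in>I. c i * Y i x))"
  shows "distr M1 (PiM I (\<lambda>_. borel)) (\<lambda>x. \<lambda>i\<in>I. X i x) = distr M2 (PiM I (\<lambda>_. borel)) (\<lambda>x. \<lambda>i\<in>I. Y i x)"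
proof -
  interpret M1: prob_space M1 by fact
  interpret M2: prob_space M2 by fact
  have box: "emeasure (distr M (PiM I (\<lambda>_. borel)) (\<lambda>x. \<lambda>i\<in>I. Z i x)) (Pi\<^sub>E I A) =
      ennreal (LINT x|M. (\<Prod>i\<in>I. indicator (A i) (Z i x)))"
    if "prob_space M" and Z [measurable]: "\<And>i. i \<in> I \<Longrightarrow> Z i \<in> borel_measurable M"
      and A [measurable]: "\<And>i. i \<in> I \<Longrightarrow> A i \<in> sets borel"
    for M :: "'c measure" and Z :: "'i \<Rightarrow> 'c \<Rightarrow> real" and A
  proof -
    interpret prob_space M by fact
    let ?E = "(\<lambda>x. \<lambda>i\<in>I. Z i x) -` Pi\<^sub>E I A \<inter> space M"
    have meas: "(\<lambda>x. \<lambda>i\<in>I. Z i x) \<in> measurable M (PiM I (\<lambda>_. borel))" by (rule measurable_restrict) fact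
    have box: "Pi\<^sub>E I A \<in> sets (PiM I (\<lambda>_. borel))" using I A by (intro sets_PiM_I_finite) auto
    have E: "?E \<in> sets M" by (rule measurable_sets[OF meas box])
    have "emeasure (distr M (PiM I (\<lambda>_. borel)) (\<lambda>x. \<lambda>i\<in>I. Z i x)) (Pi\<^sub>E I A) = ennreal (measure M ?E)"
      by (subst emeasure_distr[OF meas box]) (simp add: emeasure_eq_measure)
    also have "measure M ?E = (LINT x|M. indicator ?E x)" using E by simp
    also have "\<dots> = (LINT x|M. (\<Prod>i\<in>I. indicator (A i) (Z i x)))"
    proof (rule Bochner_Integration.integral_cong[OF refl])
      fix x assume x: "x \<in> space M"
      show "indicator ?E x = (\<Prod>i\<in>I. indicator (A i) (Z i x) :: real)"
      proof (cases "\<forall>i\<in>I. Z i x \<in> A i")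
        case True
        then show ?thesis using x by (auto simp: indicator_def)
      next
        case False
        then obtain i where i: "i \<in> I" "Z i x \<notin> A i" by auto
        then have "(\<Prod>i\<in>I. indicator (A i) (Z i x) :: real) = 0" using I by (intro prod_zero bexI[of _ i]) auto
        moreover have "x \<notin> ?E" using i by (auto simp: PiE_iff)
        ultimately show ?thesis by simp
      qed
    qed
    finally show ?thesis .
  qed
  interpret D: prob_space "distr M1 (PiM I (\<lambda>_. borel)) (\<lambda>x. \<lambda>i\<in>I. X i x)"
    by (intro M1.prob_space_distr measurable_restrict X)
  show ?thesis
  proof (rule measure_eqI_PiM_finite[OF I])
    fix A :: "'i \<Rightarrow> real set" assume A: "\<And>i. i \<in> I \<Longrightarrow> A i \<in> sets borel"
    have "(LINT x|M1. 1 * (\<Prod>i\<in>I. indicator (A i) (X i x))) = (\<integral>x. 1 * (\<Prod>i\<in>I. indicator (A i) (Y i x)) \<partial>M2 :: real)"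
      by (rule weighted_Cramer_Wold) (use I X Y A eq in auto)
    then show "emeasure (distr M1 (PiM I (\<lambda>_. borel)) (\<lambda>x. \<lambda>i\<in>I. X i x)) (Pi\<^sub>E I A) =
      emeasure (distr M2 (PiM I (\<lambda>_. borel)) (\<lambda>x. \<lambda>i\<in>I. Y i x)) (Pi\<^sub>E I A)"
      using A by (simp add: box[OF assms(1) X A] box[OF assms(2) Y A])
  next
    show "range (\<lambda>_::nat. space (PiM I (\<lambda>_. borel :: real measure))) \<subseteq> prod_algebra I (\<lambda>_. borel)"
      using space_in_prod_algebra[of I "\<lambda>_. borel :: real measure"] by (auto simp: space_PiM)
  qed auto
qed



section \<open>Centered Gaussian variables\<close>

text \<open>Gaussian variables of mean zero, described through their characteristic function. Point masses at 0 are
included, and closure under mean-square limits is immediate from this description.\<close>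

definition centered_gaussian :: "'a measure \<Rightarrow> ('a \<Rightarrow> real) \<Rightarrow> bool" where
  "centered_gaussian M Y \<longleftrightarrow> Y \<in> borel_measurable M \<and> integrable M (\<lambda>w. (Y w)\<^sup>2) \<and>
     (\<forall>t. (LINT w|M. iexp (t * Y w)) = of_real (exp (- (t\<^sup>2 * (LINT w|M. (Y w)\<^sup>2)) / 2)))"

context prob_space
begin

lemma centered_gaussianD:
  assumes "centered_gaussian M Y"
  shows "Y \<in> borel_measurable M" "integrable M (\<lambda>w. (Y w)\<^sup>2)"
    "(LINT w|M. iexp (t * Y w)) = of_real (exp (- (t\<^sup>2 * (LINT w|M. (Y w)\<^sup>2)) / 2))"
  using assms by (simp_all add: centered_gaussian_def)

lemma centered_gaussian_zero: "centered_gaussian M (\<lambda>_. 0)"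
  by (simp add: centered_gaussian_def prob_space)

lemma centered_gaussian_cong_AE:
  assumes Y: "centered_gaussian M Y" and "AE w in M. Y' w = Y w" and [measurable]: "Y' \<in> borel_measurable M"
  shows "centered_gaussian M Y'"
proof -
  note [measurable] = centered_gaussianD(1)[OF Y]
  have "integrable M (\<lambda>w. (Y' w)\<^sup>2) \<longleftrightarrow> integrable M (\<lambda>w. (Y w)\<^sup>2)"
    by (rule integrable_cong_AE) (use assms(2) in \<open>auto elim!: eventually_mono\<close>)
  moreover have "(LINT w|M. (Y' w)\<^sup>2) = (LINT w|M. (Y w)\<^sup>2)"
    by (rule integral_cong_AE) (use assms(2) in \<open>auto elim!: eventually_mono\<close>)
  moreover have "(LINT w|M. iexp (t * Y' w)) = (LINT w|M. iexp (t * Y w))" for t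
    by (rule integral_cong_AE) (use assms(2) in \<open>auto elim!: eventually_mono\<close>)
  ultimately show ?thesis using Y by (simp add: centered_gaussian_def)
qed

lemma normal_imp_centered_gaussian:
  assumes X: "distributed M lborel X (normal_density 0 \<sigma>)" and \<sigma>: "\<sigma> > 0"
  shows "centered_gaussian M X"
proof -
  have Xm: "X \<in> borel_measurable M" using distributed_measurable[OF X] by simp
  have std: "distributed M lborel (\<lambda>w. (X w - 0) / \<sigma>) std_normal_density"
    using normal_standard_normal_convert[OF \<sigma>, of X 0] X by simp
  then have std': "distributed M lborel (\<lambda>w. X w / \<sigma>) std_normal_density" by simp
  have sq: "integrable M (\<lambda>w. (X w / \<sigma>)\<^sup>2)" "(LINT w|M. (X w / \<sigma>)\<^sup>2) = 1"
    using distributed_integrable[OF std', of "\<lambda>x. x\<^sup>2"] distributed_integral[OF std', of "\<lambda>x. x\<^sup>2"]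
      integrable_std_normal_moment[of 2] integral_std_normal_moment_even[of 1]
    by (auto simp: fact_numeral)
  have int: "integrable M (\<lambda>w. (X w)\<^sup>2)"
    using integrable_mult_right[OF sq(1), of "\<sigma>\<^sup>2"] \<sigma> by (simp add: power_divide)
  have var: "(LINT w|M. (X w)\<^sup>2) = \<sigma>\<^sup>2"
    using sq(2) \<sigma> by (simp add: power_divide)
  have "(LINT w|M. iexp (t * X w)) = of_real (exp (- (t\<^sup>2 * \<sigma>\<^sup>2) / 2))" for t
  proof -
    have "(LINT w|M. iexp (t * X w)) = (LINT w|M. iexp ((t * \<sigma>) * (X w / \<sigma>)))" using \<sigma> by simp
    also have "\<dots> = (\<integral>x. iexp ((t * \<sigma>) * x) \<partial>distr M lborel (\<lambda>w. X w / \<sigma>))"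
      using Xm by (subst integral_distr) auto
    also have "\<dots> = char std_normal_distribution (t * \<sigma>)"
      unfolding distributed_distr_eq_density[OF std'] by (simp add: char_def)
    finally show ?thesis by (simp add: char_std_normal_distribution power_mult_distrib)
  qed
  then show ?thesis using Xm int var by (simp add: centered_gaussian_def)
qed

lemma centered_gaussian_imp_normal:
  assumes Y: "centered_gaussian M Y" and v: "(LINT w|M. (Y w)\<^sup>2) = \<sigma>\<^sup>2" and \<sigma>: "\<sigma> > 0"
  shows "distributed M lborel Y (normal_density 0 \<sigma>)"
proof -
  note [measurable] = centered_gaussianD(1)[OF Y]
  have "distr M borel (\<lambda>w. Y w / \<sigma>) = std_normal_distribution"
  proof (rule Levy_uniqueness)
    show "real_distribution (distr M borel (\<lambda>w. Y w / \<sigma>))" by (rule real_distribution_distr) simp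
    show "real_distribution std_normal_distribution" by (rule real_dist_normal_dist)
    show "char (distr M borel (\<lambda>w. Y w / \<sigma>)) = char std_normal_distribution"
    proof
      fix t
      have "char (distr M borel (\<lambda>w. Y w / \<sigma>)) t = (LINT w|M. iexp ((t / \<sigma>) * Y w))"
        unfolding char_def by (subst integral_distr) auto
      also have "\<dots> = of_real (exp (- (t\<^sup>2) / 2))"
        unfolding centered_gaussianD(3)[OF Y] v using \<sigma> by (simp add: power_divide)
      finally show "char (distr M borel (\<lambda>w. Y w / \<sigma>)) t = char std_normal_distribution t"
        by (simp add: char_std_normal_distribution)
    qed
  qed
  then have "distributed M lborel (\<lambda>w. Y w / \<sigma>) std_normal_density"
    unfolding distributed_def by (simp cong: distr_cong)
  then show ?thesis using normal_standard_normal_convert[OF \<sigma>, of Y 0] by simp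
qed

lemma centered_gaussian_cases:
  assumes Y: "centered_gaussian M Y"
  obtains "AE w in M. Y w = 0" | \<sigma> where "\<sigma> > 0" "distributed M lborel Y (normal_density 0 \<sigma>)"
proof (cases "(LINT w|M. (Y w)\<^sup>2) = 0")
  case True
  then have "AE w in M. (Y w)\<^sup>2 = 0"
    using integral_nonneg_eq_0_iff_AE[OF centered_gaussianD(2)[OF Y]] by simp
  then show ?thesis using that(1) by simp
next
  case False
  have nonneg: "0 \<le> (LINT w|M. (Y w)\<^sup>2)" by (rule Bochner_Integration.integral_nonneg) simp
  with False have "0 < (LINT w|M. (Y w)\<^sup>2)" by (metis order_le_less)
  then have pos: "0 < sqrt (LINT w|M. (Y w)\<^sup>2)" by simp
  show ?thesis by (rule that(2)[OF pos centered_gaussian_imp_normal[OF Y _ pos]]) (simp add: nonneg)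
qed

lemma centered_gaussian_rv: "centered_gaussian M Y \<Longrightarrow> gaussian_rv M Y"
  by (auto simp: gaussian_rv_def centered_gaussianD(1) elim!: centered_gaussian_cases)

lemma centered_gaussian_mean:
  assumes Y: "centered_gaussian M Y" shows "(LINT w|M. Y w) = 0"
  using Y
proof (cases rule: centered_gaussian_cases)
  case 1
  then show ?thesis by (rule integral_eq_zero_AE)
next
  case (2 \<sigma>)
  then show ?thesis using normal_distributed_expectation by blast
qed

lemma centered_gaussian_indep_sum:
  assumes I: "finite I" and indep: "indep_vars (\<lambda>_. borel) X I"
    and normal: "\<And>i. i \<in> I \<Longrightarrow> distributed M lborel (X i) (normal_density 0 (\<sigma> i))" "\<And>i. i \<in> I \<Longrightarrow> 0 < \<sigma> i"
  shows "centered_gaussian M (\<lambda>w. \<Sum>i\<in>I. a i * X i w)"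
proof -
  define J where "J = {i\<in>I. a i \<noteq> 0}"
  have J: "finite J" "J \<subseteq> I" using I by (auto simp: J_def)
  have eq: "(\<lambda>w. \<Sum>i\<in>I. a i * X i w) = (\<lambda>w. \<Sum>i\<in>J. a i * X i w)"
    using I by (intro ext sum.mono_neutral_right) (auto simp: J_def)
  show ?thesis
  proof (cases "J = {}")
    case True
    then show ?thesis unfolding eq by (simp add: centered_gaussian_zero)
  next
    case False
    have "indep_vars (\<lambda>_. borel) (\<lambda>i w. a i * X i w) J"
      by (rule indep_vars_compose2[OF indep_vars_subset[OF indep J(2)]]) simp
    moreover have "distributed M lborel (\<lambda>w. a i * X i w) (normal_density 0 (\<bar>a i\<bar> * \<sigma> i))" if "i \<in> J" for i
      using normal_density_affine[OF normal(1)[of i] normal(2)[of i], of "a i" 0] that by (auto simp: J_def)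
    ultimately have "distributed M lborel (\<lambda>w. \<Sum>i\<in>J. a i * X i w)
        (normal_density (\<Sum>i\<in>J. 0) (sqrt (\<Sum>i\<in>J. (\<bar>a i\<bar> * \<sigma> i)\<^sup>2)))"
      using J normal(2) False by (intro sum_indep_normal) (auto simp: J_def)
    moreover have "0 < (\<Sum>i\<in>J. (\<bar>a i\<bar> * \<sigma> i)\<^sup>2)"
      using J normal(2) False by (intro sum_pos) (auto simp: J_def less_imp_neq[symmetric])
    ultimately show ?thesis unfolding eq by (intro normal_imp_centered_gaussian[where \<sigma>="sqrt (\<Sum>i\<in>J. (\<bar>a i\<bar> * \<sigma> i)\<^sup>2)"]) auto
  qed
qed

lemma L2_const: "(\<lambda>_. c) \<in> L2 M"
  by (simp add: L2_def)

lemma L1_le_norm2: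
  assumes "f \<in> L2 M" shows "(LINT w|M. cmod (f w)) \<le> norm2 M f"
  using integral_cmod_mult_le[OF assms L2_const[of 1]] by (simp add: norm2_def[of M "\<lambda>_. 1"] prob_space)

lemma L2_integrable_L1: "f \<in> L2 M \<Longrightarrow> integrable M f"
  using L2_mult_integrable[OF _ L2_const[of 1]] by simp

lemma iexp_Lipschitz: "cmod (iexp a - iexp b) \<le> \<bar>a - b\<bar>"
proof -
  have "iexp a - iexp b = iexp b * (iexp (a - b) - 1)"
    using iexp_add[of b "a - b"] by (simp add: right_diff_distrib)
  then have "cmod (iexp a - iexp b) = cmod (iexp (a - b) - 1)"
    by (simp only: norm_mult norm_exp_i_times mult_1)
  also have "\<dots> \<le> \<bar>a - b\<bar>" using iexp_approx1[of "a - b" 0] by simp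
  finally show ?thesis .
qed

lemma centered_gaussian_L2_limit:
  assumes Y: "\<And>k. centered_gaussian M (Y k)" and Z: "(\<lambda>w. complex_of_real (Z w)) \<in> L2 M"
    and Zm [measurable]: "Z \<in> borel_measurable M"
    and lim: "L2_lim M (\<lambda>k w. complex_of_real (Y k w)) (\<lambda>w. complex_of_real (Z w))"
  shows "centered_gaussian M Z"
proof -
  have [measurable]: "Y k \<in> borel_measurable M" for k using centered_gaussianD(1)[OF Y] .
  have YL: "(\<lambda>w. complex_of_real (Y k w)) \<in> L2 M" for k
    using centered_gaussianD[OF Y[of k]] by (simp add: L2_def)
  define v where "v = (LINT w|M. (Z w)\<^sup>2)"
  have "(\<lambda>k. (norm2 M (\<lambda>w. complex_of_real (Y k w)))\<^sup>2) \<longlonglongrightarrow> (norm2 M (\<lambda>w. complex_of_real (Z w)))\<^sup>2"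
    by (intro tendsto_power norm2_tendsto YL Z lim)
  then have var: "(\<lambda>k. \<integral>w. (Y k w)\<^sup>2 \<partial>M) \<longlonglongrightarrow> v" by (simp add: norm2_sq v_def)
  have "(LINT w|M. iexp (t * Z w)) = of_real (exp (- (t\<^sup>2 * v) / 2))" for t
  proof (rule LIMSEQ_unique)
    show "(\<lambda>k. \<integral>w. iexp (t * Y k w) \<partial>M) \<longlonglongrightarrow> of_real (exp (- (t\<^sup>2 * v) / 2))"
      unfolding centered_gaussianD(3)[OF Y] by (intro tendsto_intros var) auto
    have "(\<lambda>k. (LINT w|M. iexp (t * Y k w)) - (LINT w|M. iexp (t * Z w))) \<longlonglongrightarrow> 0"
    proof (rule Lim_null_comparison[OF always_eventually], intro allI)
      show "(\<lambda>k. \<bar>t\<bar> * norm2 M (\<lambda>w. complex_of_real (Y k w) - complex_of_real (Z w))) \<longlonglongrightarrow> 0"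
        using tendsto_mult_right[OF lim, of "\<bar>t\<bar>"] by (simp add: mult.commute)
      fix k
      let ?d = "\<lambda>w. complex_of_real (Y k w) - complex_of_real (Z w)"
      have ie: "integrable M (\<lambda>w. iexp (t * W w))" if "W \<in> borel_measurable M" for W
        using that by (intro integrable_iexp) auto
      have dint: "integrable M (\<lambda>w. cmod (?d w))"
        by (intro integrable_norm L2_integrable_L1 L2_diff YL Z)
      have "(LINT w|M. iexp (t * Y k w)) - (LINT w|M. iexp (t * Z w)) = (LINT w|M. iexp (t * Y k w) - iexp (t * Z w))"
        by (rule Bochner_Integration.integral_diff[symmetric]) (intro ie; measurable)+
      also have "cmod \<dots> \<le> (LINT w|M. cmod (iexp (t * Y k w) - iexp (t * Z w)))"
        by (rule integral_norm_bound)
      also have "\<dots> \<le> (LINT w|M. \<bar>t\<bar> * cmod (?d w))"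
      proof (rule integral_mono)
        show "integrable M (\<lambda>w. cmod (iexp (t * Y k w) - iexp (t * Z w)))"
          by (intro integrable_norm Bochner_Integration.integrable_diff ie) measurable
        show "integrable M (\<lambda>w. \<bar>t\<bar> * cmod (?d w))" using dint by simp
        fix w
        show "cmod (iexp (t * Y k w) - iexp (t * Z w)) \<le> \<bar>t\<bar> * cmod (?d w)"
          using iexp_Lipschitz[of "t * Y k w" "t * Z w"]
          by (simp flip: of_real_diff right_diff_distrib add: abs_mult)
      qed
      also have "\<dots> \<le> \<bar>t\<bar> * norm2 M ?d"
        using L1_le_norm2[OF L2_diff[OF YL Z]] by (simp add: mult_left_mono)
      finally show "cmod ((LINT w|M. iexp (t * Y k w)) - (LINT w|M. iexp (t * Z w))) \<le> \<bar>t\<bar> * norm2 M ?d" .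
    qed
    then show "(\<lambda>k. \<integral>w. iexp (t * Y k w) \<partial>M) \<longlonglongrightarrow> (LINT w|M. iexp (t * Z w))" by (simp add: LIM_zero_iff)
  qed
  then show ?thesis using Z by (simp add: centered_gaussian_def v_def L2_def)
qed

text \<open>The characteristic function of the joint law factorizes, so by the Cramer-Wold theorem the joint law is the
product of the marginal laws.\<close>

lemma gaussian_uncorrelated_indep:
  fixes X :: "'i \<Rightarrow> 'a \<Rightarrow> real"
  assumes I: "finite I" and Xm: "\<And>i. X i \<in> borel_measurable M"
    and gauss: "\<And>c. centered_gaussian M (\<lambda>w. \<Sum>i\<in>I. c i * X i w)"
    and uncorr: "\<And>i j. i \<in> I \<Longrightarrow> j \<in> I \<Longrightarrow> i \<noteq> j \<Longrightarrow> (LINT w|M. X i w * X j w) = 0"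
  shows "indep_vars (\<lambda>_. borel) X I"
proof (cases "I = {}")
  case True
  then show ?thesis by (simp add: indep_vars_def indep_sets_def)
next
  case False
  note [measurable] = Xm
  let ?D = "\<lambda>i. distr M borel (X i)"
  interpret P: product_prob_space ?D I
    by (rule product_prob_spaceI) (intro prob_space_distr Xm)
  have one: "centered_gaussian M (\<lambda>w. c * X i w)" if "i \<in> I" for c i
    using gauss[of "\<lambda>j. if j = i then c else 0"] that I
    by (simp add: if_distrib[of "\<lambda>x. x * _"] cong: if_cong)
  have sq: "integrable M (\<lambda>w. (X i w)\<^sup>2)" if "i \<in> I" for i using centered_gaussianD(2)[OF one[OF that, of 1]] by simp
  have prod_int: "integrable M (\<lambda>w. X i w * X j w)" if "i \<in> I" "j \<in> I" for i j
  proof (rule Bochner_Integration.integrable_bound)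
    show "integrable M (\<lambda>w. (X i w)\<^sup>2 + (X j w)\<^sup>2)" using sq that by auto
    have "\<bar>a * b\<bar> \<le> a\<^sup>2 + b\<^sup>2" for a b :: real
      using sum_squares_bound[of "\<bar>a\<bar>" "\<bar>b\<bar>"] abs_mult[of a b] mult_nonneg_nonneg[OF abs_ge_zero[of a] abs_ge_zero[of b]]
      by simp
    then show "AE w in M. norm (X i w * X j w) \<le> norm ((X i w)\<^sup>2 + (X j w)\<^sup>2)" by auto
  qed simp
  have var: "(LINT w|M. (\<Sum>i\<in>I. c i * X i w)\<^sup>2) = (\<Sum>i\<in>I. (c i)\<^sup>2 * (LINT w|M. (X i w)\<^sup>2))" for c
  proof -
    have "(LINT w|M. (\<Sum>i\<in>I. c i * X i w)\<^sup>2) = (LINT w|M. (\<Sum>i\<in>I. \<Sum>j\<in>I. (c i * c j) * (X i w * X j w)))"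
      by (simp add: power2_eq_square sum_product mult_ac)
    also have "\<dots> = (\<Sum>i\<in>I. \<Sum>j\<in>I. (c i * c j) * (LINT w|M. X i w * X j w))"
      by (simp add: prod_int)
    also have "\<dots> = (\<Sum>i\<in>I. \<Sum>j\<in>I. if j = i then (c i)\<^sup>2 * (LINT w|M. (X i w)\<^sup>2) else 0)"
      by (intro sum.cong) (auto simp: uncorr power2_eq_square)
    finally show ?thesis using I by simp
  qed
  have "distr M (PiM I (\<lambda>_. borel)) (\<lambda>x. \<lambda>i\<in>I. X i x) = distr (PiM I ?D) (PiM I (\<lambda>_. borel)) (\<lambda>x. \<lambda>i\<in>I. x i)"
  proof (rule Cramer_Wold)
    show "prob_space M" by (rule prob_space_axioms)
    show "prob_space (PiM I ?D)" by (rule P.prob_space_axioms)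
    fix c :: "'i \<Rightarrow> real"
    have "(LINT w|M. iexp (\<Sum>i\<in>I. c i * X i w)) = of_real (exp (- (LINT w|M. (\<Sum>i\<in>I. c i * X i w)\<^sup>2) / 2))"
      using centered_gaussianD(3)[OF gauss, of 1 c] by simp
    also have "\<dots> = (\<Prod>i\<in>I. of_real (exp (- ((c i)\<^sup>2 * (LINT w|M. (X i w)\<^sup>2)) / 2)))"
      unfolding var using I by (simp add: exp_sum[symmetric] sum_negf sum_divide_distrib del: of_real_exp flip: of_real_prod)
    also have "\<dots> = (\<Prod>i\<in>I. \<integral>w. iexp (c i * X i w) \<partial>M)"
      using one[of _ 1] by (intro prod.cong refl) (subst centered_gaussianD(3), auto)
    also have "\<dots> = (\<Prod>i\<in>I. \<integral>x. iexp (c i * x) \<partial>?D i)"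
      by (intro prod.cong refl) (subst integral_distr, auto)
    also have "\<dots> = (\<integral>x. (\<Prod>i\<in>I. iexp (c i * x i)) \<partial>PiM I ?D)"
    proof (rule P.product_integral_prod[OF I, symmetric])
      fix i
      show "integrable (?D i) (\<lambda>x. iexp (c i * x))"
        by (rule prob_space.integrable_iexp[OF prob_space_distr]) auto
    qed
    also have "\<dots> = (\<integral>x. iexp (\<Sum>i\<in>I. c i * x i) \<partial>PiM I ?D)"
      using I by (simp add: exp_sum[symmetric] sum_distrib_left)
    finally show "(LINT w|M. iexp (\<Sum>i\<in>I. c i * X i w)) = (\<integral>x. iexp (\<Sum>i\<in>I. c i * x i) \<partial>PiM I ?D)" .
  next
    fix i assume "i \<in> I"
    then show "(\<lambda>x. x i) \<in> borel_measurable (PiM I ?D)"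
      using measurable_component_singleton[of i I ?D] by simp
  qed (use I Xm in auto)
  also have "distr (PiM I ?D) (PiM I (\<lambda>_. borel)) (\<lambda>x. \<lambda>i\<in>I. x i) = distr (PiM I ?D) (PiM I ?D) (\<lambda>x. x)"
    by (intro distr_cong) (auto intro!: sets_PiM_cong simp: space_PiM PiE_def extensional_restrict)
  also have "\<dots> = PiM I ?D" by simp
  finally show ?thesis using indep_vars_iff_distr_eq_PiM[OF False, where M'="\<lambda>_. borel" and X=X] Xm by simp
qed

end



section \<open>The Fourier transform of the Cauchy density\<close>

lemma integrable_Cauchy_density:
  fixes l :: real
  assumes "l > 0" shows "integrable lborel (\<lambda>v. 1 / (l\<^sup>2 + v\<^sup>2))"
proof -
  have base: "integrable lborel (\<lambda>v::real. inverse (1 + v\<^sup>2))"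
    using integrable_inverse_1_plus_square by (simp add: set_integrable_def)
  define C where "C = max 1 (1 / l\<^sup>2)"
  have C: "1 \<le> C" "1 \<le> C * l\<^sup>2" "C > 0" using assms by (auto simp: C_def field_simps max_def)
  have le: "1 / (l\<^sup>2 + v\<^sup>2) \<le> C * inverse (1 + v\<^sup>2)" for v :: real
  proof -
    have "v\<^sup>2 \<le> C * v\<^sup>2" using C(1) mult_right_mono[of 1 C "v\<^sup>2"] by simp
    then have "1 + v\<^sup>2 \<le> C * (l\<^sup>2 + v\<^sup>2)" using C(2) by (simp add: distrib_left)
    moreover have "l\<^sup>2 + v\<^sup>2 > 0" "1 + v\<^sup>2 > 0" using assms by (auto intro: add_pos_nonneg)
    ultimately show ?thesis by (simp add: field_simps)
  qed
  show ?thesis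
  proof (rule Bochner_Integration.integrable_bound)
    show "integrable lborel (\<lambda>v. C * inverse (1 + v\<^sup>2))" using base by simp
    have "norm (1 / (l\<^sup>2 + v\<^sup>2)) \<le> norm (C * inverse (1 + v\<^sup>2))" for v
      using le[of v] abs_ge_self[of "C * inverse (1 + v\<^sup>2)"] by (simp add: abs_of_nonneg)
    then show "AE v in lborel. norm (1 / (l\<^sup>2 + v\<^sup>2)) \<le> norm (C * inverse (1 + v\<^sup>2))" by simp
  qed measurable
qed

lemma integrable_exp_atLeast:
  assumes l: "l > 0" shows "integrable lborel (\<lambda>x. indicator {0..} x * exp (- l * x) :: real)"
proof (rule integrableI_nn_integral_finite)
  have "(\<integral>\<^sup>+x. ennreal (exp (- l * x)) * indicator {0..} x \<partial>lborel) = ennreal (0 - (- exp (- l * 0) / l))"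
  proof (rule nn_integral_FTC_atLeast)
    have "((\<lambda>x. exp (- (l * x))) \<longlongrightarrow> 0) at_top"
      using l by (intro filterlim_compose[OF exp_at_bot] filterlim_compose[OF filterlim_uminus_at_bot_at_top]
         filterlim_tendsto_pos_mult_at_top[OF tendsto_const]) (auto intro: filterlim_ident)
    then show "((\<lambda>x. - exp (- l * x) / l) \<longlongrightarrow> 0) at_top"
      using tendsto_divide[OF tendsto_minus tendsto_const, of _ 0 at_top l] l by fastforce
  qed (use l in \<open>auto intro!: derivative_eq_intros\<close>)
  then show "(\<integral>\<^sup>+x. ennreal (indicator {0..} x * exp (- l * x)) \<partial>lborel) = ennreal (1 / l)"
    by (simp add: indicator_mult_ennreal mult.commute)
qed auto

lemma one_sided_exp_transform:
  assumes l: "l > 0"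
  shows "(LINT x|lborel. (indicator {0..} x * exp (- l * x)) *\<^sub>R iexp (t * x)) = 1 / (of_real l - \<i> * of_real t)"
    (is "integral\<^sup>L lborel ?f = _")
proof -
  define z where "z = \<i> * of_real t - of_real l"
  have z: "z \<noteq> 0" using l by (auto simp: z_def complex_eq_iff)
  have int: "integrable lborel ?f"
    using integrable_exp_atLeast[OF l] by (rule integrable_real_times_bounded) auto
  have "((\<lambda>y. \<integral>x. indicator {..y} x *\<^sub>R ?f x \<partial>lborel) \<longlongrightarrow> integral\<^sup>L lborel ?f) at_top"
    by (rule tendsto_integral_at_top[OF _ int]) simp
  moreover have "\<forall>\<^sub>F y in at_top. exp (z * of_real y) / z - 1 / z = (LINT x|lborel. indicator {..y} x *\<^sub>R ?f x)"
    using eventually_ge_at_top[of "0::real"]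
  proof eventually_elim
    case (elim y)
    have "(LINT x|lborel. indicator {..y} x *\<^sub>R ?f x) = (LINT x|lborel. indicator {0..y} x *\<^sub>R exp (z * of_real x))"
      by (intro Bochner_Integration.integral_cong)
         (auto simp: indicator_def scaleR_conv_of_real z_def exp_of_real[symmetric] exp_add[symmetric] algebra_simps
           simp del: exp_of_real)
    also have "\<dots> = exp (z * of_real y) / z - exp (z * of_real 0) / z"
    proof (rule integral_FTC_Icc[OF elim])
      show "((\<lambda>x. exp (z * of_real x) / z) has_vector_derivative exp (z * of_real x)) (at x within {0..y})" for x
        using z by (auto intro!: derivative_eq_intros has_vector_derivative_real_field)
      show "continuous_on {0..y} (\<lambda>x. exp (z * of_real x))" by (intro continuous_intros)
    qed
    finally show ?case by simp
  qed
  ultimately have "((\<lambda>y. exp (z * of_real y) / z - 1 / z) \<longlongrightarrow> integral\<^sup>L lborel ?f) at_top"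
    by (rule Lim_transform_eventually[OF _ eventually_mono]) simp
  moreover have "((\<lambda>y. exp (z * of_real y) / z - 1 / z) \<longlongrightarrow> 0 / z - 1 / z) at_top"
  proof (intro tendsto_intros z)
    have "((\<lambda>y. exp (- (l * y))) \<longlongrightarrow> 0) at_top"
      using l by (intro filterlim_compose[OF exp_at_bot] filterlim_compose[OF filterlim_uminus_at_bot_at_top]
         filterlim_tendsto_pos_mult_at_top[OF tendsto_const]) (auto intro: filterlim_ident)
    then show "((\<lambda>y. exp (z * of_real y)) \<longlongrightarrow> 0) at_top"
      by (subst tendsto_norm_zero_iff[symmetric]) (simp add: z_def)
  qed
  ultimately have "integral\<^sup>L lborel ?f = 0 / z - 1 / z"
    by (rule tendsto_unique[rotated]) simp
  also have "\<dots> = 1 / (of_real l - \<i> * of_real t)"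
    by (simp add: z_def minus_divide_right)
  finally show ?thesis .
qed

lemma two_sided_exp_transform:
  assumes l: "l > 0"
  shows "integrable lborel (\<lambda>x. exp (- l * \<bar>x\<bar>))"
    and "(LINT x|lborel. exp (- l * \<bar>x\<bar>) *\<^sub>R iexp (t * x)) = of_real (2 * l / (l\<^sup>2 + t\<^sup>2))"
proof -
  let ?q = "\<lambda>x::real. indicator {0..} x * exp (- l * x) :: real"
  have q: "integrable lborel ?q" by (rule integrable_exp_atLeast[OF l])
  have q': "integrable lborel (\<lambda>x. ?q (- x))"
    using lborel_integrable_real_affine[OF q, of "-1" 0] by simp
  have AE: "AE x in lborel. exp (- l * \<bar>x\<bar>) = ?q x + ?q (- x)"
    using AE_lborel_singleton[of "0::real"] by eventually_elim (auto simp: indicator_def)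
  show "integrable lborel (\<lambda>x. exp (- l * \<bar>x\<bar>))"
    using Bochner_Integration.integrable_add[OF q q'] AE by (subst integrable_cong_AE) auto
  have i1: "integrable lborel (\<lambda>x. ?q x *\<^sub>R iexp (t * x))"
    using q by (rule integrable_real_times_bounded) auto
  have i2: "integrable lborel (\<lambda>x. ?q (- x) *\<^sub>R iexp (t * x))"
    using q' by (rule integrable_real_times_bounded) auto
  have "(LINT x|lborel. exp (- l * \<bar>x\<bar>) *\<^sub>R iexp (t * x)) = (LINT x|lborel. ?q x *\<^sub>R iexp (t * x) + ?q (- x) *\<^sub>R iexp (t * x))"
    using AE by (intro integral_cong_AE) (auto elim!: eventually_mono simp: scaleR_add_left)
  also have "\<dots> = (LINT x|lborel. ?q x *\<^sub>R iexp (t * x)) + (LINT x|lborel. ?q (- x) *\<^sub>R iexp (t * x))"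
    by (rule Bochner_Integration.integral_add[OF i1 i2])
  also have "(LINT x|lborel. ?q (- x) *\<^sub>R iexp (t * x)) = (LINT x|lborel. ?q x *\<^sub>R iexp ((-t) * x))"
    using lborel_integral_real_affine[of "-1" "\<lambda>x. ?q (- x) *\<^sub>R iexp (t * x)" 0] by simp
  also have "(LINT x|lborel. ?q x *\<^sub>R iexp (t * x)) + (LINT x|lborel. ?q x *\<^sub>R iexp ((-t) * x)) =
      1 / (of_real l - \<i> * of_real t) + 1 / (of_real l - \<i> * of_real (- t))"
    unfolding one_sided_exp_transform[OF l] ..
  also have "\<dots> = of_real (2 * l / (l\<^sup>2 + t\<^sup>2))"
  proof -
    have nz: "of_real l - \<i> * of_real t \<noteq> 0" "of_real l - \<i> * of_real (- t) \<noteq> 0"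
      using l by (auto simp: complex_eq_iff)
    have "(of_real l - \<i> * of_real t) * (of_real l - \<i> * of_real (- t)) = of_real (l\<^sup>2 + t\<^sup>2)"
      by (simp add: complex_eq_iff power2_eq_square)
    then show ?thesis using nz by (simp add: add_frac_eq)
  qed
  finally show "(LINT x|lborel. exp (- l * \<bar>x\<bar>) *\<^sub>R iexp (t * x)) = of_real (2 * l / (l\<^sup>2 + t\<^sup>2))" .
qed

definition Laplace_distribution :: "real \<Rightarrow> real measure" where
  "Laplace_distribution l = density lborel (\<lambda>x. ennreal (l / 2 * exp (- l * \<bar>x\<bar>)))"

lemma real_distribution_Laplace:
  assumes l: "l > 0" shows "real_distribution (Laplace_distribution l)"
proof -
  have "complex_of_real (LINT x|lborel. exp (- l * \<bar>x\<bar>)) = of_real (2 / l)"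
    using two_sided_exp_transform(2)[OF l, of 0] l by (simp add: scaleR_conv_of_real power2_eq_square del: of_real_divide)
  then have "(LINT x|lborel. exp (- l * \<bar>x\<bar>)) = 2 / l" unfolding of_real_eq_iff .
  then have "(\<integral>\<^sup>+x. ennreal (l / 2 * exp (- l * \<bar>x\<bar>)) \<partial>lborel) = 1"
    using two_sided_exp_transform(1)[OF l] l by (subst nn_integral_eq_integral) auto
  then have "prob_space (Laplace_distribution l)"
    by (intro prob_spaceI) (simp add: Laplace_distribution_def emeasure_density)
  then show ?thesis by (simp add: real_distribution_def real_distribution_axioms_def Laplace_distribution_def)
qed

lemma char_Laplace:
  assumes l: "l > 0" shows "char (Laplace_distribution l) t = of_real (l\<^sup>2 / (l\<^sup>2 + t\<^sup>2))"
proof -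
  have "char (Laplace_distribution l) t = (LINT x|lborel. (l / 2) *\<^sub>R (exp (- l * \<bar>x\<bar>) *\<^sub>R iexp (t * x)))"
    unfolding char_def Laplace_distribution_def using l by (subst integral_density) auto
  also have "\<dots> = (l / 2) *\<^sub>R of_real (2 * l / (l\<^sup>2 + t\<^sup>2))"
    unfolding integral_scaleR_right two_sided_exp_transform(2)[OF l] ..
  finally show ?thesis by (simp add: scaleR_conv_of_real power2_eq_square)
qed

lemma measure_Laplace_singleton:
  "measure (Laplace_distribution l) {a} = 0"
proof -
  have "emeasure (Laplace_distribution l) {a} = 0"
    unfolding Laplace_distribution_def
    by (subst emeasure_density) (auto simp: nn_integral_0_iff_AE intro: eventually_mono[OF AE_lborel_singleton[of a]])
  then show ?thesis by (simp add: measure_def)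
qed

lemma measure_Laplace_interval:
  assumes l: "l > 0" and ab: "0 \<le> a" "a \<le> b"
  shows "measure (Laplace_distribution l) {a<..b} = (exp (- l * a) - exp (- l * b)) / 2"
proof -
  have "emeasure (Laplace_distribution l) {a<..b} = (\<integral>\<^sup>+x. ennreal (l / 2 * exp (- l * x) * indicator {a..b} x) \<partial>lborel)"
    unfolding Laplace_distribution_def using l ab
    by (subst emeasure_density)
       (auto simp: indicator_def intro!: nn_integral_cong_AE eventually_mono[OF AE_lborel_singleton[of a]])
  also have "\<dots> = ennreal (- exp (- l * b) / 2 - (- exp (- l * a) / 2))"
  proof -
    have "has_bochner_integral lborel (\<lambda>x. l / 2 * exp (- l * x) * indicator {a..b} x)
        (- exp (- l * b) / 2 - (- exp (- l * a) / 2))"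
      by (rule has_bochner_integral_FTC_Icc_nonneg[where F="\<lambda>x. - exp (- l * x) / 2"])
         (use l ab in \<open>auto intro!: derivative_eq_intros\<close>)
    then show ?thesis
      using l by (subst nn_integral_eq_integral) (auto simp: has_bochner_integral_iff diff_divide_distrib)
  qed
  finally have "emeasure (Laplace_distribution l) {a<..b} = ennreal ((exp (- l * a) - exp (- l * b)) / 2)"
    by (simp add: field_simps)
  moreover have "exp (- l * b) \<le> exp (- l * a)" using l ab by simp
  ultimately show ?thesis by (simp add: measure_def)
qed

lemma exp_diff_quotient:
  fixes c :: "'a::{real_normed_field, banach}"
  shows "(\<lambda>n. (1 - exp (- c * of_real (1 / real (Suc n)))) / of_real (1 / real (Suc n))) \<longlonglongrightarrow> c"
proof -
  let ?h = "\<lambda>n. 1 / real (Suc n)"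
  have "((\<lambda>h. (exp (- c * h) - exp (- c * 0)) / h) \<longlongrightarrow> - c) (at 0)"
  proof -
    have "((\<lambda>h. exp (- c * h)) has_field_derivative - c) (at 0)"
      by (auto intro!: derivative_eq_intros)
    then show ?thesis by (simp add: DERIV_def)
  qed
  moreover have "filterlim (\<lambda>n. of_real (?h n) :: 'a) (at 0) sequentially"
  proof (rule filterlim_atI)
    have "?h \<longlonglongrightarrow> 0"
      using LIMSEQ_inverse_real_of_nat by (simp add: inverse_eq_divide)
    from tendsto_of_real[OF this, where 'a='a]
    show "(\<lambda>n. of_real (?h n) :: 'a) \<longlonglongrightarrow> 0" by (simp only: of_real_0)
    show "\<forall>\<^sub>F n in sequentially. (of_real (?h n) :: 'a) \<noteq> 0"
    proof (rule always_eventually, rule allI)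
      fix n
      have "?h n \<noteq> 0" by simp
      then show "(of_real (?h n) :: 'a) \<noteq> 0" unfolding of_real_eq_0_iff .
    qed
  qed
  ultimately have lim: "(\<lambda>n. (exp (- c * of_real (?h n)) - exp (- c * 0)) / of_real (?h n)) \<longlonglongrightarrow> - c"
    by (rule filterlim_compose)
  have "- ((a - exp (- c * 0)) / h) = (1 - a) / h" for a h :: 'a
    by (simp add: diff_divide_distrib)
  note eq = this
  from tendsto_minus[OF lim] show ?thesis unfolding eq minus_minus .
qed

text \<open>For an integrable characteristic function the truncated integrals of the inversion theorem converge to an
integral over the whole line.\<close>

lemma Levy_Inversion_integrable_char:
  assumes M: "real_distribution M" and ab: "a \<le> b" "measure M {a} = 0" "measure M {b} = 0"
    and int: "integrable lborel (char M)"
  shows "(LINT t|lborel. (iexp (-(t * a)) - iexp (-(t * b))) / (\<i> * t) * char M t) = of_real (2 * pi * measure M {a<..b})"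
proof -
  interpret real_distribution M by fact
  let ?F = "\<lambda>t::real. (iexp (-(t * a)) - iexp (-(t * b))) / (\<i> * t) * char M t"
  have [measurable]: "?F \<in> borel_measurable borel" by measurable
  have bnd: "AE t in lborel. cmod (?F t) \<le> (b - a) * cmod (char M t)"
    using AE_lborel_singleton[of "0::real"]
  proof eventually_elim
    case (elim t)
    have "cmod ((iexp (-(t * a)) - iexp (-(t * b))) / (\<i> * t)) \<le> b - a"
      using Levy_Inversion_aux2[OF ab(1), of "- t"] elim by (simp add: norm_divide norm_mult norm_minus_commute)
    then show ?case unfolding norm_mult by (intro mult_right_mono) auto
  qed
  have w: "integrable lborel (\<lambda>t. (b - a) * cmod (char M t))" using int by simp
  have "(\<lambda>T::nat. \<integral>t. indicator {- real T..real T} t *\<^sub>R ?F t \<partial>lborel) \<longlonglongrightarrow> (LINT t|lborel. ?F t)"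
  proof (rule integral_dominated_convergence[OF _ _ w])
    show "AE t in lborel. (\<lambda>T::nat. indicator {- real T..real T} t *\<^sub>R ?F t) \<longlonglongrightarrow> ?F t"
    proof (intro AE_I2 tendsto_eventually)
      fix t :: real
      obtain N :: nat where "\<bar>t\<bar> \<le> N" using real_arch_simple by blast
      then show "\<forall>\<^sub>F T in sequentially. indicator {- real T..real T} t *\<^sub>R ?F t = ?F t"
        unfolding eventually_sequentially by (intro exI[of _ N]) (auto simp: indicator_def)
    qed
    show "AE t in lborel. norm (indicator {- real T..real T} t *\<^sub>R ?F t) \<le> (b - a) * cmod (char M t)" for T :: nat
      using bnd by eventually_elim (use ab in \<open>auto simp: indicator_def\<close>)
  qed auto
  from tendsto_mult_left[OF this, of "1 / (2 * pi)"]
  have "(\<lambda>T::nat. 1 / (2 * pi) * (CLBINT t=-T..T. ?F t)) \<longlonglongrightarrow> 1 / (2 * pi) * (LINT t|lborel. ?F t)"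
    by (simp add: interval_integral_Icc set_lebesgue_integral_def)
  moreover have "(\<lambda>T::nat. 1 / (2 * pi) * (CLBINT t=-T..T. ?F t)) \<longlonglongrightarrow> measure M {a<..b}"
    using Levy_Inversion[OF ab] by simp
  ultimately have "1 / (2 * pi) * (LINT t|lborel. ?F t) = of_real (measure M {a<..b})"
    by (rule LIMSEQ_unique)
  then show ?thesis by (simp add: field_simps)
qed

text \<open>The characteristic function of the Laplace distribution is proportional to the Cauchy density, so this is Fourier
inversion at \<open>\<bar>x\<bar>\<close>. It is obtained by applying the inversion theorem to the intervals \<open>(\<bar>x\<bar>, \<bar>x\<bar> + h]\<close>, dividing
by \<open>h\<close>, and letting \<open>h\<close> tend to 0 through \<open>1/(n+1)\<close>.\<close>

lemma Cauchy_density_transform: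
  assumes l: "l > 0"
  shows "(LINT v|lborel. iexp (v * x) / of_real (l\<^sup>2 + v\<^sup>2)) = of_real (pi / l * exp (- l * \<bar>x\<bar>))"
proof -
  let ?h = "\<lambda>n. 1 / real (Suc n)"
  let ?c = "\<lambda>t. complex_of_real (l\<^sup>2 / (l\<^sup>2 + t\<^sup>2))"
  have c_int: "integrable lborel ?c"
    using integrable_mult_right[OF integrable_Cauchy_density[OF l], of "l\<^sup>2"] by (intro integrable_of_real) simp
  have c_char: "char (Laplace_distribution l) = ?c" using char_Laplace[OF l] by auto
  define D where "D n t = (iexp (-(t * \<bar>x\<bar>)) - iexp (-(t * (\<bar>x\<bar> + ?h n)))) / (\<i> * t) * ?c t" for n and t :: real
  have D: "(LINT t|lborel. D n t) = of_real (pi * exp (- l * \<bar>x\<bar>) * (1 - exp (- l * ?h n)))" for n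
  proof -
    have "(LINT t|lborel. D n t) = of_real (2 * pi * measure (Laplace_distribution l) {\<bar>x\<bar><..\<bar>x\<bar> + ?h n})"
      unfolding D_def
      by (rule Levy_Inversion_integrable_char[OF real_distribution_Laplace[OF l] _
            measure_Laplace_singleton measure_Laplace_singleton, unfolded c_char, OF _ c_int]) simp
    also have "\<dots> = of_real (pi * exp (- l * \<bar>x\<bar>) * (1 - exp (- l * ?h n)))"
    proof -
      have "exp (- l * (\<bar>x\<bar> + ?h n)) = exp (- l * \<bar>x\<bar>) * exp (- l * ?h n)"
        unfolding distrib_left exp_add ..
      moreover have "measure (Laplace_distribution l) {\<bar>x\<bar><..\<bar>x\<bar> + ?h n} =
          (exp (- l * \<bar>x\<bar>) - exp (- l * (\<bar>x\<bar> + ?h n))) / 2"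
        by (rule measure_Laplace_interval[OF l]) simp_all
      moreover have "2 * pi * ((u - u * v) / 2) = pi * u * (1 - v)" for u v :: real
        by (simp add: field_simps)
      ultimately show ?thesis by (simp only:)
    qed
    finally show ?thesis .
  qed
  have Dm [measurable]: "D n \<in> borel_measurable borel" for n unfolding D_def by measurable
  have "(\<lambda>n. \<integral>t. D n t / of_real (?h n) \<partial>lborel) \<longlonglongrightarrow> (LINT t|lborel. iexp (-(t * \<bar>x\<bar>)) * ?c t)"
  proof (rule integral_dominated_convergence)
    show "integrable lborel (\<lambda>t. cmod (?c t))" using c_int by (rule integrable_norm)
    show "AE t in lborel. norm (D n t / of_real (?h n)) \<le> cmod (?c t)" for n
      using AE_lborel_singleton[of "0::real"]
    proof eventually_elim
      case (elim t)
      have "cmod ((iexp (-(t * \<bar>x\<bar>)) - iexp (-(t * (\<bar>x\<bar> + ?h n)))) / (\<i> * t)) \<le> ?h n"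
        using Levy_Inversion_aux2[of "\<bar>x\<bar>" "\<bar>x\<bar> + ?h n" "- t"] elim
        by (simp add: norm_divide norm_mult norm_minus_commute)
      from mult_right_mono[OF this, of "cmod (?c t)"]
      have "cmod (D n t) \<le> ?h n * cmod (?c t)" unfolding D_def norm_mult by simp
      then have "cmod (D n t) / ?h n \<le> cmod (?c t)"
        by (subst pos_divide_le_eq) (simp_all only: mult.commute, simp)
      moreover have "\<bar>?h n\<bar> = ?h n" by simp
      ultimately show ?case by (simp only: norm_divide norm_of_real)
    qed
    show "AE t in lborel. (\<lambda>n. D n t / of_real (?h n)) \<longlonglongrightarrow> iexp (-(t * \<bar>x\<bar>)) * ?c t"
      using AE_lborel_singleton[of "0::real"]
    proof eventually_elim
      case (elim t)
      have "(\<lambda>n. iexp (-(t * \<bar>x\<bar>)) / (\<i> * t) * ((1 - exp (- (\<i> * t) * of_real (?h n))) / of_real (?h n)) * ?c t)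
          \<longlonglongrightarrow> iexp (-(t * \<bar>x\<bar>)) / (\<i> * t) * (\<i> * t) * ?c t"
        by (intro tendsto_mult_right tendsto_mult_left exp_diff_quotient)
      moreover have "iexp (-(t * \<bar>x\<bar>)) / (\<i> * t) * ((1 - exp (- (\<i> * t) * of_real (?h n))) / of_real (?h n)) * ?c t
          = D n t / of_real (?h n)" for n
      proof -
        have "iexp (-(t * (\<bar>x\<bar> + ?h n))) = iexp (-(t * \<bar>x\<bar>)) * exp (- (\<i> * t) * of_real (?h n))"
          by (simp add: exp_add[symmetric] algebra_simps)
        moreover have "e / d * ((1 - f) / h) * c = ((e - e * f) / d * c) / h" for e d f h c :: complex
          by (simp add: divide_inverse algebra_simps)
        ultimately show ?thesis unfolding D_def by (simp only:)
      qed
      ultimately show ?case using elim by simp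
    qed
  qed auto
  moreover have "(\<lambda>n. \<integral>t. D n t / of_real (?h n) \<partial>lborel) \<longlonglongrightarrow> complex_of_real (pi * exp (- l * \<bar>x\<bar>) * l)"
  proof -
    have eq: "(LINT t|lborel. D n t / of_real (?h n)) =
        complex_of_real (pi * exp (- l * \<bar>x\<bar>) * ((1 - exp (- l * of_real (?h n))) / of_real (?h n)))" for n
      unfolding integral_divide_zero D
      by (simp only: of_real_divide[symmetric] times_divide_eq_right of_real_eq_id id_apply)
    have "(\<lambda>n. complex_of_real (pi * exp (- l * \<bar>x\<bar>) * ((1 - exp (- l * of_real (?h n))) / of_real (?h n)))) \<longlonglongrightarrow> of_real (pi * exp (- l * \<bar>x\<bar>) * l)"
      by (intro tendsto_of_real tendsto_mult_left exp_diff_quotient)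
    then show ?thesis unfolding eq .
  qed
  ultimately have eq: "(LINT t|lborel. iexp (-(t * \<bar>x\<bar>)) * ?c t) = of_real (pi * exp (- l * \<bar>x\<bar>) * l)"
    by (rule LIMSEQ_unique)
  have refl: "(LINT t|lborel. iexp (-(t * y)) * ?c t) = (LINT t|lborel. iexp (t * y) * ?c t)" for y
    using lborel_integral_real_affine[of "-1" "\<lambda>t. iexp (-(t * y)) * ?c t" 0] by simp
  have "(LINT t|lborel. iexp (t * x) * ?c t) = of_real (pi * exp (- l * \<bar>x\<bar>) * l)"
    using eq refl[of x] by (cases "x \<ge> 0") simp_all
  moreover have "(LINT t|lborel. iexp (t * x) * ?c t) = of_real (l\<^sup>2) * (LINT v|lborel. iexp (v * x) / of_real (l\<^sup>2 + v\<^sup>2))"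
    by (subst integral_mult_right_zero[symmetric]) (simp add: mult.commute)
  ultimately show ?thesis using l by (simp add: field_simps power2_eq_square)
qed



section \<open>Brownian motion at finitely many times\<close>

context prob_space
begin

lemma normal_second_moment:
  assumes "distributed M lborel X (normal_density 0 \<sigma>)" "\<sigma> > 0"
  shows "(LINT w|M. (X w)\<^sup>2) = \<sigma>\<^sup>2"
  using normal_distributed_variance[OF assms(2,1)] normal_distributed_expectation[OF assms(2,1)] by simp

text \<open>Sorted together with 0, the times cut \<open>[0, \<infinity>)\<close> into intervals, and each value is almost surely the sum of the
independent increments before it.\<close>

lemma brownian_combination_gaussian:
  assumes B: "standard_brownian_motion M B" and F: "finite F" "F \<subseteq> {0..}"
  shows "centered_gaussian M (\<lambda>w. \<Sum>t\<in>F. a t * B t w)"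
proof -
  have incr: "independent_gaussian_increments M {0..} B" and B0: "AE w in M. B 0 w = 0"
    using B by (auto simp: standard_brownian_motion_def)
  have Bm: "B t \<in> borel_measurable M" if "t \<ge> 0" for t
    using incr that by (auto simp: independent_gaussian_increments_def)
  define xs where "xs = sorted_list_of_set (insert 0 F)"
  define m where "m = length xs - 1"
  define \<tau> where "\<tau> i = xs ! i" for i
  define D where "D i w = B (\<tau> (Suc i)) w - B (\<tau> i) w" for i w
  have xs: "set xs = insert 0 F" "sorted_wrt (<) xs" "length xs = Suc m"
  proof -
    have fin: "finite (insert 0 F)" using F by simp
    show "set xs = insert 0 F" unfolding xs_def by (rule set_sorted_list_of_set[OF fin])
    show "sorted_wrt (<) xs" unfolding xs_def by (rule strict_sorted_list_of_set)
    have "length xs = card (insert 0 F)" unfolding xs_def by (rule sorted_list_of_set.length_sorted_key_list_of_set)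
    moreover have "card (insert 0 F) > 0" using fin by (simp add: card_gt_0_iff)
    ultimately show "length xs = Suc m" by (simp only: m_def Suc_diff_1)
  qed
  have less: "\<tau> i < \<tau> j" if "i < j" "j \<le> m" for i j
    using sorted_wrt_nth_less[OF xs(2) that(1)] that xs(3) by (simp add: \<tau>_def)
  have nonneg: "0 \<le> \<tau> i" if "i \<le> m" for i
  proof -
    have "xs ! i \<in> set xs" using that xs(3) by (intro nth_mem) simp
    then show ?thesis unfolding xs(1) \<tau>_def using F(2) by auto
  qed
  have \<tau>0: "\<tau> 0 = 0"
  proof -
    obtain j where "j < length xs" "xs ! j = 0" using xs(1) by (metis in_set_conv_nth insertI1)
    then show ?thesis using less[of 0 j] nonneg[of 0] xs(3) by (cases "j = 0") (auto simp: \<tau>_def)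
  qed
  have \<tau>_in: "\<forall>i\<le>m. \<tau> i \<in> {0..}" "\<forall>i<m. \<tau> i < \<tau> (Suc i)" using nonneg less by auto
  have "indep_vars (\<lambda>_. borel) D {..<m}"
  proof -
    have "\<And>(m::nat) \<tau>. (\<forall>i\<le>m. \<tau> i \<in> {0..}) \<and> (\<forall>i<m. \<tau> i < \<tau> (Suc i)) \<Longrightarrow>
        indep_vars (\<lambda>_. borel) (\<lambda>i w. B (\<tau> (Suc i)) w - B (\<tau> i) w) {..<m}"
      using incr unfolding independent_gaussian_increments_def by simp
    from this[OF conjI[OF \<tau>_in]] show ?thesis unfolding D_def[abs_def] .
  qed
  moreover have "distributed M lborel (D i) (normal_density 0 (sqrt (\<tau> (Suc i) - \<tau> i)))" if "i \<in> {..<m}" for i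
  proof -
    have "\<And>s t. 0 \<le> s \<Longrightarrow> 0 \<le> t \<Longrightarrow> s < t \<Longrightarrow>
        distributed M lborel (\<lambda>w. B t w - B s w) (normal_density 0 (sqrt (t - s)))"
      using incr unfolding independent_gaussian_increments_def by simp
    from this[OF nonneg nonneg less, of i "Suc i"] that show ?thesis unfolding D_def[abs_def] by simp
  qed
  ultimately have "centered_gaussian M (\<lambda>w. \<Sum>i<m. (\<Sum>t\<in>F. if \<tau> i < t then a t else 0) * D i w)"
    using less by (intro centered_gaussian_indep_sum) auto
  moreover have "AE w in M. (\<Sum>t\<in>F. a t * B t w) = (\<Sum>i<m. (\<Sum>t\<in>F. if \<tau> i < t then a t else 0) * D i w)"
    using B0
  proof eventually_elim
    case (elim w)
    have "B t w = (\<Sum>i<m. if \<tau> i < t then D i w else 0)" if "t \<in> F" for t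
    proof -
      have "t \<in> set xs" using that xs(1) by simp
      then obtain j where "j < length xs" "xs ! j = t" unfolding in_set_conv_nth by blast
      then have j: "j \<le> m" "t = \<tau> j" using xs(3) by (simp_all add: \<tau>_def)
      have lt: "\<tau> i < \<tau> j \<longleftrightarrow> i < j" if "i < m" for i
        using less[of i j] less[of j i] j that by (cases i j rule: linorder_cases) auto
      have "(\<Sum>i<m. if \<tau> i < t then D i w else 0) = (\<Sum>i<j. D i w)"
        using j lt by (intro sum.mono_neutral_cong_right) auto
      also have "\<dots> = B (\<tau> j) w - B (\<tau> 0) w"
        unfolding D_def by (rule sum_lessThan_telescope)
      finally show ?thesis using elim j \<tau>0 by simp
    qed
    then have "(\<Sum>t\<in>F. a t * B t w) = (\<Sum>t\<in>F. \<Sum>i<m. a t * (if \<tau> i < t then D i w else 0))"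
      by (simp add: sum_distrib_left)
    also have "\<dots> = (\<Sum>i<m. \<Sum>t\<in>F. a t * (if \<tau> i < t then D i w else 0))" by (rule sum.swap)
    also have "\<dots> = (\<Sum>i<m. (\<Sum>t\<in>F. if \<tau> i < t then a t else 0) * D i w)"
      by (auto intro!: sum.cong simp: sum_distrib_right)
    finally show ?case .
  qed
  ultimately show ?thesis
    by (rule centered_gaussian_cong_AE) (use F Bm in \<open>auto intro!: borel_measurable_sum\<close>)
qed

lemma brownian_covariance:
  assumes B: "standard_brownian_motion M B" and st: "0 < s" "s \<le> t"
  shows "(LINT w|M. B s w * B t w) = s"
proof -
  have incr: "independent_gaussian_increments M {0..} B" and B0: "AE w in M. B 0 w = 0"
    using B by (auto simp: standard_brownian_motion_def)
  have [measurable]: "B t \<in> borel_measurable M" if "t \<ge> 0" for t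
    using incr that by (auto simp: independent_gaussian_increments_def)
  have inc: "(LINT w|M. (B v w - B u w)\<^sup>2) = v - u" if "0 \<le> u" "u \<le> v" for u v
  proof (cases "u = v")
    case False
    then show ?thesis
      using incr that normal_second_moment[of "\<lambda>w. B v w - B u w" "sqrt (v - u)"]
      by (auto simp: independent_gaussian_increments_def)
  qed simp
  have sq: "integrable M (\<lambda>w. (B u w)\<^sup>2)" "(LINT w|M. (B u w)\<^sup>2) = u" if "0 \<le> u" for u
  proof -
    show "integrable M (\<lambda>w. (B u w)\<^sup>2)"
      using centered_gaussianD(2)[OF brownian_combination_gaussian[OF B, of "{u}" "\<lambda>_. 1"]] that by simp
    have "(LINT w|M. (B u w)\<^sup>2) = (LINT w|M. (B u w - B 0 w)\<^sup>2)"
      using that by (intro integral_cong_AE) (use B0 in \<open>auto elim!: eventually_mono\<close>)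
    then show "(LINT w|M. (B u w)\<^sup>2) = u" using inc[of 0 u] that by simp
  qed
  have int2: "integrable M (\<lambda>w. (B t w - B s w)\<^sup>2)"
  proof (rule Bochner_Integration.integrable_bound)
    show "integrable M (\<lambda>w. 2 * (B t w)\<^sup>2 + 2 * (B s w)\<^sup>2)" using sq st by auto
    have "(x - y)\<^sup>2 \<le> 2 * x\<^sup>2 + 2 * y\<^sup>2" for x y :: real
      using zero_le_power2[of "x + y"] by (simp add: power2_eq_square algebra_simps)
    then show "AE w in M. norm ((B t w - B s w)\<^sup>2) \<le> norm (2 * (B t w)\<^sup>2 + 2 * (B s w)\<^sup>2)" by simp
  qed (use st in auto)
  have polar: "B s w * B t w = ((B t w)\<^sup>2 + (B s w)\<^sup>2 - (B t w - B s w)\<^sup>2) / 2" for w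
    by (simp add: power2_eq_square algebra_simps)
  have "(LINT w|M. B s w * B t w) = (LINT w|M. ((B t w)\<^sup>2 + (B s w)\<^sup>2 - (B t w - B s w)\<^sup>2) / 2)"
    unfolding polar ..
  also have "\<dots> = (t + s - (t - s)) / 2"
    using sq st int2 inc[of s t] by simp
  finally show ?thesis by simp
qed

end

section \<open>Riemann sums\<close>

text \<open>Right endpoints are sampled because the integrands used later need a description at positive times only.\<close>

lemma Riemann_sums_tendsto:
  fixes G :: "real \<Rightarrow> 'b::banach"
  assumes ab: "a \<le> b" and G: "continuous_on {a..b} G"
  shows "(\<lambda>n. \<Sum>k<Suc n. ((b - a) / real (Suc n)) *\<^sub>R G (a + real (Suc k) * ((b - a) / real (Suc n))))
    \<longlonglongrightarrow> integral {a..b} G"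
proof (rule LIMSEQ_I)
  fix r :: real assume r: "r > 0"
  define e where "e = r / (b - a + 1)"
  have e: "e > 0" "(b - a) * e < r"
  proof -
    show "e > 0" using r ab by (simp add: e_def)
    then show "(b - a) * e < r" using r ab by (simp add: e_def field_simps)
  qed
  have "uniformly_continuous_on {a..b} G" by (rule compact_uniformly_continuous[OF G]) simp
  then obtain d where d: "d > 0" "\<And>x y. x \<in> {a..b} \<Longrightarrow> y \<in> {a..b} \<Longrightarrow> dist y x < d \<Longrightarrow> dist (G y) (G x) < e"
    using e(1) unfolding uniformly_continuous_on_def by metis
  obtain N where N: "(b - a) / d < real N" using reals_Archimedean2 by blast
  have "norm ((\<Sum>k<Suc n. ((b - a) / real (Suc n)) *\<^sub>R G (a + real (Suc k) * ((b - a) / real (Suc n)))) - integral {a..b} G) < r"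
    if n: "n \<ge> N" for n
  proof -
    define h where "h = (b - a) / real (Suc n)"
    have h: "0 \<le> h" "real (Suc n) * h = b - a" using ab by (auto simp: h_def)
    have hd: "h < d"
    proof -
      have "real N < real (Suc n)" using n by simp
      then have "(b - a) / d < real (Suc n)" using N by linarith
      then show ?thesis using d(1) by (simp add: h_def field_simps del: of_nat_Suc)
    qed
    have le_b: "a + real m * h \<le> b" if "m \<le> Suc n" for m
      using mult_right_mono[OF of_nat_mono[OF that], of h] h by (simp del: of_nat_Suc)
    have "norm ((\<Sum>k<m. h *\<^sub>R G (a + real (Suc k) * h)) - integral {a..a + real m * h} G) \<le> real m * (h * e)"
      if "m \<le> Suc n" for m
      using that
    proof (induction m)
      case (Suc m)
      define x where "x = a + real m * h"
      have x: "a \<le> x" "x + h \<le> b" "a + real (Suc m) * h = x + h"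
        using h le_b[OF Suc.prems] by (auto simp: x_def algebra_simps)
      have int: "G integrable_on {c..d}" if "a \<le> c" "d \<le> b" for c d
        by (rule integrable_continuous_real[OF continuous_on_subset[OF G]]) (use that in auto)
      have "integral {a..x} G + integral {x..x + h} G = integral {a..x + h} G"
        using x h by (intro Henstock_Kurzweil_Integration.integral_combine int) auto
      then have split: "h *\<^sub>R G (x + h) - integral {x..x + h} G =
          h *\<^sub>R G (x + h) + integral {a..x} G - integral {a..x + h} G" by (simp add: algebra_simps)
      have "norm (integral {x..x + h} (\<lambda>y. G (x + h) - G y)) \<le> e * (x + h - x)"
      proof (rule integral_bound)
        show "continuous_on {x..x + h} (\<lambda>y. G (x + h) - G y)"
          using x h by (intro continuous_intros continuous_on_subset[OF G]) auto
        show "norm (G (x + h) - G y) \<le> e" if "y \<in> {x..x + h}" for y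
          using d(2)[of y "x + h"] x h hd that by (auto simp: dist_norm intro: less_imp_le)
      qed (use h in auto)
      moreover have "integral {x..x + h} (\<lambda>y. G (x + h) - G y) = h *\<^sub>R G (x + h) - integral {x..x + h} G"
        using int[of x "x + h"] x h by (subst Henstock_Kurzweil_Integration.integral_diff) auto
      ultimately have one: "norm (h *\<^sub>R G (x + h) - integral {x..x + h} G) \<le> h * e" by (simp add: mult.commute)
      have "(\<Sum>k<Suc m. h *\<^sub>R G (a + real (Suc k) * h)) - integral {a..x + h} G =
         ((\<Sum>k<m. h *\<^sub>R G (a + real (Suc k) * h)) - integral {a..x} G) + (h *\<^sub>R G (x + h) - integral {x..x + h} G)"
        unfolding split sum.lessThan_Suc x(3) by simp
      also have "norm \<dots> \<le> real m * (h * e) + h * e"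
        using Suc by (intro norm_triangle_mono one) (simp_all add: x_def)
      finally show ?case unfolding x(3) by (simp add: distrib_right)
    qed simp
    note bound = this[OF le_refl]
    have "a + real (Suc n) * h = b" using h(2) by (simp del: of_nat_Suc)
    note bound = bound[unfolded this]
    then have "norm ((\<Sum>k<Suc n. h *\<^sub>R G (a + real (Suc k) * h)) - integral {a..b} G) \<le> real (Suc n) * h * e"
      by (simp only: mult.assoc)
    also have "\<dots> < r" unfolding h(2) by (rule e(2))
    finally show ?thesis unfolding h_def .
  qed
  then show "\<exists>N. \<forall>n\<ge>N. norm ((\<Sum>k<Suc n. ((b - a) / real (Suc n)) *\<^sub>R G (a + real (Suc k) * ((b - a) / real (Suc n)))) - integral {a..b} G) < r"
    by blast
qed



section \<open>The isometry of two spaces with generators of equal Gram matrix\<close>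

text \<open>Families \<open>u\<close> and \<open>U\<close> with equal Gram matrices define an isometry between the closed subspaces that they span.
Elements of these spaces are functions, not classes modulo null functions, so the isometry is a relation.\<close>

locale isometric_generators =
  fixes N :: "'b measure" and M :: "'a measure"
    and u :: "'i \<Rightarrow> 'b \<Rightarrow> complex" and U :: "'i \<Rightarrow> 'a \<Rightarrow> complex"
  assumes u_L2: "u i \<in> L2 N" and U_L2: "U i \<in> L2 M"
    and gram: "inner2 N (u i) (u j) = inner2 M (U i) (U j)"
begin

inductive generated :: "('b \<Rightarrow> complex) \<Rightarrow> ('a \<Rightarrow> complex) \<Rightarrow> bool" where
  base: "generated (u i) (U i)"
| comb: "generated f Y \<Longrightarrow> generated g Y' \<Longrightarrow> generated (\<lambda>v. a * f v + b * g v) (\<lambda>w. a * Y w + b * Y' w)"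

lemma generated_L2: "generated f Y \<Longrightarrow> f \<in> L2 N \<and> Y \<in> L2 M"
  by (induction rule: generated.induct) (auto intro!: u_L2 U_L2 L2_add L2_cmult)

lemma generated_inner:
  assumes "generated f Y" "generated g Y'" shows "inner2 N f g = inner2 M Y Y'"
proof -
  have left: "inner2 N f (u j) = inner2 M Y (U j)" for j
    using assms(1)
  proof (induction rule: generated.induct)
    case (comb f Y g Y' a b)
    then show ?case
      using generated_L2[OF comb.hyps(1)] generated_L2[OF comb.hyps(2)]
      by (simp add: inner2_add_left inner2_cmult_left L2_cmult u_L2 U_L2)
  qed (rule gram)
  show ?thesis
    using assms(2)
  proof (induction rule: generated.induct)
    case (comb h Z g Y' a b)
    then show ?case
      using generated_L2[OF comb.hyps(1)] generated_L2[OF comb.hyps(2)] generated_L2[OF assms(1)]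
      by (simp add: inner2_add_right inner2_cmult_right L2_cmult)
  qed (rule left)
qed

definition paired :: "('b \<Rightarrow> complex) \<Rightarrow> ('a \<Rightarrow> complex) \<Rightarrow> bool" where
  "paired f Y \<longleftrightarrow> f \<in> L2 N \<and> Y \<in> L2 M \<and>
    (\<forall>e>0. \<exists>p P. generated p P \<and> norm2 N (\<lambda>v. f v - p v) < e \<and> norm2 M (\<lambda>w. Y w - P w) < e)"

lemma paired_L2: "paired f Y \<Longrightarrow> f \<in> L2 N" "paired f Y \<Longrightarrow> Y \<in> L2 M"
  by (simp_all add: paired_def)

lemma paired_generated: "generated f Y \<Longrightarrow> paired f Y"
  unfolding paired_def using generated_L2[of f Y] by (auto intro!: exI[of _ f] exI[of _ Y] simp: norm2_def)

lemma paired_cong: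
  assumes "paired f Y" and eq: "\<And>v. v \<in> space N \<Longrightarrow> f v = g v" "\<And>w. w \<in> space M \<Longrightarrow> Y w = Z w"
  shows "paired g Z"
proof -
  have "g \<in> L2 N \<longleftrightarrow> f \<in> L2 N" "Z \<in> L2 M \<longleftrightarrow> Y \<in> L2 M"
    using eq by (auto simp: L2_def cong: measurable_cong Bochner_Integration.integrable_cong)
  moreover have "norm2 N (\<lambda>v. g v - p v) = norm2 N (\<lambda>v. f v - p v)"
    "norm2 M (\<lambda>w. Z w - P w) = norm2 M (\<lambda>w. Y w - P w)" for p P
    using eq by (auto simp: norm2_def cong: Bochner_Integration.integral_cong)
  ultimately show ?thesis using assms(1) by (simp add: paired_def)
qed

lemma paired_base: "paired (u i) (U i)"
  by (intro paired_generated base)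

lemma paired_sequence:
  assumes "paired f Y"
  obtains p P where "\<And>k. generated (p k) (P k)"
    "L2_lim N p f" "L2_lim M P Y"
proof -
  have "\<exists>p P. generated p P \<and> norm2 N (\<lambda>v. f v - p v) < 1 / real (Suc k) \<and> norm2 M (\<lambda>w. Y w - P w) < 1 / real (Suc k)" for k
    using assms unfolding paired_def by simp
  then obtain p P where pP: "\<And>k. generated (p k) (P k)"
    "\<And>k. norm2 N (\<lambda>v. f v - p k v) < 1 / real (Suc k)" "\<And>k. norm2 M (\<lambda>w. Y w - P k w) < 1 / real (Suc k)"
    by metis
  have lim: "(\<lambda>k. 1 / real (Suc k)) \<longlonglongrightarrow> 0"
    using LIMSEQ_inverse_real_of_nat by (simp add: inverse_eq_divide)
  show ?thesis
  proof (rule that[OF pP(1)])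
    show "L2_lim N p f"
      by (rule Lim_null_comparison[OF always_eventually lim])
         (use pP(2) in \<open>auto simp: norm2_minus_commute[of N _ f] intro: less_imp_le\<close>)
    show "L2_lim M P Y"
      by (rule Lim_null_comparison[OF always_eventually lim])
         (use pP(3) in \<open>auto simp: norm2_minus_commute[of M _ Y] intro: less_imp_le\<close>)
  qed
qed

lemma paired_inner:
  assumes fY: "paired f Y" and gY: "paired g Y'" shows "inner2 N f g = inner2 M Y Y'"
proof -
  have step: "inner2 N f h = inner2 M Y H"
    if fY: "paired f Y" and hH: "h \<in> L2 N" "H \<in> L2 M" and eq: "\<And>p P. generated p P \<Longrightarrow> inner2 N p h = inner2 M P H" for f Y h H
  proof -
    obtain p P where pP: "\<And>k. generated (p k) (P k)"
      "L2_lim N p f" "L2_lim M P Y"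
      by (rule paired_sequence[OF fY]) blast
    have "(\<lambda>k. inner2 N (p k) h) \<longlonglongrightarrow> inner2 N f h"
      using generated_L2[OF pP(1)] paired_L2(1)[OF fY] hH pP by (intro inner2_tendsto_left) auto
    moreover have "(\<lambda>k. inner2 M (P k) H) \<longlonglongrightarrow> inner2 M Y H"
      using generated_L2[OF pP(1)] paired_L2(2)[OF fY] hH pP by (intro inner2_tendsto_left) auto
    ultimately show ?thesis using eq[OF pP(1)] LIMSEQ_unique by simp
  qed
  show ?thesis
  proof (rule step[OF fY paired_L2[OF gY]])
    fix p P assume pP: "generated p P"
    have "inner2 N g p = inner2 M Y' P"
      using generated_L2[OF pP] generated_inner[OF _ pP] by (intro step[OF gY]) auto
    then show "inner2 N p g = inner2 M P Y'" by (subst (1 2) inner2_commute) simp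
  qed
qed

lemma paired_norm: "paired f Y \<Longrightarrow> norm2 N f = norm2 M Y"
  using paired_inner[of f Y f Y] unfolding inner2_self of_real_eq_iff by simp

lemma paired_comb:
  assumes "paired f Y" "paired g Y'"
  shows "paired (\<lambda>v. a * f v + b * g v) (\<lambda>w. a * Y w + b * Y' w)"
  unfolding paired_def
proof (intro conjI allI impI)
  note L = paired_L2[OF assms(1)] paired_L2[OF assms(2)]
  show "(\<lambda>v. a * f v + b * g v) \<in> L2 N" "(\<lambda>w. a * Y w + b * Y' w) \<in> L2 M"
    using L by (auto intro!: L2_add L2_cmult)
  fix e :: real assume e: "e > 0"
  define d where "d = e / (cmod a + cmod b + 1)"
  have c: "cmod a + cmod b + 1 > 0" by (simp add: add_nonneg_pos)
  have d: "d > 0" "(cmod a + cmod b) * d < e" using e c by (auto simp: d_def field_simps)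
  obtain p P where p: "generated p P" "norm2 N (\<lambda>v. f v - p v) < d" "norm2 M (\<lambda>w. Y w - P w) < d"
    using assms(1) d(1) unfolding paired_def by blast
  obtain q Q where q: "generated q Q" "norm2 N (\<lambda>v. g v - q v) < d" "norm2 M (\<lambda>w. Y' w - Q w) < d"
    using assms(2) d(1) unfolding paired_def by blast
  have close: "norm2 K (\<lambda>x. a * f x + b * g x - (a * p x + b * q x)) < e"
    if "f \<in> L2 K" "g \<in> L2 K" "p \<in> L2 K" "q \<in> L2 K"
      "norm2 K (\<lambda>x. f x - p x) < d" "norm2 K (\<lambda>x. g x - q x) < d" for K :: "'c measure" and f g p q
  proof -
    have "norm2 K (\<lambda>x. a * (f x - p x) + b * (g x - q x)) \<le>
        norm2 K (\<lambda>x. a * (f x - p x)) + norm2 K (\<lambda>x. b * (g x - q x))"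
      using that by (intro norm2_triangle L2_cmult L2_diff)
    also have "\<dots> \<le> cmod a * d + cmod b * d"
      unfolding norm2_cmult using that by (intro add_mono mult_left_mono) auto
    also have "\<dots> < e" using d(2) by (simp add: distrib_right)
    finally show ?thesis by (simp add: algebra_simps)
  qed
  show "\<exists>r R. generated r R \<and> norm2 N (\<lambda>v. a * f v + b * g v - r v) < e \<and> norm2 M (\<lambda>w. a * Y w + b * Y' w - R w) < e"
  proof (intro exI conjI)
    show "generated (\<lambda>v. a * p v + b * q v) (\<lambda>w. a * P w + b * Q w)" by (rule comb[OF p(1) q(1)])
  qed (use generated_L2[OF p(1)] generated_L2[OF q(1)] p q L in \<open>auto intro!: close\<close>)
qed

lemma paired_cmult: "paired f Y \<Longrightarrow> paired (\<lambda>v. c * f v) (\<lambda>w. c * Y w)"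
  using paired_comb[of f Y f Y c 0] by simp

lemma paired_add: "paired f Y \<Longrightarrow> paired g Y' \<Longrightarrow> paired (\<lambda>v. f v + g v) (\<lambda>w. Y w + Y' w)"
  using paired_comb[of f Y g Y' 1 1] by simp

lemma paired_diff: "paired f Y \<Longrightarrow> paired g Y' \<Longrightarrow> paired (\<lambda>v. f v - g v) (\<lambda>w. Y w - Y' w)"
  using paired_comb[of f Y g Y' 1 "-1"] by simp

lemma paired_zero: "paired (\<lambda>_. 0) (\<lambda>_. 0)"
  using paired_cmult[OF paired_base, of 0] by simp

lemma paired_sum:
  assumes "\<And>i. i \<in> I \<Longrightarrow> paired (f i) (Y i)"
  shows "paired (\<lambda>v. \<Sum>i\<in>I. c i * f i v) (\<lambda>w. \<Sum>i\<in>I. c i * Y i w)"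
  using assms by (induction I rule: infinite_finite_induct) (auto intro!: paired_zero paired_add paired_cmult)

lemma paired_closed:
  assumes seq: "\<And>k. paired (f k) (Y k)" and g: "g \<in> L2 N" and Z: "Z \<in> L2 M"
    and lim: "L2_lim N f g" "L2_lim M Y Z"
  shows "paired g Z"
  unfolding paired_def
proof (intro conjI g Z allI impI)
  fix e :: real assume e: "e > 0"
  have "\<forall>\<^sub>F k in sequentially. norm2 N (\<lambda>v. f k v - g v) < e / 2 \<and> norm2 M (\<lambda>w. Y k w - Z w) < e / 2"
    using lim e by (intro eventually_conj order_tendstoD(2)) auto
  then obtain k where k: "norm2 N (\<lambda>v. f k v - g v) < e / 2" "norm2 M (\<lambda>w. Y k w - Z w) < e / 2"
    unfolding eventually_sequentially by blast
  obtain p P where p: "generated p P" "norm2 N (\<lambda>v. f k v - p v) < e / 2" "norm2 M (\<lambda>w. Y k w - P w) < e / 2"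
    using seq[of k] half_gt_zero[OF e] unfolding paired_def by blast
  have "norm2 N (\<lambda>v. g v - p v) < e"
    using norm2_triangle_via[OF g paired_L2(1)[OF seq[of k]], of p] generated_L2[OF p(1)] k p
    by (simp add: norm2_minus_commute[of N g])
  moreover have "norm2 M (\<lambda>w. Z w - P w) < e"
    using norm2_triangle_via[OF Z paired_L2(2)[OF seq[of k]], of P] generated_L2[OF p(1)] k p
    by (simp add: norm2_minus_commute[of M Z])
  ultimately show "\<exists>p P. generated p P \<and> norm2 N (\<lambda>v. g v - p v) < e \<and> norm2 M (\<lambda>w. Z w - P w) < e"
    using p(1) by blast
qed

lemma paired_Cauchy_right:
  assumes seq: "\<And>k. paired (f k) (Y k)" and g: "g \<in> L2 N"
    and lim: "L2_lim N f g" and e: "e > 0"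
  shows "\<exists>K. \<forall>m\<ge>K. \<forall>n\<ge>K. norm2 M (\<lambda>w. Y m w - Y n w) < e"
  using norm2_tendsto_Cauchy[OF paired_L2(1)[OF seq] g lim e] paired_norm[OF paired_diff[OF seq seq]] by simp

text \<open>Mean-square convergence on the left forces it on the right, because the right-hand sides are then a Cauchy
sequence; the pointwise limit is therefore also the mean-square limit.\<close>

lemma paired_limit_AE:
  assumes seq: "\<And>k. paired (f k) (Y k)" and g: "g \<in> L2 N"
    and lim: "L2_lim N f g"
    and Z: "Z \<in> borel_measurable M" "AE w in M. (\<lambda>k. Y k w) \<longlonglongrightarrow> Z w"
  shows "paired g Z" and "L2_lim M Y Z"
proof -
  obtain Z' where Z': "Z' \<in> L2 M" "L2_lim M Y Z'"
    by (rule L2_complete[OF paired_L2(2)[OF seq] paired_Cauchy_right[OF seq g lim]])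
  have eq: "AE w in M. Z w = Z' w"
    by (rule AE_eq_of_L2_limit[OF paired_L2(2)[OF seq] Z' Z(2)])
  have [measurable]: "Z' \<in> borel_measurable M" "Y k \<in> borel_measurable M" "Z \<in> borel_measurable M" for k
    using Z'(1) paired_L2(2)[OF seq, of k] Z(1) by (auto simp: L2_def)
  have ZL: "Z \<in> L2 M"
    by (rule L2_bound[OF Z(1) L2_integrable[OF Z'(1)]]) (use eq in \<open>auto elim!: eventually_mono\<close>)
  have "norm2 M (\<lambda>w. Y k w - Z w) = norm2 M (\<lambda>w. Y k w - Z' w)" for k
    by (rule norm2_cong_AE) (use eq in \<open>auto elim!: eventually_mono\<close>)
  then show "L2_lim M Y Z" using Z'(2) by simp
  then show "paired g Z" by (rule paired_closed[OF seq g ZL lim])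
qed

text \<open>Total generators span a dense subspace, and the images of an approximating sequence are a Cauchy sequence.\<close>

lemma paired_total:
  assumes total: "\<And>g. g \<in> L2 N \<Longrightarrow> (\<And>i. inner2 N g (u i) = 0) \<Longrightarrow> norm2 N g = 0"
    and f: "f \<in> L2 N"
  shows "\<exists>Y. paired f Y"
proof -
  let ?S = "{p. \<exists>P. generated p P}"
  have dense: "\<exists>p\<in>?S. norm2 N (\<lambda>v. f v - p v) < e" if "e > 0" for e
  proof (rule L2_dense_subspace[OF _ _ _ _ f that])
    show "?S \<subseteq> L2 N" using generated_L2 by auto
    show "?S \<noteq> {}" using base by blast
    show "(\<lambda>x. a * p x + b * q x) \<in> ?S" if "p \<in> ?S" "q \<in> ?S" for p q a b
      using that comb by blast
    show "norm2 N g = 0" if "g \<in> L2 N" "\<And>p. p \<in> ?S \<Longrightarrow> inner2 N g p = 0" for g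
      using that base by (intro total) auto
  qed
  have "\<exists>p P. generated p P \<and> norm2 N (\<lambda>v. f v - p v) < 1 / real (Suc k)" for k
    using dense[of "1 / real (Suc k)"] by auto
  then obtain p P where pP: "\<And>k. generated (p k) (P k)" "\<And>k. norm2 N (\<lambda>v. f v - p k v) < 1 / real (Suc k)"
    by metis
  have lim0: "(\<lambda>k. 1 / real (Suc k)) \<longlonglongrightarrow> 0"
    using LIMSEQ_inverse_real_of_nat by (simp add: inverse_eq_divide)
  have lim: "L2_lim N p f"
    by (rule Lim_null_comparison[OF always_eventually lim0])
       (use pP(2) in \<open>auto simp: norm2_minus_commute[of N _ f] intro: less_imp_le\<close>)
  note seq = paired_generated[OF pP(1)]
  obtain Y where Y: "Y \<in> L2 M" "L2_lim M P Y"
    by (rule L2_complete[OF paired_L2(2)[OF seq] paired_Cauchy_right[OF seq f lim]])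
  from paired_closed[OF seq f Y(1) lim Y(2)] show ?thesis by blast
qed

text \<open>Riemann sums are paired by linearity. On the left they converge by domination. On the right no domination is
available, but they converge along every path, which suffices by \<open>paired_limit_AE\<close>. The second part is the
resulting exchange of inner product and integral.\<close>

lemma paired_integral:
  fixes a b :: real
  assumes ab: "a < b"
    and FG: "\<And>x. a < x \<Longrightarrow> x \<le> b \<Longrightarrow> paired (F x) (G x)"
    and F_cont: "\<And>v. v \<in> space N \<Longrightarrow> continuous_on {a..b} (\<lambda>x. F x v)"
    and G_cont: "\<And>w. w \<in> space M \<Longrightarrow> continuous_on {a..b} (\<lambda>x. G x w)"
    and D: "integrable N (\<lambda>v. (D v)\<^sup>2)" "\<And>x v. a < x \<Longrightarrow> x \<le> b \<Longrightarrow> cmod (F x v) \<le> D v"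
  shows "paired (\<lambda>v. integral {a..b} (\<lambda>x. F x v)) (\<lambda>w. integral {a..b} (\<lambda>x. G x w))"
    and "\<And>H. H \<in> L2 M \<Longrightarrow> continuous_on {a..b} (\<lambda>x. inner2 M (G x) H) \<Longrightarrow>
      inner2 M (\<lambda>w. integral {a..b} (\<lambda>x. G x w)) H = integral {a..b} (\<lambda>x. inner2 M (G x) H)"
proof -
  define h where "h n = (b - a) / real (Suc n)" for n
  define x where "x n k = a + real (Suc k) * h n" for n k
  have h: "h n > 0" "real (Suc n) * h n = b - a" for n using ab by (auto simp: h_def)
  have x: "a < x n k" "x n k \<le> b" if "k < Suc n" for n k
  proof -
    show "a < x n k" using h(1)[of n] by (simp add: x_def add_pos_nonneg)
    have "real (Suc k) * h n \<le> real (Suc n) * h n" using that h(1)[of n] by (intro mult_right_mono) auto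
    then show "x n k \<le> b" unfolding x_def h(2) by simp
  qed
  let ?RF = "\<lambda>n v. \<Sum>k<Suc n. of_real (h n) * F (x n k) v"
  let ?RG = "\<lambda>n w. \<Sum>k<Suc n. of_real (h n) * G (x n k) w"
  have R: "paired (?RF n) (?RG n)" for n
    by (rule paired_sum) (use x FG in auto)
  have conv: "(\<lambda>n. \<Sum>k<Suc n. of_real (h n) * g (x n k)) \<longlonglongrightarrow> integral {a..b} g"
    if "continuous_on {a..b} g" for g :: "real \<Rightarrow> complex"
    using Riemann_sums_tendsto[OF less_imp_le[OF ab] that]
    by (simp only: scaleR_conv_of_real h_def x_def)
  have RF_meas: "?RF n \<in> borel_measurable N" for n using paired_L2(1)[OF R] by (simp add: L2_def)
  have RG_meas: "?RG n \<in> borel_measurable M" for n using paired_L2(2)[OF R] by (simp add: L2_def)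
  have f_meas: "(\<lambda>v. integral {a..b} (\<lambda>x. F x v)) \<in> borel_measurable N"
    by (rule borel_measurable_LIMSEQ_metric[OF RF_meas]) (rule conv, rule F_cont)
  have G_meas: "(\<lambda>w. integral {a..b} (\<lambda>x. G x w)) \<in> borel_measurable M"
    by (rule borel_measurable_LIMSEQ_metric[OF RG_meas]) (rule conv, rule G_cont)
  have bound: "cmod (?RF n v) \<le> (b - a) * D v" for n v
  proof -
    have "cmod (?RF n v) \<le> (\<Sum>k<Suc n. h n * D v)"
    proof (rule sum_norm_le)
      fix k assume "k \<in> {..<Suc n}"
      then have "cmod (F (x n k) v) \<le> D v" using x by (intro D(2)) auto
      then show "cmod (of_real (h n) * F (x n k) v) \<le> h n * D v"
        using h(1)[of n] by (simp add: norm_mult mult_left_mono)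
    qed
    also have "\<dots> = (real (Suc n) * h n) * D v" by simp
    finally show ?thesis unfolding h(2) .
  qed
  have D': "integrable N (\<lambda>v. ((b - a) * D v)\<^sup>2)"
    using D(1) by (simp add: power_mult_distrib)
  have F_lim: "AE v in N. (\<lambda>n. ?RF n v) \<longlonglongrightarrow> integral {a..b} (\<lambda>x. F x v)"
    by (rule AE_I2) (rule conv, rule F_cont)
  have G_lim: "AE w in M. (\<lambda>n. ?RG n w) \<longlonglongrightarrow> integral {a..b} (\<lambda>x. G x w)"
    by (rule AE_I2) (rule conv, rule G_cont)
  note dom = norm2_dominated_convergence[OF RF_meas f_meas D' F_lim AE_I2[OF bound]]
  note lim = paired_limit_AE[OF R dom(2) dom(1) G_meas G_lim]
  show "paired (\<lambda>v. integral {a..b} (\<lambda>x. F x v)) (\<lambda>w. integral {a..b} (\<lambda>x. G x w))" by (rule lim(1))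
  fix H assume H: "H \<in> L2 M" and cont: "continuous_on {a..b} (\<lambda>x. inner2 M (G x) H)"
  have "(\<lambda>n. inner2 M (?RG n) H) \<longlonglongrightarrow> inner2 M (\<lambda>w. integral {a..b} (\<lambda>x. G x w)) H"
    by (rule inner2_tendsto_left[OF paired_L2(2)[OF R] paired_L2(2)[OF lim(1)] H lim(2)])
  moreover have "inner2 M (?RG n) H = (\<Sum>k<Suc n. of_real (h n) * inner2 M (G (x n k)) H)" for n
  proof -
    have int: "integrable M (\<lambda>w. of_real (h n) * (G (x n k) w * cnj (H w)))" if "k < Suc n" for k
      using L2_mult_integrable[OF paired_L2(2)[OF FG[OF x[OF that]]] H] by simp
    have "inner2 M (?RG n) H = (LINT w|M. (\<Sum>k<Suc n. of_real (h n) * (G (x n k) w * cnj (H w))))"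
      unfolding inner2_def sum_distrib_right mult.assoc ..
    also have "\<dots> = (\<Sum>k<Suc n. \<integral>w. of_real (h n) * (G (x n k) w * cnj (H w)) \<partial>M)"
      by (rule Bochner_Integration.integral_sum) (use int in auto)
    finally show ?thesis unfolding inner2_def integral_mult_right_zero .
  qed
  ultimately have "(\<lambda>n. \<Sum>k<Suc n. of_real (h n) * inner2 M (G (x n k)) H) \<longlonglongrightarrow> inner2 M (\<lambda>w. integral {a..b} (\<lambda>x. G x w)) H"
    by (simp only:)
  from LIMSEQ_unique[OF this conv[OF cont]]
  show "inner2 M (\<lambda>w. integral {a..b} (\<lambda>x. G x w)) H = integral {a..b} (\<lambda>x. inner2 M (G x) H)" .
qed

text \<open>The real part of a combination of generators is a real combination of the \<open>V i\<close>; the rest is a limit.\<close>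

lemma paired_gaussian:
  assumes M: "prob_space M" and V: "\<And>i w. U i w = of_real (V i w)"
    and gauss: "\<And>F a. finite F \<Longrightarrow> centered_gaussian M (\<lambda>w. \<Sum>i\<in>F. a i * V i w)"
    and fY: "paired f Y"
  shows "centered_gaussian M (\<lambda>w. Re (Y w))"
proof -
  interpret prob_space M by fact
  have comb: "\<exists>F a. finite F \<and> (\<forall>w. P w = (\<Sum>i\<in>F. a i * of_real (V i w)))" if "generated p P" for p P
    using that
  proof (induction rule: generated.induct)
    case (base i)
    show ?case by (intro exI[of _ "{i}"] exI[of _ "\<lambda>_. 1"]) (simp add: V)
  next
    case (comb f Y g Y' c d)
    then obtain F a G b where F: "finite F" "\<And>w. Y w = (\<Sum>i\<in>F. a i * of_real (V i w))"
      and G: "finite G" "\<And>w. Y' w = (\<Sum>i\<in>G. b i * of_real (V i w))" by metis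
    have "c * Y w + d * Y' w = (\<Sum>i\<in>F \<union> G. (c * (if i \<in> F then a i else 0) + d * (if i \<in> G then b i else 0)) * of_real (V i w))" for w
    proof -
      have "Y w = (\<Sum>i\<in>F \<union> G. (if i \<in> F then a i else 0) * of_real (V i w))"
        unfolding F(2) using F G by (intro sum.mono_neutral_cong_left) auto
      moreover have "Y' w = (\<Sum>i\<in>F \<union> G. (if i \<in> G then b i else 0) * of_real (V i w))"
        unfolding G(2) using F G by (intro sum.mono_neutral_cong_left) auto
      ultimately show ?thesis by (simp add: sum_distrib_left distrib_right sum.distrib mult.assoc)
    qed
    then show ?case using F(1) G(1)
      by (intro exI[of _ "F \<union> G"] exI[of _ "\<lambda>i. c * (if i \<in> F then a i else 0) + d * (if i \<in> G then b i else 0)"]) simp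
  qed
  have generated_gauss: "centered_gaussian M (\<lambda>w. Re (P w))" if pP: "generated p P" for p P
  proof -
    obtain F a where F: "finite F" "\<And>w. P w = (\<Sum>i\<in>F. a i * of_real (V i w))" using comb[OF pP] by metis
    have "(\<lambda>w. Re (P w)) = (\<lambda>w. \<Sum>i\<in>F. Re (a i) * V i w)" by (simp add: F(2))
    then show ?thesis using gauss[OF F(1), of "\<lambda>i. Re (a i)"] by simp
  qed
  obtain p P where pP: "\<And>k. generated (p k) (P k)" "L2_lim M P Y"
    by (rule paired_sequence[OF fY]) blast
  have Y [measurable]: "Y \<in> borel_measurable M" and YL: "Y \<in> L2 M" using paired_L2(2)[OF fY] by (auto simp: L2_def)
  show ?thesis
  proof (rule centered_gaussian_L2_limit)
    show "centered_gaussian M (\<lambda>w. Re (P k w))" for k by (rule generated_gauss[OF pP(1)])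
    show "(\<lambda>w. complex_of_real (Re (Y w))) \<in> L2 M"
      by (rule L2_bound[OF _ L2_integrable[OF YL]]) (auto simp: cmod_power2)
    show "L2_lim M (\<lambda>k w. complex_of_real (Re (P k w))) (\<lambda>w. complex_of_real (Re (Y w)))"
    proof (rule Lim_null_comparison[OF always_eventually pP(2)], intro allI)
      fix k
      have PL: "P k \<in> L2 M" using generated_L2[OF pP(1)] by simp
      then have [measurable]: "P k \<in> borel_measurable M" by (simp add: L2_def)
      have le: "(cmod (complex_of_real (Re (P k w)) - complex_of_real (Re (Y w))))\<^sup>2 \<le> (cmod (P k w - Y w))\<^sup>2" for w
        using abs_Re_le_cmod[of "P k w - Y w"] by (intro power_mono) (simp_all flip: of_real_diff)
      have "norm2 M (\<lambda>w. complex_of_real (Re (P k w)) - complex_of_real (Re (Y w))) \<le> norm2 M (\<lambda>w. P k w - Y w)"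
        unfolding norm2_def
      proof (intro real_sqrt_le_mono integral_mono)
        show int: "integrable M (\<lambda>w. (cmod (P k w - Y w))\<^sup>2)" by (rule L2_integrable[OF L2_diff[OF PL YL]])
        show "integrable M (\<lambda>w. (cmod (complex_of_real (Re (P k w)) - complex_of_real (Re (Y w))))\<^sup>2)"
          by (rule Bochner_Integration.integrable_bound[OF int]) (use le in auto)
      qed (rule le)
      then show "norm (norm2 M (\<lambda>w. complex_of_real (Re (P k w)) - complex_of_real (Re (Y w)))) \<le> norm2 M (\<lambda>w. P k w - Y w)"
        by simp
    qed
  qed simp
qed

end



section \<open>The spectral side\<close>

lemma spectral_control_density: "spectral_control = density lborel (\<lambda>_. ennreal (2 * pi))"
  unfolding spectral_control_def
  by (rule measure_eqI) (simp_all add: emeasure_density nn_integral_cmult)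

lemma sets_spectral_control [simp, measurable_cong]: "sets spectral_control = sets borel"
  by (simp add: spectral_control_density)

lemma space_spectral_control [simp]: "space spectral_control = UNIV"
  by (simp add: spectral_control_density)

lemma integrable_spectral_control:
  fixes f :: "real \<Rightarrow> 'b::{banach, second_countable_topology}"
  shows "integrable spectral_control f \<longleftrightarrow> integrable lborel f"
proof (cases "f \<in> borel_measurable borel")
  case True
  then have "integrable spectral_control f \<longleftrightarrow> integrable lborel (\<lambda>x. (2 * pi) *\<^sub>R f x)"
    unfolding spectral_control_density by (subst integrable_density) auto
  moreover have "integrable lborel f" if "integrable lborel (\<lambda>x. (2 * pi) *\<^sub>R f x)"
    using integrable_scaleR_right[OF that, of "1 / (2 * pi)"] by simp
  ultimately show ?thesis by blast
next
  case False
  have "f \<in> borel_measurable borel" if "integrable spectral_control f \<or> integrable lborel f"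
    using that borel_measurable_integrable by fastforce
  with False show ?thesis by blast
qed

lemma integral_spectral_control:
  fixes f :: "real \<Rightarrow> 'b::{banach, second_countable_topology}"
  assumes "f \<in> borel_measurable borel"
  shows "(LINT v|spectral_control. f v) = (2 * pi) *\<^sub>R (LINT v|lborel. f v)"
  unfolding spectral_control_density using assms by (subst integral_density) auto

lemma spectral_kernel_denominator: "of_nat k + 1/2 + \<i> * of_real v \<noteq> (0::complex)"
  by (auto simp: complex_eq_iff)

lemma spectral_kernel_nonzero: "spectral_kernel n v \<noteq> 0"
  using spectral_kernel_denominator by (simp add: spectral_kernel_def)

lemma spectral_kernel_0: "spectral_kernel 0 v = 1 / (1/2 + \<i> * of_real v)"
  by (simp add: spectral_kernel_def)

lemma spectral_kernel_Suc:
  "spectral_kernel (Suc n) v = spectral_kernel n v / (of_nat (Suc n) + 1/2 + \<i> * of_real v)"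
  by (simp add: spectral_kernel_def prod.atLeast0_atMost_Suc del: of_nat_Suc)

lemma spectral_kernel_measurable [measurable]: "spectral_kernel n \<in> borel_measurable borel"
  unfolding spectral_kernel_def[abs_def] by measurable

lemma cmod_spectral_kernel_0: "(cmod (spectral_kernel 0 v))\<^sup>2 = 1 / ((1/2)\<^sup>2 + v\<^sup>2)"
  by (simp add: spectral_kernel_0 norm_divide power_divide cmod_power2)

text \<open>The integrand that represents \<open>X\<^sub>n(t)\<close>.\<close>

definition spectral_wave :: "nat \<Rightarrow> real \<Rightarrow> real \<Rightarrow> complex" where
  "spectral_wave n t v = spectral_kernel n v * exp (\<i> * of_real (v * t))"

lemma spectral_wave_measurable [measurable]: "spectral_wave n t \<in> borel_measurable borel"
  unfolding spectral_wave_def[abs_def] by measurable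

lemma cmod_spectral_wave: "cmod (spectral_wave n t v) = cmod (spectral_kernel n v)"
  by (simp add: spectral_wave_def norm_mult)

lemma spectral_wave_shift: "spectral_wave n (t + h) v = iexp (v * h) * spectral_wave n t v"
  by (simp add: spectral_wave_def distrib_left exp_add)

lemma spectral_wave_0_L2: "spectral_wave 0 t \<in> L2 spectral_control"
  using integrable_Cauchy_density[of "1/2"]
  by (simp add: L2_def cmod_spectral_wave cmod_spectral_kernel_0 integrable_spectral_control)

lemma spectral_wave_0_gram:
  "inner2 spectral_control (spectral_wave 0 s) (spectral_wave 0 t) = of_real (4 * pi\<^sup>2 * exp (- \<bar>s - t\<bar> / 2))"
proof -
  have "spectral_wave 0 s v * cnj (spectral_wave 0 t v) = iexp (v * (s - t)) / of_real ((1/2)\<^sup>2 + v\<^sup>2)" for v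
  proof -
    have "spectral_wave 0 s v * cnj (spectral_wave 0 t v) =
        (spectral_kernel 0 v * cnj (spectral_kernel 0 v)) * (iexp (v * s) * iexp (- (v * t)))"
      by (simp add: spectral_wave_def exp_cnj)
    also have "spectral_kernel 0 v * cnj (spectral_kernel 0 v) = of_real (1 / ((1/2)\<^sup>2 + v\<^sup>2))"
      using complex_norm_square[of "spectral_kernel 0 v"] unfolding cmod_spectral_kernel_0[symmetric] by simp
    also have "iexp (v * s) * iexp (- (v * t)) = iexp (v * (s - t))"
      unfolding iexp_add[symmetric] by (simp add: right_diff_distrib)
    finally show ?thesis by simp
  qed
  note eq = this
  have m: "(\<lambda>v. spectral_wave 0 s v * cnj (spectral_wave 0 t v)) \<in> borel_measurable borel" by measurable
  have "inner2 spectral_control (spectral_wave 0 s) (spectral_wave 0 t) =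
      (2 * pi) *\<^sub>R (LINT v|lborel. iexp (v * (s - t)) / of_real ((1/2)\<^sup>2 + v\<^sup>2))"
    unfolding inner2_def integral_spectral_control[OF m] unfolding eq ..
  also have "\<dots> = of_real (4 * pi\<^sup>2 * exp (- \<bar>s - t\<bar> / 2))"
    by (subst Cauchy_density_transform) (simp_all add: scaleR_conv_of_real power2_eq_square)
  finally show ?thesis .
qed

text \<open>A function orthogonal to all waves has a product with \<open>cnj H\<^sub>0\<close> that is integrable with vanishing Fourier transform;
\<open>H\<^sub>0\<close> has no zeros.\<close>

lemma spectral_waves_total:
  assumes g: "g \<in> L2 spectral_control" and orth: "\<And>t. inner2 spectral_control g (spectral_wave 0 t) = 0"
  shows "norm2 spectral_control g = 0"
proof -
  have [measurable]: "g \<in> borel_measurable borel"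
    using g measurable_cong_sets[OF sets_spectral_control refl] by (auto simp: L2_def)
  define w where "w v = g v * cnj (spectral_kernel 0 v)" for v
  have eq: "g v * cnj (spectral_wave 0 t v) = w v * iexp ((- t) * v)" for t v
    by (simp add: w_def spectral_wave_def exp_cnj mult_ac)
  have "integrable spectral_control w"
    using L2_mult_integrable[OF g spectral_wave_0_L2[of 0]] unfolding eq by simp
  then have w: "integrable lborel w" by (simp add: integrable_spectral_control)
  have [measurable]: "w \<in> borel_measurable borel" using w by simp
  have "(LINT v|lborel. w v * iexp (t * v)) = 0" for t
  proof -
    have "(2 * pi) *\<^sub>R (LINT v|lborel. w v * iexp ((- (- t)) * v)) = inner2 spectral_control g (spectral_wave 0 (- t))"
      unfolding inner2_def eq by (subst integral_spectral_control) simp_all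
    then show ?thesis unfolding orth by simp
  qed
  then have "AE v in lborel. w v = 0" by (rule Fourier_injective_L1[OF w])
  then have "AE v in lborel. (cmod (g v))\<^sup>2 = 0"
    by (rule eventually_mono) (simp add: w_def spectral_kernel_nonzero)
  then have "(LINT v|lborel. (cmod (g v))\<^sup>2) = 0" by (rule integral_eq_zero_AE)
  then show ?thesis unfolding norm2_def by (subst integral_spectral_control) auto
qed

section \<open>The Ornstein-Uhlenbeck process\<close>

locale brownian = prob_space M for M :: "'a measure" +
  fixes B :: "real \<Rightarrow> 'a \<Rightarrow> real"
  assumes bm: "standard_brownian_motion M B"
begin

abbreviation X :: "nat \<Rightarrow> real \<Rightarrow> 'a \<Rightarrow> real" where
  "X \<equiv> rescaled_integrated_bm B"

lemma X_0: "X 0 t w = exp (- t / 2) * B (exp t) w"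
  by (simp add: rescaled_integrated_bm_def)

lemma OU_combination_gaussian:
  assumes F: "finite F" shows "centered_gaussian M (\<lambda>w. \<Sum>t\<in>F. a t * X 0 t w)"
proof -
  have "(\<Sum>t\<in>F. a t * X 0 t w) = (\<Sum>x\<in>exp ` F. a (ln x) * exp (- ln x / 2) * B x w)" for w
    by (subst sum.reindex) (auto simp: X_0 inj_on_def mult.assoc)
  moreover have "centered_gaussian M (\<lambda>w. \<Sum>x\<in>exp ` F. a (ln x) * exp (- ln x / 2) * B x w)"
    by (rule brownian_combination_gaussian[OF bm]) (use F in auto)
  ultimately show ?thesis by simp
qed

lemma OU_measurable [measurable]: "X 0 t \<in> borel_measurable M"
  and OU_square_integrable: "integrable M (\<lambda>w. (X 0 t w)\<^sup>2)"
  using centered_gaussianD(1,2)[OF OU_combination_gaussian[of "{t}" "\<lambda>_. 1"]] by simp_all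

lemma OU_covariance: "(LINT w|M. X 0 s w * X 0 t w) = exp (- \<bar>s - t\<bar> / 2)"
proof -
  have le: "(LINT w|M. X 0 s w * X 0 t w) = exp (- \<bar>s - t\<bar> / 2)" if "s \<le> t" for s t
  proof -
    have "(LINT w|M. X 0 s w * X 0 t w) = (LINT w|M. exp (- s / 2) * exp (- t / 2) * (B (exp s) w * B (exp t) w))"
      by (simp add: X_0 mult_ac)
    also have "\<dots> = exp (- s / 2) * exp (- t / 2) * exp s"
      using that by (subst integral_mult_right_zero) (simp add: brownian_covariance[OF bm])
    also have "\<dots> = exp (- \<bar>s - t\<bar> / 2)"
      using that by (simp add: exp_add[symmetric])
    finally show ?thesis .
  qed
  show ?thesis
    using le[of s t] le[of t s] by (cases "s \<le> t") (simp_all add: mult.commute abs_minus_commute)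
qed

definition scaled_OU :: "real \<Rightarrow> 'a \<Rightarrow> complex" where
  "scaled_OU t w = of_real (2 * pi * X 0 t w)"

lemma scaled_OU_measurable [measurable]: "scaled_OU t \<in> borel_measurable M"
  unfolding scaled_OU_def[abs_def] by measurable

lemma scaled_OU_gram: "inner2 M (scaled_OU s) (scaled_OU t) = of_real (4 * pi\<^sup>2 * exp (- \<bar>s - t\<bar> / 2))"
proof -
  have "scaled_OU s w * cnj (scaled_OU t w) = complex_of_real (4 * pi\<^sup>2 * (X 0 s w * X 0 t w))" for w
    by (simp add: scaled_OU_def power2_eq_square)
  then have "inner2 M (scaled_OU s) (scaled_OU t) = (LINT w|M. complex_of_real (4 * pi\<^sup>2 * (X 0 s w * X 0 t w)))"
    unfolding inner2_def by (simp only:)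
  also have "\<dots> = complex_of_real (LINT w|M. 4 * pi\<^sup>2 * (X 0 s w * X 0 t w))" by (rule integral_complex_of_real)
  also have "(LINT w|M. 4 * pi\<^sup>2 * (X 0 s w * X 0 t w)) = 4 * pi\<^sup>2 * exp (- \<bar>s - t\<bar> / 2)"
    by (simp only: integral_mult_right_zero OU_covariance)
  finally show ?thesis .
qed

sublocale isometric_generators spectral_control M "spectral_wave 0" scaled_OU
proof
  show "scaled_OU t \<in> L2 M" for t
    using OU_square_integrable[of t] by (simp add: L2_def scaled_OU_def norm_mult power_mult_distrib)
  show "inner2 spectral_control (spectral_wave 0 s) (spectral_wave 0 t) = inner2 M (scaled_OU s) (scaled_OU t)" for s t
    by (simp only: spectral_wave_0_gram scaled_OU_gram)
qed (rule spectral_wave_0_L2)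

lemma gaussian_Re:
  assumes "paired f Y" shows "centered_gaussian M (\<lambda>w. Re (Y w))"
proof (rule paired_gaussian[OF prob_space_axioms _ _ assms])
  show "scaled_OU t w = of_real (2 * pi * X 0 t w)" for t w by (rule scaled_OU_def)
  show "centered_gaussian M (\<lambda>w. \<Sum>t\<in>F. a t * (2 * pi * X 0 t w))" if "finite F" for F a
    using OU_combination_gaussian[OF that, of "\<lambda>t. a t * (2 * pi)"] by (simp add: mult.assoc)
qed

lemma integrated_bm_continuous:
  assumes "w \<in> space M" shows "continuous_on {0..} (\<lambda>t. integrated_bm B n t w)"
proof (induction n)
  case 0
  then show ?case using bm assms by (simp add: standard_brownian_motion_def)
next
  case (Suc n)
  have "continuous_on {0..T} (\<lambda>t. integrated_bm B (Suc n) t w)" for T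
    unfolding integrated_bm.simps
    by (intro indefinite_integral_continuous_1 integrable_continuous_real continuous_on_subset[OF Suc]) auto
  then have "continuous (at t within {0..}) (\<lambda>t. integrated_bm B (Suc n) t w)" if "t \<ge> 0" for t
  proof -
    assume *: "\<And>T. continuous_on {0..T} (\<lambda>t. integrated_bm B (Suc n) t w)"
    have "continuous (at t within {0..t + 1}) (\<lambda>t. integrated_bm B (Suc n) t w)"
      using *[of "t + 1"] that by (simp add: continuous_on_eq_continuous_within del: integrated_bm.simps)
    moreover have "at t within {0..t + 1} = at t within {0..}"
      by (rule at_within_nhd[of _ "{..<t + 1}"]) auto
    ultimately show ?thesis by simp
  qed
  then show ?case by (simp add: continuous_on_eq_continuous_within del: integrated_bm.simps)
qed

lemma X_continuous:
  assumes "w \<in> space M" shows "continuous_on A (\<lambda>t. X n t w)"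
  unfolding rescaled_integrated_bm_def
  by (intro continuous_intros continuous_on_compose2[OF integrated_bm_continuous[OF assms]]) auto

end

section \<open>Iterated integrals\<close>

text \<open>In the time \<open>x = e^t\<close> of the Brownian motion, the wave \<open>e^(ivt)\<close> with the scaling factor \<open>e^(st)\<close> becomes the
power \<open>x^(s + iv)\<close>, so integration in \<open>x\<close> raises \<open>s\<close> by 1 and divides by \<open>s + 1 + iv\<close>. For \<open>s > 0\<close> the conventions
for \<open>ln\<close> and \<open>powr\<close> give the value 0 at 0, which makes the function continuous on \<open>[0, \<infinity>)\<close>.\<close>

definition Mellin_wave :: "real \<Rightarrow> real \<Rightarrow> real \<Rightarrow> complex" where
  "Mellin_wave s v x = of_real (x powr s) * exp (\<i> * of_real (v * ln x))"

lemma Mellin_wave_continuous: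
  assumes s: "s > 0" shows "continuous_on {0..} (Mellin_wave s v)"
  unfolding continuous_on_eq_continuous_within
proof
  fix x :: real assume x: "x \<in> {0..}"
  show "continuous (at x within {0..}) (Mellin_wave s v)"
  proof (cases "x = 0")
    case False
    then have "isCont (\<lambda>y. of_real (y powr s) * exp (\<i> * of_real (v * ln y)) :: complex) x"
      using x by (intro continuous_intros) auto
    then show ?thesis unfolding Mellin_wave_def[abs_def] by (rule continuous_at_imp_continuous_at_within)
  next
    case True
    have "continuous_on {0..} (\<lambda>y::real. y powr s)"
      using s by (intro continuous_on_powr') (auto intro: continuous_intros)
    from this[unfolded continuous_on_def, rule_format, of 0]
    have "((\<lambda>y::real. y powr s) \<longlongrightarrow> 0) (at 0 within {0..})" by simp
    then have "(Mellin_wave s v \<longlongrightarrow> 0) (at 0 within {0..})"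
      by (intro Lim_null_comparison[of "Mellin_wave s v" "\<lambda>y. y powr s"])
         (auto simp: Mellin_wave_def norm_mult intro!: always_eventually)
    then show ?thesis using True by (simp add: continuous_within Mellin_wave_def)
  qed
qed

lemma Mellin_wave_derivative:
  assumes x: "x > 0"
  shows "(Mellin_wave (s + 1) v has_vector_derivative (of_real s + 1 + \<i> * of_real v) * Mellin_wave s v x) (at x)"
proof -
  have 1: "((\<lambda>y. complex_of_real (y powr (s + 1))) has_vector_derivative of_real ((s + 1) * x powr s)) (at x)"
    using x by (intro has_vector_derivative_of_real) (auto intro!: derivative_eq_intros simp: has_real_derivative_iff_has_vector_derivative[symmetric])
  have "((\<lambda>y. \<i> * complex_of_real (v * ln y)) has_vector_derivative \<i> * of_real (v * (1 / x))) (at x)"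
    using x by (intro has_vector_derivative_mult_right has_vector_derivative_of_real)
      (auto intro!: derivative_eq_intros simp: has_real_derivative_iff_has_vector_derivative[symmetric])
  then have 2: "((\<lambda>y. exp (\<i> * complex_of_real (v * ln y))) has_vector_derivative
      (\<i> * of_real (v * (1 / x))) * exp (\<i> * complex_of_real (v * ln x))) (at x)"
    using field_vector_diff_chain_at[of "\<lambda>y. \<i> * complex_of_real (v * ln y)" "\<i> * of_real (v * (1 / x))" x exp "exp (\<i> * complex_of_real (v * ln x))"]
    by (simp add: o_def DERIV_exp)
  have pow: "x powr (s + 1) = x powr s * x" "x powr (1 + s) = x powr s * x" using x by (simp_all add: powr_add)
  show ?thesis
    unfolding Mellin_wave_def[abs_def]
    by (rule has_vector_derivative_eq_rhs[OF has_vector_derivative_mult[OF 1 2]])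
       (use x in \<open>simp add: Mellin_wave_def pow algebra_simps\<close>)
qed

lemma Mellin_wave_integral:
  assumes s: "s > 0" and T: "T \<ge> 0"
  shows "integral {0..T} (Mellin_wave s v) = Mellin_wave (s + 1) v T / (of_real s + 1 + \<i> * of_real v)"
proof -
  have nz: "of_real s + 1 + \<i> * of_real v \<noteq> 0" using s by (auto simp: complex_eq_iff)
  have "((\<lambda>x. (of_real s + 1 + \<i> * of_real v) * Mellin_wave s v x) has_integral Mellin_wave (s + 1) v T - Mellin_wave (s + 1) v 0) {0..T}"
    using s by (intro fundamental_theorem_of_calculus_interior[OF T] Mellin_wave_derivative
        continuous_on_subset[OF Mellin_wave_continuous]) auto
  from has_integral_mult_right[OF this, of "1 / (of_real s + 1 + \<i> * of_real v)"]
  have "(Mellin_wave s v has_integral Mellin_wave (s + 1) v T / (of_real s + 1 + \<i> * of_real v)) {0..T}"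
    using nz by (simp add: Mellin_wave_def[of _ _ 0])
  then show ?thesis by (rule integral_unique)
qed

context brownian
begin

text \<open>Undoing the scaling, \<open>W\<^sub>n(x)\<close> for \<open>x > 0\<close> is paired with \<open>H\<^sub>n(v) x^(n + 1/2 + iv) / (2\<pi>)\<close>. Integrating both over \<open>(0, e^t]\<close>
and scaling again produces \<open>X\<^sub>n\<^sub>+\<^sub>1(t)\<close> and the next factor of the kernel.\<close>

lemma paired_X: "paired (spectral_wave n t) (\<lambda>w. of_real (2 * pi * X n t w))"
proof (induction n arbitrary: t)
  case 0
  show ?case using paired_base[of t] by (simp only: scaled_OU_def[abs_def])
next
  case (Suc n)
  define s where "s = real n + 1/2"
  define T where "T = exp t"
  have s: "s > 0" by (simp add: s_def)
  have T: "T > 0" by (simp add: T_def)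
  define F where "F x v = spectral_kernel n v * Mellin_wave s v x" for x v
  define G where "G x w = complex_of_real (2 * pi * integrated_bm B n x w)" for x w
  have FG: "paired (F x) (G x)" if "0 < x" "x \<le> T" for x
  proof -
    have "paired (\<lambda>v. of_real (x powr s) * spectral_wave n (ln x) v)
        (\<lambda>w. of_real (x powr s) * of_real (2 * pi * X n (ln x) w))"
      by (rule paired_cmult[OF Suc])
    moreover have "x powr s * (2 * pi * X n (ln x) w) = 2 * pi * integrated_bm B n x w" for w
    proof -
      have "x powr s * exp (- s * ln x) = 1"
        using that by (simp add: powr_def exp_minus)
      then show ?thesis using that by (simp add: rescaled_integrated_bm_def s_def)
    qed
    moreover have "of_real (x powr s) * spectral_wave n (ln x) v = F x v" for v
      by (simp add: F_def Mellin_wave_def spectral_wave_def mult_ac)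
    ultimately show ?thesis by (simp only: G_def[abs_def] of_real_mult[symmetric])
  qed
  have R: "paired (\<lambda>v. integral {0..T} (\<lambda>x. F x v)) (\<lambda>w. integral {0..T} (\<lambda>x. G x w))"
  proof (rule paired_integral(1)[OF T FG])
    show "continuous_on {0..T} (\<lambda>x. F x v)" for v
      unfolding F_def
      by (intro continuous_intros continuous_on_subset[OF Mellin_wave_continuous[OF s]]) auto
    show "continuous_on {0..T} (\<lambda>x. G x w)" if "w \<in> space M" for w
      unfolding G_def
      by (intro continuous_intros continuous_on_subset[OF integrated_bm_continuous[OF that]]) auto
    show "integrable spectral_control (\<lambda>v. (T powr s * cmod (spectral_kernel n v))\<^sup>2)"
      using L2_integrable[OF paired_L2(1)[OF Suc]] by (simp add: cmod_spectral_wave power_mult_distrib)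
    show "cmod (F x v) \<le> T powr s * cmod (spectral_kernel n v)" if "0 < x" "x \<le> T" for x v
      using that s by (simp add: F_def Mellin_wave_def norm_mult mult.commute mult_right_mono powr_mono2)
  qed
  have left: "of_real (exp (- (s + 1) * t)) * integral {0..T} (\<lambda>x. F x v) = spectral_wave (Suc n) t v" for v
  proof -
    have "integral {0..T} (\<lambda>x. F x v) = spectral_kernel n v * (Mellin_wave (s + 1) v T / (of_real s + 1 + \<i> * of_real v))"
      unfolding F_def using Mellin_wave_integral[OF s less_imp_le[OF T], of v] by simp
    moreover have "of_real (exp (- (s + 1) * t)) * Mellin_wave (s + 1) v T = exp (\<i> * of_real (v * t))"
    proof -
      have "exp (- (s + 1) * t) * T powr (s + 1) = 1"
        by (simp add: T_def powr_def exp_add[symmetric] algebra_simps)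
      then show ?thesis unfolding Mellin_wave_def mult.assoc[symmetric] of_real_mult[symmetric] by (simp add: T_def)
    qed
    moreover have "of_real s + 1 + \<i> * of_real v = of_nat (Suc n) + 1/2 + \<i> * complex_of_real v"
      by (simp add: s_def)
    ultimately show ?thesis
      unfolding spectral_wave_def spectral_kernel_Suc by (simp add: mult_ac)
  qed
  have right: "of_real (exp (- (s + 1) * t)) * integral {0..T} (\<lambda>x. G x w) = of_real (2 * pi * X (Suc n) t w)"
    if "w \<in> space M" for w
  proof -
    have int: "(\<lambda>x. integrated_bm B n x w) integrable_on {0..T}"
      by (intro integrable_continuous_real continuous_on_subset[OF integrated_bm_continuous[OF that]]) auto
    have "((\<lambda>x. complex_of_real (2 * pi * integrated_bm B n x w)) has_integral
        complex_of_real (2 * pi * integral {0..T} (\<lambda>x. integrated_bm B n x w))) {0..T}"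
      by (intro has_integral_of_real has_integral_mult_right integrable_integral int)
    then have "integral {0..T} (\<lambda>x. G x w) = of_real (2 * pi * integral {0..T} (\<lambda>x. integrated_bm B n x w))"
      unfolding G_def by (rule integral_unique)
    then show ?thesis
      by (simp add: rescaled_integrated_bm_def T_def s_def algebra_simps)
  qed
  have "paired (\<lambda>v. of_real (exp (- (s + 1) * t)) * integral {0..T} (\<lambda>x. F x v))
      (\<lambda>w. of_real (exp (- (s + 1) * t)) * integral {0..T} (\<lambda>x. G x w))"
    by (rule paired_cmult[OF R])
  then show ?case
    by (rule paired_cong) (use left right in auto)
qed

end



section \<open>The random spectral measure\<close>

lemma nn_integral_sq_tendsto_zero_iff:
  assumes "\<And>k. f k \<in> L2 M"
  shows "(\<lambda>k. \<integral>\<^sup>+x. ennreal ((cmod (f k x))\<^sup>2) \<partial>M) \<longlonglongrightarrow> 0 \<longleftrightarrow> (\<lambda>k. norm2 M (f k)) \<longlonglongrightarrow> 0"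
proof -
  have "(\<lambda>k. \<integral>\<^sup>+x. ennreal ((cmod (f k x))\<^sup>2) \<partial>M) = (\<lambda>k. ennreal ((norm2 M (f k))\<^sup>2))"
    using assms by (simp add: nn_integral_norm2 del: ennreal_power)
  moreover have "(\<lambda>k. ennreal ((norm2 M (f k))\<^sup>2)) \<longlonglongrightarrow> ennreal 0 \<longleftrightarrow> (\<lambda>k. (norm2 M (f k))\<^sup>2) \<longlonglongrightarrow> 0"
    by (rule tendsto_ennreal_iff) auto
  moreover have "(\<lambda>k. (norm2 M (f k))\<^sup>2) \<longlonglongrightarrow> 0 \<longleftrightarrow> (\<lambda>k. norm2 M (f k)) \<longlonglongrightarrow> 0"
  proof
    assume "(\<lambda>k. (norm2 M (f k))\<^sup>2) \<longlonglongrightarrow> 0"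
    from tendsto_real_sqrt[OF this] show "(\<lambda>k. norm2 M (f k)) \<longlonglongrightarrow> 0" by simp
  next
    assume "(\<lambda>k. norm2 M (f k)) \<longlonglongrightarrow> 0"
    from tendsto_power[OF this, of 2] show "(\<lambda>k. (norm2 M (f k))\<^sup>2) \<longlonglongrightarrow> 0" by simp
  qed
  ultimately show ?thesis by simp
qed

lemma indicator_L2:
  assumes "A \<in> finite_sets \<nu>" shows "(indicator A :: real \<Rightarrow> complex) \<in> L2 \<nu>"
proof -
  have "(\<lambda>v. (cmod (indicator A v))\<^sup>2) = (indicator A :: real \<Rightarrow> real)"
    by (auto simp: indicator_def)
  then show ?thesis using assms by (auto simp: L2_def finite_sets_def)
qed

text \<open>The value 0 is left out of the representation of a simple function: its preimage is the only one that may have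
infinite measure.\<close>

lemma L2_simple_approximation:
  assumes f: "f \<in> L2 \<nu>"
  obtains m :: "nat \<Rightarrow> nat" and c :: "nat \<Rightarrow> nat \<Rightarrow> complex" and A :: "nat \<Rightarrow> nat \<Rightarrow> real set"
  where "\<And>k i. i < m k \<Longrightarrow> A k i \<in> finite_sets \<nu>"
    "(\<lambda>k. norm2 \<nu> (\<lambda>v. (\<Sum>i<m k. c k i * indicator (A k i) v) - f v)) \<longlonglongrightarrow> 0"
proof -
  have fm: "f \<in> borel_measurable \<nu>" using f by (simp add: L2_def)
  from borel_measurable_implies_sequence_metric[OF fm, of 0]
  obtain s where s0: "(\<forall>k. simple_function \<nu> (s k)) \<and> (\<forall>x\<in>space \<nu>. (\<lambda>k. s k x) \<longlonglongrightarrow> f x) \<and>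
      (\<forall>k. \<forall>x\<in>space \<nu>. dist (s k x) 0 \<le> 2 * dist (f x) 0)" ..
  then have s: "\<And>k. simple_function \<nu> (s k)" "\<And>x. x \<in> space \<nu> \<Longrightarrow> (\<lambda>k. s k x) \<longlonglongrightarrow> f x"
    "\<And>k x. x \<in> space \<nu> \<Longrightarrow> cmod (s k x) \<le> 2 * cmod (f x)" by simp_all
  have sm: "s k \<in> borel_measurable \<nu>" for k by (rule borel_measurable_simple_function[OF s(1)])
  have D: "integrable \<nu> (\<lambda>x. (2 * cmod (f x))\<^sup>2)" using L2_integrable[OF f] by (simp add: power_mult_distrib)
  have lim: "(\<lambda>k. norm2 \<nu> (\<lambda>x. s k x - f x)) \<longlonglongrightarrow> 0"
    by (rule norm2_dominated_convergence(1)[OF sm fm D]) (use s in auto)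
  have sL: "s k \<in> L2 \<nu>" for k
    by (rule L2_bound[OF sm D AE_I2]) (rule power_mono[OF s(3) norm_ge_zero])
  define Q where "Q k m c A \<longleftrightarrow> (\<forall>i<m. A i \<in> finite_sets \<nu>) \<and>
      (\<forall>x\<in>space \<nu>. s k x = (\<Sum>i<m. c i * indicator (A i) x))"
    for k and m :: nat and c :: "nat \<Rightarrow> complex" and A :: "nat \<Rightarrow> real set"
  have "\<exists>m c A. Q k m c A" for k
  proof -
    let ?R = "s k ` space \<nu> - {0}"
    have fin: "finite ?R" using s(1)[of k] by (auto simp: simple_function_def)
    obtain c where c: "bij_betw c {..<card ?R} ?R" using ex_bij_betw_nat_finite[OF fin] by (auto simp: atLeast0LessThan)
    define A where "A i = s k -` {c i} \<inter> space \<nu>" for i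
    have Am: "A i \<in> sets \<nu>" for i unfolding A_def using sm[of k] by (auto intro: measurable_sets)
    have "A i \<in> finite_sets \<nu>" if "i < card ?R" for i
    proof -
      have ci: "c i \<noteq> 0" using c that by (auto simp: bij_betw_def)
      have "ennreal ((cmod (c i))\<^sup>2) * emeasure \<nu> (A i) = (\<integral>\<^sup>+x. ennreal ((cmod (c i))\<^sup>2) * indicator (A i) x \<partial>\<nu>)"
        by (rule nn_integral_cmult_indicator[symmetric]) (rule Am)
      also have "\<dots> \<le> (\<integral>\<^sup>+x. ennreal ((cmod (s k x))\<^sup>2) \<partial>\<nu>)"
        by (intro nn_integral_mono) (auto simp: A_def indicator_def)
      also have "\<dots> < \<infinity>" unfolding nn_integral_norm2[OF sL] by simp
      finally have "emeasure \<nu> (A i) < \<infinity>" using ci by (auto simp: ennreal_mult_less_top)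
      then show ?thesis using Am by (simp add: finite_sets_def)
    qed
    moreover have "s k x = (\<Sum>i<card ?R. c i * indicator (A i) x)" if x: "x \<in> space \<nu>" for x
    proof -
      have "(\<Sum>i<card ?R. c i * indicator (A i) x) = (\<Sum>i<card ?R. if s k x = c i then c i else 0)"
        using x by (intro sum.cong) (auto simp: A_def indicator_def)
      also have "\<dots> = (\<Sum>y\<in>?R. if s k x = y then y else 0)"
        by (rule sum.reindex_bij_betw[OF c])
      also have "\<dots> = s k x" using fin x by (auto simp: sum.delta)
      finally show ?thesis by simp
    qed
    ultimately have "Q k (card ?R) c A" unfolding Q_def by (intro conjI allI impI ballI)
    then show ?thesis by blast
  qed
  then obtain m c A where "\<And>k. Q k (m k) (c k) (A k)" by metis
  then have mcA: "\<And>k i. i < m k \<Longrightarrow> A k i \<in> finite_sets \<nu>"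
    "\<And>k x. x \<in> space \<nu> \<Longrightarrow> s k x = (\<Sum>i<m k. c k i * indicator (A k i) x)"
    unfolding Q_def by blast+
  show ?thesis
  proof (rule that[OF mcA(1)])
    have "norm2 \<nu> (\<lambda>v. (\<Sum>i<m k. c k i * indicator (A k i) v) - f v) = norm2 \<nu> (\<lambda>x. s k x - f x)" for k
      unfolding norm2_def using mcA(2) by (auto cong: Bochner_Integration.integral_cong)
    then show "(\<lambda>k. norm2 \<nu> (\<lambda>v. (\<Sum>i<m k. c k i * indicator (A k i) v) - f v)) \<longlonglongrightarrow> 0" using lim by simp
  qed
qed

context brownian
begin

lemma paired_exists: "f \<in> L2 spectral_control \<Longrightarrow> \<exists>Y. paired f Y"
  by (rule paired_total[OF spectral_waves_total])

text \<open>The pairing determines its right-hand side only up to null events, so a version is chosen for each set.\<close>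

definition zeta :: "real set \<Rightarrow> 'a \<Rightarrow> complex" where
  "zeta A = (SOME Y. paired (indicator A) Y)"

lemma paired_zeta:
  "A \<in> finite_sets spectral_control \<Longrightarrow> paired (indicator A) (zeta A)"
  unfolding zeta_def using paired_exists[OF indicator_L2] by (rule someI_ex)

text \<open>Stochastic integrals against \<open>zeta\<close> are the pairing: simple functions are paired with their elementary integrals
by linearity, and the relation is closed. The converse \<open>paired_imp_has_random_integral\<close> approximates by simple
functions and transports the error through the isometry.\<close>

lemma has_random_integral_imp_paired:
  assumes "has_random_integral M spectral_control zeta f Y" shows "paired f Y"
proof -
  obtain m :: "nat \<Rightarrow> nat" and c A where fm: "f \<in> borel_measurable spectral_control" and Ym: "Y \<in> borel_measurable M"
    and A: "\<forall>k. \<forall>i<m k. A k i \<in> finite_sets spectral_control"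
    and lim_f: "(\<lambda>k. \<integral>\<^sup>+ v. ennreal ((cmod (f v - (\<Sum>i<m k. c k i * indicator (A k i) v)))\<^sup>2) \<partial>spectral_control) \<longlonglongrightarrow> 0"
    and lim_Y: "(\<lambda>k. \<integral>\<^sup>+ w. ennreal ((cmod (Y w - (\<Sum>i<m k. c k i * zeta (A k i) w)))\<^sup>2) \<partial>M) \<longlonglongrightarrow> 0"
    using assms unfolding has_random_integral_def by (elim conjE exE) (rule that, assumption+)
  let ?S = "\<lambda>k v. \<Sum>i<m k. c k i * indicator (A k i) v" and ?T = "\<lambda>k w. \<Sum>i<m k. c k i * zeta (A k i) w"
  have R: "paired (?S k) (?T k)" for k
    by (rule paired_sum) (use A paired_zeta in auto)
  have L2I: "g \<in> L2 K" if gm: "g \<in> borel_measurable K" and S: "\<And>k. S k \<in> L2 K"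
    and lim: "(\<lambda>k. \<integral>\<^sup>+ x. ennreal ((cmod (g x - S k x))\<^sup>2) \<partial>K) \<longlonglongrightarrow> 0" for K :: "'z measure" and g S
  proof -
    have "\<forall>\<^sub>F k in sequentially. (\<integral>\<^sup>+ x. ennreal ((cmod (g x - S k x))\<^sup>2) \<partial>K) < \<infinity>"
      by (rule order_tendstoD(2)[OF lim]) simp
    then obtain k where k: "(\<integral>\<^sup>+ x. ennreal ((cmod (g x - S k x))\<^sup>2) \<partial>K) < \<infinity>"
      unfolding eventually_sequentially by blast
    have "S k \<in> borel_measurable K" using S by (simp add: L2_def)
    then have "(\<lambda>x. g x - S k x) \<in> L2 K" using gm k by (intro L2I_nn_integral) auto
    from L2_add[OF this S[of k]] show ?thesis by simp
  qed
  have fL: "f \<in> L2 spectral_control" by (rule L2I[OF fm paired_L2(1)[OF R] lim_f])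
  have YL: "Y \<in> L2 M" by (rule L2I[OF Ym paired_L2(2)[OF R] lim_Y])
  show ?thesis
  proof (rule paired_closed[OF R fL YL])
    show "L2_lim spectral_control ?S f"
      using lim_f unfolding nn_integral_sq_tendsto_zero_iff[OF L2_diff[OF fL paired_L2(1)[OF R]]]
      by (simp add: norm2_minus_commute[of _ f])
    show "L2_lim M ?T Y"
      using lim_Y unfolding nn_integral_sq_tendsto_zero_iff[OF L2_diff[OF YL paired_L2(2)[OF R]]]
      by (simp add: norm2_minus_commute[of _ Y])
  qed
qed

lemma paired_imp_has_random_integral:
  assumes fY: "paired f Y" shows "has_random_integral M spectral_control zeta f Y"
proof -
  obtain m :: "nat \<Rightarrow> nat" and c A where A: "\<And>k i. i < m k \<Longrightarrow> A k i \<in> finite_sets spectral_control"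
    and lim: "L2_lim spectral_control (\<lambda>k v. \<Sum>i<m k. c k i * indicator (A k i) v) f"
    by (rule L2_simple_approximation[OF paired_L2(1)[OF fY]]) blast
  let ?S = "\<lambda>k v. \<Sum>i<m k. c k i * indicator (A k i) v" and ?T = "\<lambda>k w. \<Sum>i<m k. c k i * zeta (A k i) w"
  have R: "paired (?S k) (?T k)" for k
    by (rule paired_sum) (use A paired_zeta in auto)
  note Rd = paired_diff[OF fY R]
  have lim': "(\<lambda>k. norm2 spectral_control (\<lambda>v. f v - ?S k v)) \<longlonglongrightarrow> 0"
    using lim by (simp add: norm2_minus_commute[of _ f])
  have lim_f: "(\<lambda>k. \<integral>\<^sup>+ v. ennreal ((cmod (f v - ?S k v))\<^sup>2) \<partial>spectral_control) \<longlonglongrightarrow> 0"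
    unfolding nn_integral_sq_tendsto_zero_iff[OF paired_L2(1)[OF Rd]] by (rule lim')
  have lim_Y: "(\<lambda>k. \<integral>\<^sup>+ w. ennreal ((cmod (Y w - ?T k w))\<^sup>2) \<partial>M) \<longlonglongrightarrow> 0"
    unfolding nn_integral_sq_tendsto_zero_iff[OF paired_L2(2)[OF Rd]] paired_norm[OF Rd, symmetric] by (rule lim')
  have "f \<in> borel_measurable spectral_control" "Y \<in> borel_measurable M"
    using paired_L2[OF fY] by (simp_all add: L2_def)
  moreover have "\<forall>k. \<forall>i<m k. A k i \<in> finite_sets spectral_control" using A by simp
  ultimately show ?thesis unfolding has_random_integral_def
    by (intro conjI exI[of _ m] exI[of _ c] exI[of _ A] lim_f lim_Y)
qed

lemma gaussian_Re_combination:
  assumes "\<And>i. i \<in> F \<Longrightarrow> paired (f i) (Y i)"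
  shows "centered_gaussian M (\<lambda>w. Re (\<Sum>i\<in>F. c i * Y i w))"
  by (rule gaussian_Re[OF paired_sum[OF assms]])

lemma zeta_gaussian_random_measure:
  "gaussian_random_measure M spectral_control zeta"
  unfolding gaussian_random_measure_def
proof (intro conjI ballI allI impI)
  fix A assume A: "A \<in> finite_sets spectral_control"
  note R = paired_zeta[OF A]
  show "zeta A \<in> borel_measurable M" "integrable M (\<lambda>w. (cmod (zeta A w))\<^sup>2)"
    using paired_L2(2)[OF R] by (simp_all add: L2_def)
  have int: "integrable M (zeta A)" by (rule L2_integrable_L1[OF paired_L2(2)[OF R]])
  have "(LINT w|M. Re (zeta A w)) = 0" by (rule centered_gaussian_mean[OF gaussian_Re[OF R]])
  moreover have "(LINT w|M. Im (zeta A w)) = 0"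
    using centered_gaussian_mean[OF gaussian_Re[OF paired_cmult[OF R, of "- \<i>"]]] by simp
  ultimately show "(LINT w|M. zeta A w) = 0"
    using int by (simp add: complex_eq_iff)
next
  show "jointly_gaussian M (finite_sets spectral_control \<times> (UNIV :: bool set))
       (\<lambda>(A, b) w. if b then Re (zeta A w) else Im (zeta A w))"
    unfolding jointly_gaussian_def
  proof (intro allI impI)
    fix F :: "(real set \<times> bool) set" and c
    assume F: "finite F \<and> F \<subseteq> finite_sets spectral_control \<times> UNIV"
    have "centered_gaussian M (\<lambda>w. Re (\<Sum>i\<in>F. (if snd i then of_real (c i) else - \<i> * of_real (c i)) * zeta (fst i) w))"
      using F by (intro gaussian_Re_combination[where f="\<lambda>i. indicator (fst i)"] paired_zeta) auto
    moreover have "Re (\<Sum>i\<in>F. (if snd i then of_real (c i) else - \<i> * of_real (c i)) * zeta (fst i) w) =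
      (\<Sum>i\<in>F. c i * (case i of (A, b) \<Rightarrow> \<lambda>w. if b then Re (zeta A w) else Im (zeta A w)) w)" for w
      unfolding Re_sum by (intro sum.cong) (auto split: prod.splits)
    ultimately show "gaussian_rv M (\<lambda>w. \<Sum>i\<in>F. c i * (case i of (A, b) \<Rightarrow> \<lambda>w. if b then Re (zeta A w) else Im (zeta A w)) w)"
      by (simp add: centered_gaussian_rv)
  qed
next
  fix A :: "nat \<Rightarrow> real set"
  assume A: "range A \<subseteq> finite_sets spectral_control \<and> disjoint_family A \<and> (\<Union>i. A i) \<in> finite_sets spectral_control"
  let ?I = "\<lambda>S. indicator S :: real \<Rightarrow> complex"
  have R: "paired (\<lambda>v. \<Sum>i<k. ?I (A i) v) (\<lambda>w. \<Sum>i<k. zeta (A i) w)" for k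
    using paired_sum[of "{..<k}" "\<lambda>i. ?I (A i)" "\<lambda>i. zeta (A i)" "\<lambda>_. 1"] paired_zeta A by auto
  have RU: "paired (?I (\<Union>i. A i)) (zeta (\<Union>i. A i))" using A by (intro paired_zeta) auto
  note Rd = paired_diff[OF RU R]
  have disj: "(\<Sum>i<k. ?I (A i) v) = ?I (\<Union>i<k. A i) v" for k v
    using A by (intro indicator_UN_disjoint[symmetric]) (auto intro: disjoint_family_on_mono)
  have "L2_lim spectral_control (\<lambda>k v. \<Sum>i<k. ?I (A i) v) (?I (\<Union>i. A i))"
  proof (rule norm2_dominated_convergence(1))
    show "(\<lambda>v. \<Sum>i<k. ?I (A i) v) \<in> borel_measurable spectral_control" for k
      using paired_L2(1)[OF R] by (simp add: L2_def)
    show "?I (\<Union>i. A i) \<in> borel_measurable spectral_control"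
      using paired_L2(1)[OF RU] by (simp add: L2_def)
    show "integrable spectral_control (\<lambda>v. (cmod (?I (\<Union>i. A i) v))\<^sup>2)"
      by (rule L2_integrable[OF paired_L2(1)[OF RU]])
    show "AE v in spectral_control. (\<lambda>k. \<Sum>i<k. ?I (A i) v) \<longlonglongrightarrow> ?I (\<Union>i. A i) v"
      unfolding disj by (intro AE_I2 LIMSEQ_indicator_UN)
    show "AE v in spectral_control. cmod (\<Sum>i<k. ?I (A i) v) \<le> cmod (?I (\<Union>i. A i) v)" for k
      unfolding disj by (intro AE_I2) (auto simp: indicator_def)
  qed
  then have "(\<lambda>k. norm2 spectral_control (\<lambda>v. ?I (\<Union>i. A i) v - (\<Sum>i<k. ?I (A i) v))) \<longlonglongrightarrow> 0"
    by (simp add: norm2_minus_commute[of _ "?I (\<Union>i. A i)"])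
  then show "(\<lambda>k. \<integral>\<^sup>+ w. ennreal ((cmod (zeta (\<Union>i. A i) w - (\<Sum>i<k. zeta (A i) w)))\<^sup>2) \<partial>M) \<longlonglongrightarrow> 0"
    unfolding nn_integral_sq_tendsto_zero_iff[OF paired_L2(2)[OF Rd]] paired_norm[OF Rd, symmetric] .
next
  fix f g :: "real \<Rightarrow> complex" and Y Y' :: "'a \<Rightarrow> complex"
  assume "has_random_integral M spectral_control zeta f Y \<and> has_random_integral M spectral_control zeta g Y'"
  then have "paired f Y" "paired g Y'" using has_random_integral_imp_paired by blast+
  from paired_inner[OF this] show "(LINT w|M. Y w * cnj (Y' w)) = (LINT v|spectral_control. f v * cnj (g v))"
    by (simp add: inner2_def)
qed

section \<open>Joint Gaussianity and stationarity\<close>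

lemma X_measurable [measurable]: "X n t \<in> borel_measurable M"
proof -
  have "(\<lambda>w. complex_of_real (2 * pi * X n t w)) \<in> borel_measurable M"
    using paired_L2(2)[OF paired_X] by (simp add: L2_def)
  then have "(\<lambda>w. Re (complex_of_real (2 * pi * X n t w)) / (2 * pi)) \<in> borel_measurable M" by measurable
  then show ?thesis by simp
qed

lemma X_combination_paired:
  "paired (\<lambda>v. \<Sum>i\<in>F. of_real (c i / (2 * pi)) * spectral_wave (fst i) (snd i + h) v)
    (\<lambda>w. of_real (\<Sum>i\<in>F. c i * X (fst i) (snd i + h) w))"
proof -
  have "paired (\<lambda>v. \<Sum>i\<in>F. of_real (c i / (2 * pi)) * spectral_wave (fst i) (snd i + h) v)
    (\<lambda>w. \<Sum>i\<in>F. of_real (c i / (2 * pi)) * of_real (2 * pi * X (fst i) (snd i + h) w))"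
    by (rule paired_sum[OF paired_X])
  moreover have "(\<Sum>i\<in>F. of_real (c i / (2 * pi)) * of_real (2 * pi * X (fst i) (snd i + h) w)) =
      complex_of_real (\<Sum>i\<in>F. c i * X (fst i) (snd i + h) w)" for w
  proof -
    have "of_real (a / (2 * pi)) * of_real (2 * pi * b) = complex_of_real (a * b)" for a b
      unfolding of_real_mult[symmetric] by simp
    then show ?thesis by (simp only: of_real_sum)
  qed
  ultimately show ?thesis by (simp only:)
qed

lemma X_combination_gaussian: "centered_gaussian M (\<lambda>w. \<Sum>i\<in>F. c i * X (fst i) (snd i + h) w)"
  using gaussian_Re[OF X_combination_paired] by simp

lemma X_jointly_gaussian: "jointly_gaussian M UNIV (\<lambda>(n, t). X n t)"
  unfolding jointly_gaussian_def
proof (intro allI impI)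
  fix F :: "(nat \<times> real) set" and c
  show "gaussian_rv M (\<lambda>w. \<Sum>i\<in>F. c i * (case i of (n, t) \<Rightarrow> X n t) w)"
    using centered_gaussian_rv[OF X_combination_gaussian[where F=F and c=c and h=0]]
    by (simp add: case_prod_beta)
qed

lemma X_jointly_stationary: "jointly_stationary M X"
  unfolding jointly_stationary_def
proof (intro conjI allI impI X_measurable)
  fix N :: nat and T :: "real set" and h :: real assume T: "finite T"
  let ?I = "{..N} \<times> T"
  have var: "(LINT w|M. (\<Sum>i\<in>?I. c i * X (fst i) (snd i + h) w)\<^sup>2) = (LINT w|M. (\<Sum>i\<in>?I. c i * X (fst i) (snd i) w)\<^sup>2)" for c
  proof -
    let ?S = "\<lambda>h v. \<Sum>i\<in>?I. of_real (c i / (2 * pi)) * spectral_wave (fst i) (snd i + h) v"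
    have *: "(LINT w|M. (\<Sum>i\<in>?I. c i * X (fst i) (snd i + h) w)\<^sup>2) =
      (norm2 spectral_control (?S h))\<^sup>2" for h
      unfolding paired_norm[OF X_combination_paired] by (simp add: norm2_sq del: of_real_sum)
    have "?S h v =
      iexp (v * h) * ?S 0 v" for v
      unfolding spectral_wave_shift sum_distrib_left by (intro sum.cong) (auto simp: mult_ac)
    then have "norm2 spectral_control (?S h) =
      norm2 spectral_control (?S 0)"
      by (simp add: norm2_def norm_mult)
    then show ?thesis using *[of h] *[of 0] by simp
  qed
  have "distr M (PiM ?I (\<lambda>_. borel)) (\<lambda>w. \<lambda>i\<in>?I. X (fst i) (snd i + h) w) =
      distr M (PiM ?I (\<lambda>_. borel)) (\<lambda>w. \<lambda>i\<in>?I. X (fst i) (snd i) w)"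
  proof (rule Cramer_Wold[OF prob_space_axioms prob_space_axioms])
    fix c
    show "(LINT w|M. iexp (\<Sum>i\<in>?I. c i * X (fst i) (snd i + h) w)) = (LINT w|M. iexp (\<Sum>i\<in>?I. c i * X (fst i) (snd i) w))"
      using centered_gaussianD(3)[OF X_combination_gaussian[where F="?I" and c=c and h=h], of 1]
        centered_gaussianD(3)[OF X_combination_gaussian[where F="?I" and c=c and h=0], of 1] var[of c] by simp
  qed (use T in auto)
  then show "distr M (PiM ?I (\<lambda>_. borel)) (\<lambda>w. \<lambda>(n, t)\<in>?I. X n (t + h) w) =
      distr M (PiM ?I (\<lambda>_. borel)) (\<lambda>w. \<lambda>(n, t)\<in>?I. X n t w)"
    by (simp only: case_prod_unfold)
qed

section \<open>The white noise\<close>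

text \<open>The distribution function of the white noise, a pathwise solution of \<open>dZ = dX\<^sub>0 + X\<^sub>0/2 dt\<close>. One of the two
integrals is always over an empty or degenerate interval, so their difference is the oriented integral from 0 to \<open>t\<close>.\<close>

definition noise_path :: "real \<Rightarrow> 'a \<Rightarrow> real" where
  "noise_path t w = X 0 t w + (integral {0..t} (\<lambda>x. X 0 x w) - integral {t..0} (\<lambda>x. X 0 x w)) / 2"

lemma noise_path_increment:
  assumes w: "w \<in> space M" and st: "s \<le> t"
  shows "noise_path t w - noise_path s w = X 0 t w - X 0 s w + integral {s..t} (\<lambda>x. X 0 x w) / 2"
proof -
  have int: "(\<lambda>x. X 0 x w) integrable_on {a..b}" for a b
    by (rule integrable_continuous_real[OF X_continuous[OF w]])
  have comb: "integral {a..b} (\<lambda>x. X 0 x w) + integral {b..c} (\<lambda>x. X 0 x w) = integral {a..c} (\<lambda>x. X 0 x w)"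
    if "a \<le> b" "b \<le> c" for a b c
    by (rule Henstock_Kurzweil_Integration.integral_combine[OF that int])
  have "(integral {0..t} (\<lambda>x. X 0 x w) - integral {t..0} (\<lambda>x. X 0 x w)) -
      (integral {0..s} (\<lambda>x. X 0 x w) - integral {s..0} (\<lambda>x. X 0 x w)) = integral {s..t} (\<lambda>x. X 0 x w)"
  proof -
    consider "0 \<le> s" | "s < 0" "0 \<le> t" | "t < 0" by linarith
    then show ?thesis
    proof cases
      case 1
      then show ?thesis using comb[of 0 s t] st
        by (cases "s = 0"; cases "t = 0") (auto simp: algebra_simps)
    next
      case 2
      then show ?thesis using comb[of s 0 t] by (cases "t = 0") (auto simp: algebra_simps)
    next
      case 3
      then show ?thesis using comb[of s t 0] st by (auto simp: algebra_simps)
    qed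
  qed
  then show ?thesis by (simp add: noise_path_def field_simps)
qed

definition scaled_noise :: "real \<Rightarrow> real \<Rightarrow> 'a \<Rightarrow> complex" where
  "scaled_noise s t w = scaled_OU t w - scaled_OU s w + 1/2 * integral {s..t} (\<lambda>x. scaled_OU x w)"

lemma scaled_noise_eq:
  assumes w: "w \<in> space M" and st: "s \<le> t"
  shows "scaled_noise s t w = of_real (2 * pi * (noise_path t w - noise_path s w))"
proof -
  have "((\<lambda>x. complex_of_real (2 * pi * X 0 x w)) has_integral
      complex_of_real (2 * pi * integral {s..t} (\<lambda>x. X 0 x w))) {s..t}"
    by (intro has_integral_of_real has_integral_mult_right integrable_integral
        integrable_continuous_real[OF X_continuous[OF w]])
  then have "integral {s..t} (\<lambda>x. scaled_OU x w) = of_real (2 * pi * integral {s..t} (\<lambda>x. X 0 x w))"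
    unfolding scaled_OU_def by (rule integral_unique)
  then show ?thesis unfolding scaled_noise_def noise_path_increment[OF assms] by (simp add: scaled_OU_def algebra_simps)
qed

lemma OU_integral_paired:
  assumes st: "s < t"
  shows "paired (\<lambda>v. integral {s..t} (\<lambda>x. spectral_wave 0 x v)) (\<lambda>w. integral {s..t} (\<lambda>x. scaled_OU x w))"
    and "\<And>H. H \<in> L2 M \<Longrightarrow> continuous_on {s..t} (\<lambda>x. inner2 M (scaled_OU x) H) \<Longrightarrow>
      inner2 M (\<lambda>w. integral {s..t} (\<lambda>x. scaled_OU x w)) H = integral {s..t} (\<lambda>x. inner2 M (scaled_OU x) H)"
proof -
  have F: "continuous_on {s..t} (\<lambda>x. spectral_wave 0 x v)" for v
    unfolding spectral_wave_def by (intro continuous_intros)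
  have G: "continuous_on {s..t} (\<lambda>x. scaled_OU x w)" if "w \<in> space M" for w
    unfolding scaled_OU_def by (intro continuous_intros X_continuous[OF that])
  have D: "integrable spectral_control (\<lambda>v. (cmod (spectral_kernel 0 v))\<^sup>2)"
    using L2_integrable[OF spectral_wave_0_L2[of 0]] by (simp add: cmod_spectral_wave)
  note RI = paired_integral[of s t "spectral_wave 0" scaled_OU, OF st paired_base F G D]
  show "paired (\<lambda>v. integral {s..t} (\<lambda>x. spectral_wave 0 x v)) (\<lambda>w. integral {s..t} (\<lambda>x. scaled_OU x w))"
    by (rule RI(1)) (simp_all add: cmod_spectral_wave)
  show "inner2 M (\<lambda>w. integral {s..t} (\<lambda>x. scaled_OU x w)) H = integral {s..t} (\<lambda>x. inner2 M (scaled_OU x) H)"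
    if "H \<in> L2 M" "continuous_on {s..t} (\<lambda>x. inner2 M (scaled_OU x) H)" for H
    by (rule RI(2)) (simp_all add: cmod_spectral_wave that)
qed

lemma paired_noise:
  assumes st: "s < t"
  shows "paired (\<lambda>v. integral {s..t} (\<lambda>u. exp (\<i> * of_real (v * u)))) (scaled_noise s t)"
proof -
  have "paired (\<lambda>v. (spectral_wave 0 t v - spectral_wave 0 s v) + 1/2 * integral {s..t} (\<lambda>x. spectral_wave 0 x v)) (scaled_noise s t)"
    unfolding scaled_noise_def[abs_def] by (intro paired_add paired_diff paired_cmult paired_base OU_integral_paired(1) st)
  moreover have "(spectral_wave 0 t v - spectral_wave 0 s v) + 1/2 * integral {s..t} (\<lambda>x. spectral_wave 0 x v) =
      integral {s..t} (\<lambda>u. exp (\<i> * of_real (v * u)))" for v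
  proof -
    let ?J = "integral {s..t} (\<lambda>u. exp (\<i> * complex_of_real (v * u)))"
    have "((\<lambda>u. \<i> * of_real v * exp (\<i> * complex_of_real (v * u))) has_integral
        exp (\<i> * of_real (v * t)) - exp (\<i> * of_real (v * s))) {s..t}"
    proof (rule fundamental_theorem_of_calculus)
      fix u
      have "((\<lambda>z. exp (\<i> * (of_real v * z))) has_field_derivative \<i> * of_real v * exp (\<i> * (of_real v * of_real u))) (at (of_real u))"
        by (auto intro!: derivative_eq_intros)
      from has_vector_derivative_real_field[OF this]
      show "((\<lambda>u. exp (\<i> * complex_of_real (v * u))) has_vector_derivative \<i> * of_real v * exp (\<i> * complex_of_real (v * u))) (at u within {s..t})"
        by simp
    qed (use st in simp)
    then have J: "\<i> * of_real v * ?J = exp (\<i> * of_real (v * t)) - exp (\<i> * of_real (v * s))"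
      by (simp add: integral_unique flip: Henstock_Kurzweil_Integration.integral_mult_right)
    have wave: "integral {s..t} (\<lambda>x. spectral_wave 0 x v) = spectral_kernel 0 v * ?J"
      by (simp add: spectral_wave_def)
    have step: "g * a - g * b + 1/2 * (g * J) = g * (1/2 + w) * J" if "w * J = a - b" for g a b w J :: complex
    proof -
      have "g * a - g * b = g * (w * J)" unfolding that by (rule right_diff_distrib[symmetric])
      then show ?thesis by (simp add: algebra_simps)
    qed
    have "(spectral_wave 0 t v - spectral_wave 0 s v) + 1/2 * integral {s..t} (\<lambda>x. spectral_wave 0 x v) =
        spectral_kernel 0 v * (1/2 + \<i> * of_real v) * ?J"
      unfolding wave unfolding spectral_wave_def by (rule step[OF J])
    also have "spectral_kernel 0 v * (1/2 + \<i> * of_real v) = 1"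
      using spectral_kernel_denominator[of 0 v] by (simp add: spectral_kernel_0)
    finally show ?thesis by simp
  qed
  ultimately show ?thesis by (simp only:)
qed

lemma inner_noise_left:
  assumes st: "s < t" and H: "H \<in> L2 M" and cont: "continuous_on {s..t} (\<lambda>x. inner2 M (scaled_OU x) H)"
  shows "inner2 M (scaled_noise s t) H = inner2 M (scaled_OU t) H - inner2 M (scaled_OU s) H + 1/2 * integral {s..t} (\<lambda>x. inner2 M (scaled_OU x) H)"
proof -
  have L: "(\<lambda>w. integral {s..t} (\<lambda>x. scaled_OU x w)) \<in> L2 M" by (rule paired_L2(2)[OF OU_integral_paired(1)[OF st]])
  show ?thesis
    unfolding scaled_noise_def[abs_def]
    by (subst inner2_add_left[OF L2_diff[OF U_L2 U_L2] L2_cmult[OF L] H])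
       (simp only: inner2_diff_left[OF U_L2 U_L2 H] inner2_cmult_left OU_integral_paired(2)[OF st H cont])
qed

lemma exp_has_integral:
  fixes k :: real assumes "k \<noteq> 0" "s \<le> t"
  shows "((\<lambda>y. exp (k * (y - x))) has_integral (exp (k * (t - x)) - exp (k * (s - x))) / k) {s..t}"
proof -
  have "((\<lambda>y. exp (k * (y - x))) has_integral exp (k * (t - x)) / k - exp (k * (s - x)) / k) {s..t}"
    by (rule fundamental_theorem_of_calculus[OF assms(2)])
       (use assms in \<open>auto intro!: derivative_eq_intros simp: has_real_derivative_iff_has_vector_derivative[symmetric]\<close>)
  then show ?thesis by (simp add: diff_divide_distrib)
qed

text \<open>The noise after time \<open>s\<close> is orthogonal to the Ornstein-Uhlenbeck process up to time \<open>s\<close>. This gives the orthogonality of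
noise increments over disjoint intervals, and the second case gives their variance.\<close>

lemma inner_noise_OU:
  assumes st: "s < t" and x: "x \<le> t"
  shows "inner2 M (scaled_noise s t) (scaled_OU x) = of_real (8 * pi\<^sup>2 * (if x \<le> s then 0 else 1 - exp (- (x - s) / 2)))"
proof -
  let ?K = "\<lambda>y. exp (- \<bar>y - x\<bar> / 2)"
  have cont: "continuous_on {s..t} (\<lambda>y. inner2 M (scaled_OU y) (scaled_OU x))"
    unfolding scaled_OU_gram by (intro continuous_intros) simp
  have Kint: "?K integrable_on {s..t}" by (intro integrable_continuous_real continuous_intros) simp
  have K: "?K t - ?K s + 1/2 * integral {s..t} ?K = 2 * (if x \<le> s then 0 else 1 - exp (- (x - s) / 2))"
  proof (cases "x \<le> s")
    case True
    have "(?K has_integral (exp (- (1/2) * (t - x)) - exp (- (1/2) * (s - x))) / (- (1/2))) {s..t}"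
      by (rule has_integral_eq[OF _ exp_has_integral]) (use True st in \<open>auto simp: diff_divide_distrib\<close>)
    from integral_unique[OF this] show ?thesis using True st by (simp add: diff_divide_distrib)
  next
    case False
    have 1: "(?K has_integral (exp (1/2 * (x - x)) - exp (1/2 * (s - x))) / (1/2)) {s..x}"
      by (rule has_integral_eq[OF _ exp_has_integral]) (use False in auto)
    have 2: "(?K has_integral (exp (- (1/2) * (t - x)) - exp (- (1/2) * (x - x))) / (- (1/2))) {x..t}"
      by (rule has_integral_eq[OF _ exp_has_integral]) (use x in \<open>auto simp: diff_divide_distrib\<close>)
    have "integral {s..t} ?K = integral {s..x} ?K + integral {x..t} ?K"
      using Henstock_Kurzweil_Integration.integral_combine[OF _ x Kint] False by simp
    then show ?thesis unfolding integral_unique[OF 1] integral_unique[OF 2]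
      using False x by (simp add: diff_divide_distrib add_divide_distrib)
  qed
  have "((\<lambda>y. complex_of_real (4 * pi\<^sup>2 * ?K y)) has_integral of_real (4 * pi\<^sup>2 * integral {s..t} ?K)) {s..t}"
    by (intro has_integral_of_real has_integral_mult_right integrable_integral Kint)
  then have "integral {s..t} (\<lambda>y. inner2 M (scaled_OU y) (scaled_OU x)) = of_real (4 * pi\<^sup>2 * integral {s..t} ?K)"
    unfolding scaled_OU_gram by (rule integral_unique)
  then have "inner2 M (scaled_noise s t) (scaled_OU x) = of_real (4 * pi\<^sup>2 * (?K t - ?K s + 1/2 * integral {s..t} ?K))"
    unfolding inner_noise_left[OF st U_L2 cont] scaled_OU_gram by (simp add: algebra_simps)
  then show ?thesis unfolding K by simp
qed

lemma inner_OU_noise: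
  assumes "s < t" "x \<le> t"
  shows "inner2 M (scaled_OU x) (scaled_noise s t) = of_real (8 * pi\<^sup>2 * (if x \<le> s then 0 else 1 - exp (- (x - s) / 2)))"
  by (subst inner2_commute, subst inner_noise_OU[OF assms]) simp

lemma scaled_noise_L2: "s < t \<Longrightarrow> scaled_noise s t \<in> L2 M"
  by (rule paired_L2(2)[OF paired_noise])

lemma inner_noise_disjoint:
  assumes "s' < t'" "t' \<le> s" "s < t" shows "inner2 M (scaled_noise s' t') (scaled_noise s t) = 0"
proof -
  have zero: "inner2 M (scaled_OU x) (scaled_noise s t) = 0" if "x \<le> s" for x
    using inner_OU_noise[OF assms(3), of x] that assms by simp
  have cont: "continuous_on {s'..t'} (\<lambda>x. inner2 M (scaled_OU x) (scaled_noise s t))"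
    by (rule continuous_on_eq[OF continuous_on_const[of _ 0]]) (use zero assms in auto)
  have "integral {s'..t'} (\<lambda>x. inner2 M (scaled_OU x) (scaled_noise s t)) = integral {s'..t'} (\<lambda>x. 0)"
    by (rule Henstock_Kurzweil_Integration.integral_cong) (use zero assms in auto)
  then show ?thesis
    unfolding inner_noise_left[OF assms(1) scaled_noise_L2[OF assms(3)] cont] using assms by (simp add: zero)
qed

lemma inner_noise_self:
  assumes st: "s < t" shows "inner2 M (scaled_noise s t) (scaled_noise s t) = of_real (4 * pi\<^sup>2 * (t - s))"
proof -
  have eq: "inner2 M (scaled_OU x) (scaled_noise s t) = of_real (8 * pi\<^sup>2 * (1 - exp (- (1/2) * (x - s))))" if "x \<in> {s..t}" for x
  proof -
    have "- (1/2) * (x - s) = - (x - s) / 2" by linarith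
    moreover have "(if x \<le> s then 0 else 1 - exp (- (x - s) / 2)) = 1 - exp (- (x - s) / 2)"
      using that by auto
    ultimately show ?thesis using inner_OU_noise[OF st, of x] that by (simp only: atLeastAtMost_iff)
  qed
  have cont: "continuous_on {s..t} (\<lambda>x. inner2 M (scaled_OU x) (scaled_noise s t))"
    by (rule continuous_on_eq[OF _ eq[symmetric]]) (intro continuous_intros, assumption)
  have "((\<lambda>x. complex_of_real (8 * pi\<^sup>2 * (1 - exp (- (1/2) * (x - s))))) has_integral
      of_real (8 * pi\<^sup>2 * (1 * (t - s) - (exp (- (1/2) * (t - s)) - exp (- (1/2) * (s - s))) / (- (1/2))))) {s..t}"
  proof (intro has_integral_of_real has_integral_mult_right has_integral_diff exp_has_integral)
    show "((\<lambda>x. 1::real) has_integral 1 * (t - s)) {s..t}"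
      using has_integral_const_real[of "1::real" s t] st by simp
  qed (use st in auto)
  then have "integral {s..t} (\<lambda>x. inner2 M (scaled_OU x) (scaled_noise s t)) =
      of_real (8 * pi\<^sup>2 * (1 * (t - s) - (exp (- (1/2) * (t - s)) - exp (- (1/2) * (s - s))) / (- (1/2))))"
    by (intro integral_unique) (rule has_integral_eq[rotated], auto simp: eq)
  then show ?thesis
    unfolding inner_noise_left[OF st scaled_noise_L2[OF st] cont] using st by (simp add: eq field_simps)
qed

lemma noise_path_measurable [measurable]: "noise_path t \<in> borel_measurable M"
proof -
  have int: "(\<lambda>w. integral {a..b} (\<lambda>x. X 0 x w)) \<in> borel_measurable M" for a b
  proof (cases "a \<le> b")
    case True
    show ?thesis
      by (rule borel_measurable_LIMSEQ_metric[OF _ Riemann_sums_tendsto[OF True X_continuous]]) measurable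
  qed simp
  show ?thesis unfolding noise_path_def[abs_def] using int by measurable
qed

lemma inner_noise_covariance:
  assumes "s \<le> t" "s' \<le> t'"
  shows "inner2 M (scaled_noise s t) (scaled_noise s' t') = of_real (4 * pi\<^sup>2 * (LINT w|M. (noise_path t w - noise_path s w) * (noise_path t' w - noise_path s' w)))"
proof -
  have "inner2 M (scaled_noise s t) (scaled_noise s' t') = (LINT w|M. complex_of_real (4 * pi\<^sup>2 * ((noise_path t w - noise_path s w) * (noise_path t' w - noise_path s' w))))"
    unfolding inner2_def using assms
    by (intro Bochner_Integration.integral_cong) (auto simp: scaled_noise_eq power2_eq_square)
  also have "\<dots> = complex_of_real (LINT w|M. 4 * pi\<^sup>2 * ((noise_path t w - noise_path s w) * (noise_path t' w - noise_path s' w)))" by (rule integral_complex_of_real)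
  finally show ?thesis by (simp only: integral_mult_right_zero)
qed

lemma noise_path_increments_gaussian:
  assumes "\<And>i. i \<in> F \<Longrightarrow> s i < t i"
  shows "centered_gaussian M (\<lambda>w. \<Sum>i\<in>F. c i * (noise_path (t i) w - noise_path (s i) w))"
proof -
  have "centered_gaussian M (\<lambda>w. Re (\<Sum>i\<in>F. of_real (c i / (2 * pi)) * scaled_noise (s i) (t i) w))"
    by (rule gaussian_Re_combination[OF paired_noise]) (rule assms)
  then show ?thesis
  proof (rule centered_gaussian_cong_AE)
    show "AE w in M. (\<Sum>i\<in>F. c i * (noise_path (t i) w - noise_path (s i) w)) = Re (\<Sum>i\<in>F. of_real (c i / (2 * pi)) * scaled_noise (s i) (t i) w)"
    proof (rule AE_I2)
      fix w assume w: "w \<in> space M"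
      show "(\<Sum>i\<in>F. c i * (noise_path (t i) w - noise_path (s i) w)) = Re (\<Sum>i\<in>F. of_real (c i / (2 * pi)) * scaled_noise (s i) (t i) w)"
        unfolding Re_sum by (intro sum.cong refl) (simp add: scaled_noise_eq[OF w less_imp_le[OF assms]])
    qed
  qed measurable
qed

lemma noise_path_independent_gaussian_increments: "independent_gaussian_increments M UNIV noise_path"
  unfolding independent_gaussian_increments_def
proof (intro conjI ballI allI impI noise_path_measurable)
  fix s t :: real assume st: "s < t"
  have "complex_of_real (4 * pi\<^sup>2 * (LINT w|M. (noise_path t w - noise_path s w) * (noise_path t w - noise_path s w))) = of_real (4 * pi\<^sup>2 * (t - s))"
    using inner_noise_covariance[of s t s t] inner_noise_self[OF st] st by simp
  then have var: "(LINT w|M. (noise_path t w - noise_path s w)\<^sup>2) = (sqrt (t - s))\<^sup>2"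
    using st unfolding of_real_eq_iff by (simp add: power2_eq_square)
  have "centered_gaussian M (\<lambda>w. noise_path t w - noise_path s w)"
    using noise_path_increments_gaussian[of "{()}" "\<lambda>_. s" "\<lambda>_. t" "\<lambda>_. 1"] st by simp
  then show "distributed M lborel (\<lambda>w. noise_path t w - noise_path s w) (normal_density 0 (sqrt (t - s)))"
    by (rule centered_gaussian_imp_normal[OF _ var]) (use st in simp)
next
  fix m :: nat and \<tau> :: "nat \<Rightarrow> real"
  assume \<tau>: "(\<forall>i\<le>m. \<tau> i \<in> UNIV) \<and> (\<forall>i<m. \<tau> i < \<tau> (Suc i))"
  have mono: "\<tau> i \<le> \<tau> j" if "i \<le> j" "j \<le> m" for i j
    using that
  proof (induction j rule: dec_induct)
    case (step k)
    then have "\<tau> k < \<tau> (Suc k)" "\<tau> i \<le> \<tau> k" using \<tau> by simp_all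
    then show ?case by linarith
  qed simp
  have uncorr: "(LINT w|M. (noise_path (\<tau> (Suc i)) w - noise_path (\<tau> i) w) * (noise_path (\<tau> (Suc j)) w - noise_path (\<tau> j) w)) = 0"
    if "i < j" "j < m" for i j
  proof -
    have "\<tau> i < \<tau> (Suc i)" "\<tau> j < \<tau> (Suc j)" "\<tau> (Suc i) \<le> \<tau> j" using \<tau> that mono[of "Suc i" j] by auto
    then show ?thesis
      using inner_noise_covariance[of "\<tau> i" "\<tau> (Suc i)" "\<tau> j" "\<tau> (Suc j)"] inner_noise_disjoint[of "\<tau> i" "\<tau> (Suc i)" "\<tau> j" "\<tau> (Suc j)"]
      by simp
  qed
  show "indep_vars (\<lambda>_. borel) (\<lambda>i w. noise_path (\<tau> (Suc i)) w - noise_path (\<tau> i) w) {..<m}"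
  proof (rule gaussian_uncorrelated_indep)
    show "centered_gaussian M (\<lambda>w. \<Sum>i<m. c i * (noise_path (\<tau> (Suc i)) w - noise_path (\<tau> i) w))" for c
      by (rule noise_path_increments_gaussian) (use \<tau> in simp)
    fix i j assume "i \<in> {..<m}" "j \<in> {..<m}" "i \<noteq> j"
    then show "(LINT w|M. (noise_path (\<tau> (Suc i)) w - noise_path (\<tau> i) w) * (noise_path (\<tau> (Suc j)) w - noise_path (\<tau> j) w)) = 0"
      using uncorr[of i j] uncorr[of j i] by (cases "i < j") (auto simp: mult.commute)
  qed auto
qed

lemma white_noise: "white_noise_spectral_measure M noise_path zeta"
  unfolding white_noise_spectral_measure_def
proof (intro conjI allI impI noise_path_independent_gaussian_increments)
  fix s t :: real assume st: "s < t"
  show "\<exists>Y. has_random_integral M spectral_control zeta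
         (\<lambda>v. integral {s..t} (\<lambda>u. exp (\<i> * of_real (v * u)))) Y \<and>
       (AE w in M. of_real (noise_path t w - noise_path s w) = 1 / (2 * of_real pi) * Y w)"
    using paired_imp_has_random_integral[OF paired_noise[OF st]] st
    by (intro exI[of _ "scaled_noise s t"] conjI AE_I2) (auto simp: scaled_noise_eq)
qed

lemma X_spectral_representation:
  "has_random_integral M spectral_control zeta
     (\<lambda>v. spectral_kernel n v * exp (\<i> * of_real (v * t))) (\<lambda>w. of_real (2 * pi * X n t w))"
  using paired_imp_has_random_integral[OF paired_X] unfolding spectral_wave_def[abs_def] .

end

theorem proposition3p1:
  fixes M :: "'a measure" and B :: "real \<Rightarrow> 'a \<Rightarrow> real"
  assumes "prob_space M"
    and "standard_brownian_motion M B"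
  defines "X \<equiv> rescaled_integrated_bm B"
  shows "jointly_gaussian M (UNIV :: (nat \<times> real) set) (\<lambda>(n, t). X n t) \<and>
    jointly_stationary M X \<and>
    (\<exists>\<zeta>. gaussian_spectral_measure M \<zeta> \<and>
      (\<forall>n t. \<exists>Y.
         has_random_integral M spectral_control \<zeta>
           (\<lambda>v. spectral_kernel n v * exp (\<i> * of_real (v * t))) Y \<and>
         (AE \<omega> in M. of_real (X n t \<omega>) = 1 / (2 * of_real pi) * Y \<omega>)))"
proof -
  interpret brownian M B
    using assms(1,2) by (simp add: brownian_def brownian_axioms_def)
  show ?thesis
    unfolding X_def
  proof (intro conjI X_jointly_gaussian X_jointly_stationary exI[of _ zeta] allI)
    show "gaussian_spectral_measure M zeta"
      unfolding gaussian_spectral_measure_def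
      using zeta_gaussian_random_measure white_noise by blast
    fix n t
    show "\<exists>Y. has_random_integral M spectral_control zeta
           (\<lambda>v. spectral_kernel n v * exp (\<i> * of_real (v * t))) Y \<and>
         (AE \<omega> in M. of_real (rescaled_integrated_bm B n t \<omega>) = 1 / (2 * of_real pi) * Y \<omega>)"
      by (intro exI[of _ "\<lambda>\<omega>. of_real (2 * pi * rescaled_integrated_bm B n t \<omega>)"] conjI X_spectral_representation) simp
  qed
qed


end
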